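(* Let $n\ge1$, $G=GL_n(\mathbb{C})$, and $\mathscr{Z}_n=\{(A,B)\in M_n(\mathbb{C})^2 : AB+BA=0\}$ with $G$ acting by simultaneous conjugation. Then the GIT quotient $\mathscr{Z}_n/\!/G$ is of pure dimension $n$: for every $(p,m,r)\in\mathbb{Z}_{\ge0}^3$ with $2p+m+r=n$, the quotient $\mathscr{Z}_{p,m,r}/\!/G$ is an irreducible component of $\mathscr{Z}_n/\!/G$ and has dimension $n$.
   Context: For an affine $G$-variety $X$, $X/\!/G=\mathrm{Specmax}(\mathbb{C}[X]^G)$. For $(p,m,r)$ with $2p+m+r=n$, $\mathscr{Z}_{p,m,r}$ is the Zariski closure in $\mathscr{Z}_n$ of the union of the $G$-orbits of all pairs $(A,B)\in\mathscr{Z}_n$ with $A=\mathrm{diag}(a_1,-a_1,\dots,a_p,-a_p,a_{p+1},\dots,a_{p+m},0,\dots,0)$ ($r$ zeros), where $a_i\in\mathbb{C}^*$ and $a_i\ne\pm a_j$ for $i\ne j$. *)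

theory Defs
  imports "Jordan_Normal_Form.Matrix" "HOL-Library.Extended_Nat"
begin

type_synonym pt = "complex mat \<times> complex mat"

inductive_set poly_fun :: "nat \<Rightarrow> (pt \<Rightarrow> complex) set" for n :: nat where
  const: "(\<lambda>_. c) \<in> poly_fun n"
| coordA: "i < n \<Longrightarrow> j < n \<Longrightarrow> (\<lambda>x. fst x $$ (i, j)) \<in> poly_fun n"
| coordB: "i < n \<Longrightarrow> j < n \<Longrightarrow> (\<lambda>x. snd x $$ (i, j)) \<in> poly_fun n"
| add: "p \<in> poly_fun n \<Longrightarrow> q \<in> poly_fun n \<Longrightarrow> (\<lambda>x. p x + q x) \<in> poly_fun n"
| mult: "p \<in> poly_fun n \<Longrightarrow> q \<in> poly_fun n \<Longrightarrow> (\<lambda>x. p x * q x) \<in> poly_fun n"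

definition ambient :: "nat \<Rightarrow> pt set" where
  "ambient n = carrier_mat n n \<times> carrier_mat n n"

definition Zn :: "nat \<Rightarrow> pt set" where
  "Zn n = {(A, B). A \<in> carrier_mat n n \<and> B \<in> carrier_mat n n \<and> A * B + B * A = 0\<^sub>m n n}"

definition zar_closure :: "nat \<Rightarrow> pt set \<Rightarrow> pt set" where
  "zar_closure n T = {x \<in> ambient n. \<forall>p \<in> poly_fun n. (\<forall>y\<in>T. p y = 0) \<longrightarrow> p x = 0}"

definition GLpair :: "nat \<Rightarrow> complex mat \<Rightarrow> complex mat \<Rightarrow> bool" where
  "GLpair n g h \<longleftrightarrow> g \<in> carrier_mat n n \<and> h \<in> carrier_mat n n \<and> g * h = 1\<^sub>m n \<and> h * g = 1\<^sub>m n"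

definition conj_act :: "complex mat \<Rightarrow> complex mat \<Rightarrow> pt \<Rightarrow> pt" where
  "conj_act g h x = (g * fst x * h, g * snd x * h)"

text \<open>The diagonal matrix diag(a_1,-a_1,...,a_p,-a_p,a_{p+1},...,a_{p+m},0,...,0)
  (a is 0-indexed here).\<close>
definition diag_pmr :: "nat \<Rightarrow> nat \<Rightarrow> nat \<Rightarrow> (nat \<Rightarrow> complex) \<Rightarrow> complex mat" where
  "diag_pmr n p m a = mat n n (\<lambda>(i, j). if i \<noteq> j then 0
      else if i < 2 * p then (if even i then a (i div 2) else - a (i div 2))
      else if i < 2 * p + m then a (i - p) else 0)"

definition Z_pmr :: "nat \<Rightarrow> nat \<Rightarrow> nat \<Rightarrow> nat \<Rightarrow> pt set" where
  "Z_pmr n p m r = zar_closure n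
     {conj_act g h (A, B) | g h A B. GLpair n g h \<and> (A, B) \<in> Zn n \<and>
        (\<exists>a. (\<forall>i < p + m. a i \<noteq> 0) \<and> (\<forall>i < p + m. \<forall>j < p + m. i \<noteq> j \<longrightarrow> a i \<noteq> a j \<and> a i \<noteq> - a j)
             \<and> A = diag_pmr n p m a)}"

text \<open>Regular functions on a subset X, represented as polynomial functions extended by 0 off X.\<close>
definition ext0 :: "pt set \<Rightarrow> (pt \<Rightarrow> complex) \<Rightarrow> pt \<Rightarrow> complex" where
  "ext0 X f = (\<lambda>x. if x \<in> X then f x else 0)"

definition coord_ring :: "nat \<Rightarrow> pt set \<Rightarrow> (pt \<Rightarrow> complex) set" where
  "coord_ring n X = ext0 X ` poly_fun n"

definition inv_ring :: "nat \<Rightarrow> pt set \<Rightarrow> (pt \<Rightarrow> complex) set" where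
  "inv_ring n X = {f \<in> coord_ring n X. \<forall>g h. GLpair n g h \<longrightarrow> (\<forall>x\<in>X. f (conj_act g h x) = f x)}"

definition ideal_in :: "(pt \<Rightarrow> complex) set \<Rightarrow> (pt \<Rightarrow> complex) set \<Rightarrow> bool" where
  "ideal_in S I \<longleftrightarrow> I \<subseteq> S \<and> (\<lambda>_. 0) \<in> I \<and> (\<forall>f\<in>I. \<forall>g\<in>I. (\<lambda>x. f x + g x) \<in> I)
     \<and> (\<forall>f\<in>I. \<forall>s\<in>S. (\<lambda>x. s x * f x) \<in> I)"

definition maximal_ideal :: "(pt \<Rightarrow> complex) set \<Rightarrow> (pt \<Rightarrow> complex) set \<Rightarrow> bool" where
  "maximal_ideal S I \<longleftrightarrow> ideal_in S I \<and> I \<noteq> S \<and>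
     (\<forall>J. ideal_in S J \<and> I \<subseteq> J \<and> J \<noteq> S \<longrightarrow> J = I)"

definition Specmax :: "(pt \<Rightarrow> complex) set \<Rightarrow> (pt \<Rightarrow> complex) set set" where
  "Specmax S = {I. maximal_ideal S I}"

definition git_quot :: "nat \<Rightarrow> pt set \<Rightarrow> (pt \<Rightarrow> complex) set set" where
  "git_quot n X = Specmax (inv_ring n X)"

definition zclosed :: "(pt \<Rightarrow> complex) set \<Rightarrow> (pt \<Rightarrow> complex) set set \<Rightarrow> bool" where
  "zclosed S C \<longleftrightarrow> (\<exists>E \<subseteq> S. C = {M \<in> Specmax S. E \<subseteq> M})"

definition zirred :: "(pt \<Rightarrow> complex) set \<Rightarrow> (pt \<Rightarrow> complex) set set \<Rightarrow> bool" where
  "zirred S C \<longleftrightarrow> zclosed S C \<and> C \<noteq> {} \<and>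
     (\<forall>C1 C2. zclosed S C1 \<and> zclosed S C2 \<and> C \<subseteq> C1 \<union> C2 \<longrightarrow> C \<subseteq> C1 \<or> C \<subseteq> C2)"

definition zcomponent :: "(pt \<Rightarrow> complex) set \<Rightarrow> (pt \<Rightarrow> complex) set set \<Rightarrow> bool" where
  "zcomponent S C \<longleftrightarrow> zirred S C \<and> (\<forall>D. zirred S D \<and> C \<subseteq> D \<longrightarrow> D = C)"

definition zdim :: "(pt \<Rightarrow> complex) set \<Rightarrow> (pt \<Rightarrow> complex) set set \<Rightarrow> enat" where
  "zdim S Y = Sup {enat k | k. \<exists>c. (\<forall>i\<le>k. zirred S (c i) \<and> c i \<subseteq> Y) \<and> (\<forall>i<k. c i \<subset> c (Suc i))}"

text \<open>Natural closed embedding Y//G -> X//G for G-stable closed Y \<subseteq> X, induced by the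
  restriction map C[X]^G -> C[Y]^G: a maximal ideal M of C[Y]^G goes to its preimage.\<close>
definition quot_embed :: "nat \<Rightarrow> pt set \<Rightarrow> pt set \<Rightarrow> (pt \<Rightarrow> complex) set \<Rightarrow> (pt \<Rightarrow> complex) set" where
  "quot_embed n X Y M = {f \<in> inv_ring n X. ext0 Y f \<in> M}"

end

theory Submission
  imports Defs "Jordan_Normal_Form.Schur_Decomposition" "HOL-Analysis.Continuum_Not_Denumerable"
    "HOL-Library.Function_Algebras" "HOL-Computational_Algebra.Fundamental_Theorem_Algebra"
begin

text \<open>An invariant takes the same value on a pair and on its semisimplification, so it is determined
  by its restrictions to the slices \<open>phi n p m\<close>, affine \<open>n\<close>-spaces of direct sums of the simple pairs:
  \<open>A = diag(a, -a)\<close> with \<open>B\<close> antidiagonal with entries \<open>b\<close>, and the one-dimensional pairs \<open>(a, 0)\<close> and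
  \<open>(0, b)\<close>. The matrices \<open>A\<^sup>2\<close> and \<open>B\<^sup>2\<close> are diagonal on a slice, hence each slice coordinate is
  integral over the coefficients of their characteristic polynomials. By lying over and the
  Nullstellensatz every maximal ideal of the invariant ring is the ideal of a slice point, and the
  images of the coordinate subspaces of a slice are closed. They are irreducible and form a chain of
  length \<open>n\<close>, while \<open>n + 1\<close> polynomials in \<open>n\<close> variables are algebraically dependent, which
  excludes longer chains. A finite union of closed irreducible sets of the same dimension has
  exactly these sets as components. This works for the whole variety and for each
  \<open>Z_pmr n p m r\<close>, where the single slice of type \<open>(p, m, r)\<close> suffices.\<close>


section \<open>Polynomial functions in finitely many variables\<close>

text \<open>The invariant ring is studied only through its pullbacks along the slices, which are
  subrings of a polynomial ring over which every coordinate is integral; this is what turns maximal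
  ideals into points. The two-dimensional blocks exist because \<open>A\<close> commutes with
  \<open>B * B\<close>: a common eigenvector \<open>v\<close> of the two spans an invariant subspace
  together with \<open>B v\<close>. Balancing the two off-diagonal entries of \<open>B\<close>
  leaves two parameters per block, against one for each remaining diagonal position, so every slice
  has \<open>2 * p + m + r = n\<close> parameters whatever its type. Two obstacles shape the rest. A
  pair in the closure \<open>Z_pmr\<close> has no normal form, so its degeneration is constructed
  for generic \<open>A\<close> only and density transfers the conclusion; the curves used must stay
  inside the closed set, which they do because they consist of conjugates. And slices of different
  types are never compared directly: if the image of one lay strictly inside that of another, its
  chain of strata could be prolonged beyond length \<open>n\<close>, so the dimension bound alone
  yields maximality.\<close>

inductive_set mpoly_fun :: "nat \<Rightarrow> ((nat \<Rightarrow> complex) \<Rightarrow> complex) set" for k :: nat where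
  mconst: "(\<lambda>_. c) \<in> mpoly_fun k"
| mvar: "i < k \<Longrightarrow> (\<lambda>t. t i) \<in> mpoly_fun k"
| madd: "p \<in> mpoly_fun k \<Longrightarrow> q \<in> mpoly_fun k \<Longrightarrow> (\<lambda>t. p t + q t) \<in> mpoly_fun k"
| mmult: "p \<in> mpoly_fun k \<Longrightarrow> q \<in> mpoly_fun k \<Longrightarrow> (\<lambda>t. p t * q t) \<in> mpoly_fun k"

definition subalg :: "('a \<Rightarrow> complex) set \<Rightarrow> bool" where
  "subalg S \<longleftrightarrow> (\<forall>c. (\<lambda>_. c) \<in> S) \<and> (\<forall>f\<in>S. \<forall>g\<in>S. (\<lambda>x. f x + g x) \<in> S)
     \<and> (\<forall>f\<in>S. \<forall>g\<in>S. (\<lambda>x. f x * g x) \<in> S)"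

text \<open>The conditions of \<open>ideal_in\<close> over an arbitrary domain: the same lemmas
  serve ideals of functions on pairs and ideals of functions of the slice parameters.\<close>

definition fun_ideal :: "('a \<Rightarrow> complex) set \<Rightarrow> ('a \<Rightarrow> complex) set \<Rightarrow> bool" where
  "fun_ideal S I \<longleftrightarrow> I \<subseteq> S \<and> (\<lambda>_. 0) \<in> I \<and> (\<forall>f\<in>I. \<forall>g\<in>I. (\<lambda>x. f x + g x) \<in> I)
     \<and> (\<forall>f\<in>I. \<forall>s\<in>S. (\<lambda>x. s x * f x) \<in> I)"

lemma subalg_mpoly_fun: "subalg (mpoly_fun k)"
  unfolding subalg_def by (blast intro: mpoly_fun.intros)

lemma subalgD:
  assumes "subalg S"
  shows "(\<lambda>_. c) \<in> S" "f \<in> S \<Longrightarrow> g \<in> S \<Longrightarrow> (\<lambda>x. f x + g x) \<in> S"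
    "f \<in> S \<Longrightarrow> g \<in> S \<Longrightarrow> (\<lambda>x. f x * g x) \<in> S"
  using assms unfolding subalg_def by blast+

lemma subalg_uminus:
  assumes "subalg S" "f \<in> S"
  shows "(\<lambda>x. - f x) \<in> S"
  using subalgD(3)[OF assms(1) subalgD(1)[OF assms(1), of "-1"] assms(2)] by simp

lemma subalg_diff:
  assumes "subalg S" "f \<in> S" "g \<in> S"
  shows "(\<lambda>x. f x - g x) \<in> S"
  using subalgD(2)[OF assms(1,2) subalg_uminus[OF assms(1,3)]] by simp

lemma subalg_sum:
  assumes "subalg S" "\<And>i. i \<in> A \<Longrightarrow> f i \<in> S"
  shows "(\<lambda>x. \<Sum>i\<in>A. f i x) \<in> S"
  using assms(2)
  by (induction A rule: infinite_finite_induct)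
     (simp_all add: subalgD[OF assms(1)])

lemma subalg_prod:
  assumes "subalg S" "\<And>i. i \<in> A \<Longrightarrow> f i \<in> S"
  shows "(\<lambda>x. \<Prod>i\<in>A. f i x) \<in> S"
  using assms(2)
  by (induction A rule: infinite_finite_induct)
     (simp_all add: subalgD[OF assms(1)])

lemma subalg_power:
  assumes "subalg S" "f \<in> S"
  shows "(\<lambda>x. f x ^ m) \<in> S"
  by (induction m) (simp_all add: subalgD[OF assms(1)] assms(2))

lemma fun_idealD:
  assumes "fun_ideal S I"
  shows "I \<subseteq> S" "(\<lambda>_. 0) \<in> I" "f \<in> I \<Longrightarrow> g \<in> I \<Longrightarrow> (\<lambda>x. f x + g x) \<in> I"
    "f \<in> I \<Longrightarrow> s \<in> S \<Longrightarrow> (\<lambda>x. s x * f x) \<in> I"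
  using assms unfolding fun_ideal_def by blast+

lemma fun_ideal_sum:
  assumes "fun_ideal S I" "\<And>i. i \<in> A \<Longrightarrow> f i \<in> I"
  shows "(\<lambda>x. \<Sum>i\<in>A. f i x) \<in> I"
  using assms(2)
  by (induction A rule: infinite_finite_induct)
     (simp_all add: fun_idealD[OF assms(1)])

lemma fun_ideal_diff:
  assumes "subalg S" "fun_ideal S I" "f \<in> I" "g \<in> I"
  shows "(\<lambda>x. f x - g x) \<in> I"
  using fun_idealD(3)[OF assms(2,3) fun_idealD(4)[OF assms(2,4) subalgD(1)[OF assms(1), of "-1"]]]
  by simp

text \<open>Restriction to a line brings questions about several variables down to polynomials in
  one.\<close>

lemma mpoly_fun_line:
  assumes "p \<in> mpoly_fun k"
  shows "\<exists>q::complex poly. \<forall>s. p (\<lambda>i. u i + s * v i) = poly q s"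
  using assms
proof induction
  case (mconst c)
  show ?case by (rule exI[of _ "[:c:]"]) simp
next
  case (mvar i)
  show ?case by (rule exI[of _ "[:u i, v i:]"]) simp
next
  case (madd p q)
  then obtain P Q where "\<forall>s. p (\<lambda>i. u i + s * v i) = poly P s" "\<forall>s. q (\<lambda>i. u i + s * v i) = poly Q s"
    by blast
  then show ?case by (intro exI[of _ "P + Q"]) simp
next
  case (mmult p q)
  then obtain P Q where "\<forall>s. p (\<lambda>i. u i + s * v i) = poly P s" "\<forall>s. q (\<lambda>i. u i + s * v i) = poly Q s"
    by blast
  then show ?case by (intro exI[of _ "P * Q"]) simp
qed

lemma poly_zero_if_cofinite:
  fixes q :: "complex poly"
  assumes "finite F" "\<And>s. s \<notin> F \<Longrightarrow> poly q s = 0"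
  shows "poly q s = 0"
proof -
  have "infinite (UNIV - F :: complex set)"
    using assms(1) infinite_UNIV_char_0 by (metis Diff_infinite_finite)
  moreover have "UNIV - F \<subseteq> {s. poly q s = 0}" using assms(2) by auto
  ultimately have "infinite {s. poly q s = 0}" using infinite_super by blast
  then have "q = 0" using poly_roots_finite[of q] by blast
  then show ?thesis by simp
qed

text \<open>A point where \<open>p\<close> does not vanish and one where \<open>q\<close> does not
  are joined by a line; along it two nonzero one-variable polynomials would have product
  zero.\<close>

lemma mpoly_fun_domain:
  assumes p: "p \<in> mpoly_fun k" and q: "q \<in> mpoly_fun k" and 0: "\<And>t. p t * q t = 0"
  shows "(\<forall>t. p t = 0) \<or> (\<forall>t. q t = 0)"
proof (rule ccontr)
  assume "\<not> ?thesis"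
  then obtain u v where u: "p u \<noteq> 0" and v: "q v \<noteq> 0" by blast
  let ?l = "\<lambda>s i. u i + s * (v i - u i)"
  obtain P where P: "\<And>s. p (?l s) = poly P s" using mpoly_fun_line[OF p] by metis
  obtain Q where Q: "\<And>s. q (?l s) = poly Q s" using mpoly_fun_line[OF q] by metis
  have "poly (P * Q) s = 0" for s using 0 P Q by (metis poly_mult)
  then have "P * Q = 0" using poly_all_0_iff_0 by blast
  then have "P = 0 \<or> Q = 0" by simp
  moreover have "poly P 0 \<noteq> 0" using P[of 0] u by simp
  moreover have "poly Q 1 \<noteq> 0" using Q[of 1] v by simp
  ultimately show False by auto
qed

section \<open>Linear and algebraic dependence\<close>

interpretation cfun: vector_space "\<lambda>(c::complex) (f::'a \<Rightarrow> complex) x. c * f x"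
  by unfold_locales (simp_all add: fun_eq_iff distrib_left distrib_right mult.assoc)

lemma cfun_sum_apply: "(\<Sum>i\<in>A. (f i :: 'a \<Rightarrow> complex)) x = (\<Sum>i\<in>A. f i x)"
  by (induction A rule: infinite_finite_induct) auto

text \<open>Stated for families, whereas \<open>cfun.dependent\<close> speaks of sets: a repetition
  \<open>g i = g j\<close> is itself a relation, hence the split on injectivity.\<close>

lemma linear_dependence:
  fixes g :: "'i \<Rightarrow> 'a \<Rightarrow> complex"
  assumes I: "finite I" and B: "finite B" and card: "card B < card I"
    and g: "\<And>i. i \<in> I \<Longrightarrow> g i \<in> cfun.span B"
  obtains c where "\<exists>i\<in>I. c i \<noteq> 0" "\<And>x. (\<Sum>i\<in>I. c i * g i x) = 0"
proof (cases "inj_on g I")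
  case True
  have "cfun.dependent (g ` I)"
  proof (rule ccontr)
    assume "\<not> ?thesis"
    from cfun.independent_span_bound[OF B this] g
    have "card (g ` I) \<le> card B" by auto
    then show False using card card_image[OF True] by simp
  qed
  then obtain u v where uv: "v \<in> g ` I" "u v \<noteq> 0" "(\<Sum>v\<in>g ` I. (\<lambda>x. u v * v x)) = 0"
    using cfun.dependent_finite[of "g ` I"] I by auto
  have "(\<Sum>i\<in>I. u (g i) * g i x) = 0" for x
  proof -
    have "(\<Sum>v\<in>g ` I. (\<lambda>x. u v * v x)) x = 0" using uv(3) by (simp add: zero_fun_def)
    then show ?thesis by (simp add: cfun_sum_apply sum.reindex[OF True] o_def)
  qed
  with uv show ?thesis using that[of "\<lambda>i. u (g i)"] by auto
next
  case False
  then obtain i j where ij: "i \<in> I" "j \<in> I" "i \<noteq> j" "g i = g j" unfolding inj_on_def by blast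
  define c where "c = (\<lambda>k. if k = i then 1 else if k = j then -1 else (0::complex))"
  have "(\<Sum>k\<in>I. c k * g k x) = 0" for x
  proof -
    have "(\<Sum>k\<in>I. c k * g k x) = (\<Sum>k\<in>{i,j}. c k * g k x)"
      using ij I by (intro sum.mono_neutral_right) (auto simp: c_def)
    also have "\<dots> = 0" using ij by (simp add: c_def)
    finally show ?thesis .
  qed
  moreover have "\<exists>k\<in>I. c k \<noteq> 0" using ij by (auto simp: c_def)
  ultimately show ?thesis using that by blast
qed

section \<open>Algebraic dependence by counting monomials\<close>

definition monomial :: "nat \<Rightarrow> (nat \<Rightarrow> nat) \<Rightarrow> (nat \<Rightarrow> complex) \<Rightarrow> complex" where
  "monomial k e t = (\<Prod>i<k. t i ^ e i)"

text \<open>The degree is bounded in each variable separately, which makes the number of exponent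
  vectors a pure power; extensionality keeps a vector from being counted twice.\<close>

definition box :: "nat \<Rightarrow> nat \<Rightarrow> (nat \<Rightarrow> nat) set" where
  "box k d = {..<k} \<rightarrow>\<^sub>E {..d}"

definition deg_space :: "nat \<Rightarrow> nat \<Rightarrow> ((nat \<Rightarrow> complex) \<Rightarrow> complex) set" where
  "deg_space k d = cfun.span (monomial k ` box k d)"

lemma finite_box: "finite (box k d)"
  unfolding box_def by (intro finite_PiE) auto

lemma card_box: "card (box k d) = (d + 1) ^ k"
  unfolding box_def by (simp add: card_PiE)

lemma deg_space_mono: "d \<le> d' \<Longrightarrow> deg_space k d \<subseteq> deg_space k d'"
  unfolding deg_space_def box_def by (intro cfun.span_mono image_mono PiE_mono) auto

lemma monomial_mult:
  assumes "e \<in> box k d" "e' \<in> box k d'"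
  shows "(\<lambda>t. monomial k e t * monomial k e' t) \<in> monomial k ` box k (d + d')"
proof (rule image_eqI[of _ _ "restrict (\<lambda>i. e i + e' i) {..<k}"])
  show "(\<lambda>t. monomial k e t * monomial k e' t) = monomial k (restrict (\<lambda>i. e i + e' i) {..<k})"
    by (simp add: fun_eq_iff monomial_def prod.distrib power_add)
  show "restrict (\<lambda>i. e i + e' i) {..<k} \<in> box k (d + d')"
    using assms by (force simp: box_def PiE_iff intro: add_mono)
qed

lemma deg_space_add:
  "p \<in> deg_space k d \<Longrightarrow> q \<in> deg_space k d \<Longrightarrow> (\<lambda>t. p t + q t) \<in> deg_space k d"
  using cfun.span_add[of p _ q] unfolding deg_space_def by (simp add: plus_fun_def)

lemma deg_space_mult:
  assumes p: "p \<in> deg_space k d" and q: "q \<in> deg_space k d'"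
  shows "(\<lambda>t. p t * q t) \<in> deg_space k (d + d')"
proof -
  have 1: "(\<lambda>t. monomial k e t * q t) \<in> deg_space k (d + d')" if e: "e \<in> box k d" for e
    using q unfolding deg_space_def
  proof (induction rule: cfun.span_induct_alt)
    case base
    show ?case using cfun.span_zero by (simp add: zero_fun_def)
  next
    case (step c x y)
    then obtain e' where "e' \<in> box k d'" "x = monomial k e'" by auto
    then have "(\<lambda>t. monomial k e t * x t) \<in> cfun.span (monomial k ` box k (d + d'))"
      using monomial_mult[OF e] by (auto intro: cfun.span_base)
    from cfun.span_add[OF cfun.span_scale[OF this, of c] step(2)]
    show ?case by (simp add: plus_fun_def algebra_simps)
  qed
  show ?thesis using p unfolding deg_space_def
  proof (induction rule: cfun.span_induct_alt)
    case base
    show ?case using cfun.span_zero by (simp add: zero_fun_def)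
  next
    case (step c x y)
    then obtain e where "e \<in> box k d" "x = monomial k e" by auto
    from cfun.span_add[OF cfun.span_scale[OF 1[OF this(1), unfolded deg_space_def], of c] step(2)] this
    show ?case by (simp add: plus_fun_def algebra_simps)
  qed
qed

lemma const_in_deg_space: "(\<lambda>_. c) \<in> deg_space k d"
proof -
  have "(\<lambda>_. 1) \<in> monomial k ` box k d"
    by (rule image_eqI[of _ _ "restrict (\<lambda>_. 0) {..<k}"])
       (auto simp: fun_eq_iff monomial_def box_def)
  from cfun.span_scale[OF cfun.span_base[OF this], of c] show ?thesis
    by (simp add: deg_space_def)
qed

lemma deg_space_power: "p \<in> deg_space k d \<Longrightarrow> (\<lambda>t. p t ^ m) \<in> deg_space k (m * d)"
  by (induction m) (auto intro: deg_space_mult const_in_deg_space)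

lemma mpoly_fun_deg_space:
  assumes "p \<in> mpoly_fun k"
  shows "\<exists>d. p \<in> deg_space k d"
  using assms
proof induction
  case (mconst c)
  show ?case using const_in_deg_space by blast
next
  case (mvar i)
  have "(\<lambda>t. t i) \<in> monomial k ` box k 1"
  proof (rule image_eqI[of _ _ "restrict (\<lambda>j. if j = i then 1 else 0) {..<k}"])
    show "(\<lambda>t. t i) = monomial k (restrict (\<lambda>j. if j = i then 1 else 0) {..<k})"
    proof
      fix t :: "nat \<Rightarrow> complex"
      have "monomial k (restrict (\<lambda>j. if j = i then 1 else 0) {..<k}) t
          = (\<Prod>j<k. if j = i then t j else 1)"
        unfolding monomial_def by (intro prod.cong) auto
      also have "\<dots> = t i" using mvar by (simp add: prod.delta)
      finally show "t i = monomial k (restrict (\<lambda>j. if j = i then 1 else 0) {..<k}) t" by simp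
    qed
  qed (auto simp: box_def)
  then show ?case unfolding deg_space_def by (blast intro: cfun.span_base)
next
  case (madd p q)
  then obtain d d' where "p \<in> deg_space k d" "q \<in> deg_space k d'" by blast
  then have "p \<in> deg_space k (max d d')" "q \<in> deg_space k (max d d')"
    using deg_space_mono[of d "max d d'"] deg_space_mono[of d' "max d d'"] by auto
  then show ?case using deg_space_add by blast
next
  case (mmult p q)
  then show ?case using deg_space_mult by blast
qed

text \<open>A polynomial with coefficients \<open>c\<close> (indexed by exponent lists with entries below \<open>N\<close>),
  evaluated at a list of functions. The nesting isolates the first variable, as in the
  lexicographic elimination below.\<close>

primrec eval_rel :: "nat \<Rightarrow> (nat list \<Rightarrow> complex) \<Rightarrow> ('a \<Rightarrow> complex) list \<Rightarrow> 'a \<Rightarrow> complex" where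
  "eval_rel N c [] x = c []"
| "eval_rel N c (f # fs) x = (\<Sum>i<N. f x ^ i * eval_rel N (\<lambda>l. c (i # l)) fs x)"

definition explists :: "nat \<Rightarrow> nat \<Rightarrow> nat list set" where
  "explists N k = {l. set l \<subseteq> {..<N} \<and> length l = k}"

primrec list_monom :: "('a \<Rightarrow> complex) list \<Rightarrow> nat list \<Rightarrow> 'a \<Rightarrow> complex" where
  "list_monom [] l x = 1"
| "list_monom (f # fs) l x = f x ^ hd l * list_monom fs (tl l) x"

lemma explists_0: "explists N 0 = {[]}"
  by (auto simp: explists_def)

lemma explists_Suc: "explists N (Suc k) = (\<lambda>(i, l). i # l) ` ({..<N} \<times> explists N k)"
  by (auto simp: explists_def length_Suc_conv image_iff)

lemma finite_explists: "finite (explists N k)"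
  unfolding explists_def by (rule finite_lists_length_eq) simp

lemma card_explists: "card (explists N k) = N ^ k"
  unfolding explists_def using card_lists_length_eq[of "{..<N}" k] by simp

text \<open>Links the two readings of a relation: nested in the first variable for elimination, a
  flat sum over monomials for linear dependence.\<close>

lemma eval_rel_eq_sum:
  "eval_rel N c fs x = (\<Sum>l\<in>explists N (length fs). c l * list_monom fs l x)"
proof (induction fs arbitrary: c)
  case Nil
  show ?case by (simp add: explists_0)
next
  case (Cons f fs)
  have inj: "inj_on (\<lambda>(i::nat, l). i # l) ({..<N} \<times> explists N (length fs))"
    by (auto simp: inj_on_def)
  have "(\<Sum>l\<in>explists N (length (f # fs)). c l * list_monom (f # fs) l x)
      = (\<Sum>(i, l)\<in>{..<N} \<times> explists N (length fs). c (i # l) * (f x ^ i * list_monom fs l x))"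
    unfolding list.size add_0_right add_Suc_right explists_Suc
    by (subst sum.reindex[OF inj]) (simp add: o_def case_prod_unfold)
  also have "\<dots> = (\<Sum>i<N. \<Sum>l\<in>explists N (length fs). c (i # l) * (f x ^ i * list_monom fs l x))"
    by (rule sum.cartesian_product[symmetric])
  also have "\<dots> = eval_rel N c (f # fs) x"
    by (simp add: Cons sum_distrib_left mult_ac)
  finally show ?case by simp
qed

lemma list_monom_deg_space:
  assumes "set fs \<subseteq> deg_space k d" "l \<in> explists N (length fs)"
  shows "list_monom fs l \<in> deg_space k (length fs * N * d)"
  using assms
proof (induction fs arbitrary: l)
  case Nil
  have "list_monom [] l = (\<lambda>_. 1)" by auto
  then show ?case using const_in_deg_space[of 1 k] by simp
next
  case (Cons f fs)
  then obtain i l' where l: "l = i # l'" "i < N" "l' \<in> explists N (length fs)"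
    by (auto simp: explists_Suc)
  have "(\<lambda>t. f t ^ i) \<in> deg_space k (i * d)" using Cons.prems by (intro deg_space_power) auto
  then have "(\<lambda>t. f t ^ i) \<in> deg_space k (N * d)"
    using deg_space_mono[of "i * d" "N * d"] l by auto
  from deg_space_mult[OF this Cons.IH[OF _ l(3)]] Cons.prems l
  have "(\<lambda>t. f t ^ i * list_monom fs l' t) \<in> deg_space k (N * d + length fs * N * d)" by simp
  moreover have "(\<lambda>t. f t ^ i * list_monom fs l' t) = list_monom (f # fs) l"
    using l by auto
  moreover have "N * d + length fs * N * d = length (f # fs) * N * d" by (simp add: algebra_simps)
  ultimately show ?case by (simp only:)
qed

text \<open>There are \<open>N ^ (n + 1)\<close> exponent lists with entries below \<open>N\<close>,
  while the monomials they give in functions of \<open>n\<close> variables lie in a space whose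
  dimension grows only like \<open>N ^ n\<close>.\<close>

lemma algebraic_dependence:
  assumes fs: "set fs \<subseteq> mpoly_fun n" and len: "length fs = n + 1"
  obtains N c where "\<exists>l\<in>explists N (n + 1). c l \<noteq> 0" "\<And>t. eval_rel N c fs t = 0"
proof -
  have "\<exists>d. \<forall>f\<in>set fs. f \<in> deg_space n d" using fs
  proof (induction fs)
    case (Cons f fs)
    obtain d' where "f \<in> deg_space n d'" using mpoly_fun_deg_space[of f n] Cons.prems by auto
    moreover obtain d where "\<forall>f\<in>set fs. f \<in> deg_space n d" using Cons by auto
    ultimately have "\<forall>g\<in>set (f # fs). g \<in> deg_space n (max d d')"
      using deg_space_mono[of d "max d d'" n] deg_space_mono[of d' "max d d'" n] by auto
    then show ?case by blast
  qed simp
  then obtain d where d: "set fs \<subseteq> deg_space n d" by blast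
  \<comment> \<open>\<open>K * N\<close> bounds the number of exponents available to each variable,
    so the space has dimension at most \<open>K ^ n * N ^ n\<close>; \<open>N\<close> is just large
    enough to make this less than \<open>N ^ (n + 1)\<close>.\<close>
  define K where "K = (n + 1) * d + 1"
  define N where "N = K ^ n + 1"
  have K: "K \<ge> 1" "N \<ge> 1" by (auto simp: K_def N_def)
  have "((n + 1) * N * d + 1) ^ n \<le> (K * N) ^ n"
    by (rule power_mono) (use K in \<open>auto simp: K_def algebra_simps\<close>)
  also have "\<dots> = K ^ n * N ^ n" by (rule power_mult_distrib)
  also have "\<dots> < N * N ^ n" using K by (intro mult_strict_right_mono) (auto simp: N_def)
  also have "\<dots> = N ^ (n + 1)" by simp
  finally have lt: "((n + 1) * N * d + 1) ^ n < N ^ (n + 1)" .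
  let ?B = "monomial n ` box n ((n + 1) * N * d)"
  have "card ?B \<le> ((n + 1) * N * d + 1) ^ n"
    using card_image_le[OF finite_box] card_box by metis
  with lt have card: "card ?B < card (explists N (n + 1))" by (simp add: card_explists)
  show ?thesis
  proof (rule linear_dependence[OF finite_explists finite_imageI[OF finite_box] card,
        where g = "list_monom fs"])
    show "list_monom fs l \<in> cfun.span ?B" if "l \<in> explists N (n + 1)" for l
      using list_monom_deg_space[OF d, of l N] that len by (simp add: deg_space_def)
    fix c assume "\<exists>l\<in>explists N (n + 1). c l \<noteq> 0"
      and "\<And>x. (\<Sum>l\<in>explists N (n + 1). c l * list_monom fs l x) = 0"
    then show thesis using that[of N c] len by (simp add: eval_rel_eq_sum)
  qed
qed


lemma eval_rel_in:
  assumes "subalg S" "set fs \<subseteq> S"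
  shows "eval_rel N c fs \<in> S"
  using assms(2)
proof (induction fs arbitrary: c)
  case Nil
  have "eval_rel N c [] = (\<lambda>_. c [])" by auto
  then show ?case using subalgD(1)[OF assms(1)] by simp
next
  case (Cons f fs)
  have "eval_rel N c (f # fs) = (\<lambda>x. \<Sum>i<N. f x ^ i * eval_rel N (\<lambda>l. c (i # l)) fs x)" by auto
  moreover have "(\<lambda>x. \<Sum>i<N. f x ^ i * eval_rel N (\<lambda>l. c (i # l)) fs x) \<in> S"
    using Cons
    by (intro subalg_sum[OF assms(1)] subalgD(3)[OF assms(1)] subalg_power[OF assms(1)]) auto
  ultimately show ?case by simp
qed

text \<open>Elements \<open>F j\<close> separating consecutive members of a chain of irreducible sets are
  algebraically independent: in a vanishing relation, dividing by the lowest power of the first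
  variable and restricting to the next smaller set leaves a relation with one variable less.\<close>

lemma chain_algebraically_independent:
  assumes S: "subalg S"
    and prime: "\<And>j g h. j \<le> m \<Longrightarrow> g \<in> S \<Longrightarrow> h \<in> S \<Longrightarrow> (\<And>t. t \<in> T j \<Longrightarrow> g t * h t = 0)
      \<Longrightarrow> (\<forall>t\<in>T j. g t = 0) \<or> (\<forall>t\<in>T j. h t = 0)"
    and mono: "\<And>j. j < m \<Longrightarrow> T j \<subseteq> T (Suc j)"
    and ne: "T 0 \<noteq> {}"
    and F: "\<And>j. j < m \<Longrightarrow> F j \<in> S" "\<And>j t. j < m \<Longrightarrow> t \<in> T j \<Longrightarrow> F j t = 0"
      "\<And>j. j < m \<Longrightarrow> \<exists>t\<in>T (Suc j). F j t \<noteq> 0"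
    and c: "\<exists>l\<in>explists N m. c l \<noteq> 0"
  shows "\<exists>t\<in>T m. eval_rel N c (map F (rev [0..<m])) t \<noteq> (0::complex)"
  using prime mono F c
proof (induction m arbitrary: c)
  case 0
  then show ?case using ne by (auto simp: explists_0)
next
  case (Suc m)
  \<comment> \<open>The list is reversed so that its head is the function separating the two largest
    sets: removing the head leaves the relation for the chain without its top member.\<close>
  let ?fs = "map F (rev [0..<m])"
  define E where "E = (\<lambda>i. eval_rel N (\<lambda>l. c (i # l)) ?fs)"
  define P where "P = (\<lambda>i. i < N \<and> (\<exists>l\<in>explists N m. c (i # l) \<noteq> 0))"
  have "\<exists>i. P i" using Suc.prems(6) by (auto simp: explists_Suc P_def)
  then obtain i0 where i0: "P i0" "\<And>i. i < i0 \<Longrightarrow> \<not> P i" by (metis exists_least_iff)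
  have "\<exists>t\<in>T m. eval_rel N (\<lambda>l. c (i0 # l)) ?fs t \<noteq> 0"
    by (rule Suc.IH) (use Suc.prems i0(1) in \<open>auto simp: P_def\<close>)
  then obtain t where t: "t \<in> T m" "E i0 t \<noteq> 0" by (auto simp: E_def)
  have E0: "E i x = 0" if "i < i0" for i x
  proof -
    have "\<forall>l\<in>explists N m. c (i # l) = 0" using i0(2)[OF that] that i0(1) by (auto simp: P_def)
    then show ?thesis by (simp add: E_def eval_rel_eq_sum)
  qed
  have ES: "E i \<in> S" for i unfolding E_def
    by (rule eval_rel_in[OF S]) (use Suc.prems(3) in auto)
  \<comment> \<open>Collects the powers above \<open>i0\<close> after \<open>F m\<close> has been
    split off \<open>i0 + 1\<close> times; on \<open>T m\<close>, where \<open>F m\<close> vanishes,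
    the term \<open>F m x * H x\<close> drops out.\<close>
  define H where "H = (\<lambda>x. \<Sum>i\<in>{i0<..<N}. F m x ^ (i - i0 - 1) * E i x)"
  have HS: "H \<in> S" unfolding H_def
    using Suc.prems(3) ES
    by (intro subalg_sum[OF S] subalgD(3)[OF S] subalg_power[OF S]) auto
  have expand: "eval_rel N c (map F (rev [0..<Suc m])) x = F m x ^ i0 * (E i0 x + F m x * H x)" for x
  proof -
    have "eval_rel N c (map F (rev [0..<Suc m])) x = (\<Sum>i<N. F m x ^ i * E i x)"
      by (simp add: E_def)
    also have "\<dots> = (\<Sum>i\<in>{i0..<N}. F m x ^ i * E i x)"
      by (rule sum.mono_neutral_right) (use E0 in \<open>auto simp: not_le\<close>)
    also have "{i0..<N} = insert i0 {i0<..<N}" using i0(1) by (auto simp: P_def)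
    also have "(\<Sum>i\<in>insert i0 {i0<..<N}. F m x ^ i * E i x)
        = F m x ^ i0 * E i0 x + (\<Sum>i\<in>{i0<..<N}. F m x ^ i * E i x)" by simp
    also have "(\<Sum>i\<in>{i0<..<N}. F m x ^ i * E i x)
        = (\<Sum>i\<in>{i0<..<N}. F m x ^ i0 * (F m x * (F m x ^ (i - i0 - 1) * E i x)))"
    proof (rule sum.cong[OF refl])
      fix i assume "i \<in> {i0<..<N}"
      then have "i = i0 + Suc (i - i0 - 1)" by auto
      then have "F m x ^ i = F m x ^ i0 * (F m x * F m x ^ (i - i0 - 1))"
        by (metis power_add power_Suc)
      then show "F m x ^ i * E i x = F m x ^ i0 * (F m x * (F m x ^ (i - i0 - 1) * E i x))"
        by (simp add: mult_ac)
    qed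
    also have "\<dots> = F m x ^ i0 * (F m x * H x)" by (simp add: H_def sum_distrib_left)
    finally show ?thesis by (simp add: distrib_left)
  qed
  show ?case
  proof (rule ccontr)
    assume "\<not> ?case"
    then have "F m x ^ i0 * (E i0 x + F m x * H x) = 0" if "x \<in> T (Suc m)" for x
      using expand that by metis
    moreover have "(\<lambda>t. F m t ^ i0) \<in> S" "(\<lambda>t. E i0 t + F m t * H t) \<in> S"
      using Suc.prems(3)[of m] ES HS
      by (auto intro!: subalg_power[OF S] subalgD(2)[OF S] subalgD(3)[OF S])
    ultimately have "(\<forall>t\<in>T (Suc m). F m t ^ i0 = 0) \<or> (\<forall>t\<in>T (Suc m). E i0 t + F m t * H t = 0)"
      using Suc.prems(1)[OF le_refl] by blast
    moreover have "\<not> (\<forall>t\<in>T (Suc m). F m t ^ i0 = 0)" using Suc.prems(5)[of m] by auto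
    ultimately have "\<forall>t\<in>T (Suc m). E i0 t + F m t * H t = 0" by blast
    then have "E i0 t + F m t * H t = 0" using t Suc.prems(2)[of m] by auto
    then show False using t Suc.prems(4)[of m t] by simp
  qed
qed

section \<open>The weak Nullstellensatz\<close>

definition fun_maximal :: "('a \<Rightarrow> complex) set \<Rightarrow> ('a \<Rightarrow> complex) set \<Rightarrow> bool" where
  "fun_maximal S M \<longleftrightarrow> fun_ideal S M \<and> (\<lambda>_. 1) \<notin> M
     \<and> (\<forall>I. fun_ideal S I \<longrightarrow> M \<subseteq> I \<longrightarrow> (\<lambda>_. 1) \<notin> I \<longrightarrow> I = M)"

lemma fun_maximal_exists:
  assumes J: "fun_ideal S J" "(\<lambda>_. 1) \<notin> J"
  obtains M where "fun_maximal S M" "J \<subseteq> M"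
proof -
  let ?A = "{I. fun_ideal S I \<and> J \<subseteq> I \<and> (\<lambda>_. 1) \<notin> I}"
  have "\<exists>M\<in>?A. \<forall>X\<in>?A. M \<subseteq> X \<longrightarrow> X = M"
  proof (rule subset_Zorn_nonempty)
    show "?A \<noteq> {}" using J by blast
    fix C assume C: "C \<noteq> {}" "subset.chain ?A C"
    have sub: "I \<in> ?A" if "I \<in> C" for I using C that by (auto simp: subset.chain_def)
    have two: "\<exists>K\<in>C. I \<subseteq> K \<and> I' \<subseteq> K" if "I \<in> C" "I' \<in> C" for I I'
    proof -
      have "I \<subseteq> I' \<or> I' \<subseteq> I" using C(2) that by (simp add: subset_chain_def)
      then show ?thesis using that by auto
    qed
    have "fun_ideal S (\<Union>C)"
      unfolding fun_ideal_def
    proof (intro conjI ballI)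
      show "\<Union>C \<subseteq> S" using sub fun_idealD(1) by blast
      show "(\<lambda>_. 0) \<in> \<Union>C" using sub C(1) fun_idealD(2) by blast
      show "(\<lambda>x. f x + g x) \<in> \<Union>C" if "f \<in> \<Union>C" "g \<in> \<Union>C" for f g
      proof -
        from that two obtain K where "K \<in> C" "f \<in> K" "g \<in> K" by (meson UnionE subset_iff)
        then show ?thesis using sub fun_idealD(3)[of S K f g] by auto
      qed
      show "(\<lambda>x. s x * f x) \<in> \<Union>C" if "f \<in> \<Union>C" "s \<in> S" for f s
      proof -
        from that obtain I where "I \<in> C" "f \<in> I" by blast
        then show ?thesis using sub fun_idealD(4)[of S I f s] that by blast
      qed
    qed
    then show "\<Union>C \<in> ?A" using sub C(1) by blast
  qed
  then obtain M where M: "M \<in> ?A" and max: "\<And>X. X \<in> ?A \<Longrightarrow> M \<subseteq> X \<Longrightarrow> X = M" by auto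
  have "I = M" if "fun_ideal S I" "M \<subseteq> I" "(\<lambda>_. 1) \<notin> I" for I
    by (rule max) (use that M in auto)
  with M have "fun_maximal S M" "J \<subseteq> M" by (auto simp: fun_maximal_def)
  then show ?thesis by (rule that)
qed

text \<open>The quotient by a maximal ideal is a field: \<open>M\<close> and \<open>f\<close>
  together generate an ideal strictly above \<open>M\<close>, so it contains 1.\<close>

lemma fun_maximal_inverse:
  assumes S: "subalg S" and M: "fun_maximal S M" and f: "f \<in> S" "f \<notin> M"
  obtains g where "g \<in> S" "(\<lambda>x. f x * g x - 1) \<in> M"
proof -
  have Mi: "fun_ideal S M" using M by (simp add: fun_maximal_def)
  define I where "I = {(\<lambda>x. m x + g x * f x) | m g. m \<in> M \<and> g \<in> S}"
  have II: "(\<lambda>x. m x + g x * f x) \<in> I" if "m \<in> M" "g \<in> S" for m g using that by (auto simp: I_def)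
  have MI: "M \<subseteq> I"
  proof
    fix m assume "m \<in> M"
    from II[OF this subalgD(1)[OF S, of 0]] show "m \<in> I" by simp
  qed
  have fI: "f \<in> I" using II[OF fun_idealD(2)[OF Mi] subalgD(1)[OF S, of 1]] by simp
  have "fun_ideal S I"
    unfolding fun_ideal_def
  proof (intro conjI ballI)
    show "I \<subseteq> S"
      using fun_idealD(1)[OF Mi] f by (auto simp: I_def intro!: subalgD(2,3)[OF S])
    show "(\<lambda>_. 0) \<in> I" using MI fun_idealD(2)[OF Mi] by blast
    fix a assume "a \<in> I"
    then obtain m g where a: "m \<in> M" "g \<in> S" "a = (\<lambda>x. m x + g x * f x)" by (auto simp: I_def)
    show "(\<lambda>x. a x + b x) \<in> I" if "b \<in> I" for b
    proof -
      obtain m' g' where b: "m' \<in> M" "g' \<in> S" "b = (\<lambda>x. m' x + g' x * f x)"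
        using \<open>b \<in> I\<close> by (auto simp: I_def)
      from II[OF fun_idealD(3)[OF Mi a(1) b(1)] subalgD(2)[OF S a(2) b(2)]]
      show ?thesis by (simp add: a(3) b(3) algebra_simps)
    qed
    show "(\<lambda>x. s x * a x) \<in> I" if "s \<in> S" for s
      using II[OF fun_idealD(4)[OF Mi a(1) that] subalgD(3)[OF S that a(2)]]
      by (simp add: a(3) algebra_simps)
  qed
  then have "(\<lambda>_. 1) \<in> I" using M MI fI f by (auto simp: fun_maximal_def)
  then obtain m g where mg: "m \<in> M" "g \<in> S" "(\<lambda>_. 1) = (\<lambda>x. m x + g x * f x)"
    by (auto simp: I_def)
  have "f x * g x - 1 = - 1 * m x" for x using fun_cong[OF mg(3), of x] by (simp add: algebra_simps)
  then have "(\<lambda>x. f x * g x - 1) \<in> M"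
    using fun_idealD(4)[OF Mi mg(1) subalgD(1)[OF S, of "-1"]] by simp
  with mg that show ?thesis by blast
qed

lemma fun_maximal_prime:
  assumes S: "subalg S" and M: "fun_maximal S M" and f: "f \<in> S" and g: "g \<in> S"
    and fg: "(\<lambda>x. f x * g x) \<in> M"
  shows "f \<in> M \<or> g \<in> M"
proof (rule ccontr)
  assume neg: "\<not> ?thesis"
  then have "f \<notin> M" by blast
  have Mi: "fun_ideal S M" using M by (simp add: fun_maximal_def)
  obtain h where h: "h \<in> S" "(\<lambda>x. f x * h x - 1) \<in> M"
    using fun_maximal_inverse[OF S M f \<open>f \<notin> M\<close>] by blast
  from fun_ideal_diff[OF S Mi fun_idealD(4)[OF Mi fg h(1)] fun_idealD(4)[OF Mi h(2) g]]
  have "g \<in> M" by (simp add: algebra_simps)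
  with neg show False by blast
qed

text \<open>An element of the residue field that is algebraic over the complex numbers is a
  constant, since \<open>q\<close> splits into linear factors and \<open>M\<close> is prime.\<close>

lemma fun_maximal_root:
  assumes S: "subalg S" and M: "fun_maximal S M" and f: "f \<in> S"
    and q: "q \<noteq> 0" "(\<lambda>x. poly q (f x)) \<in> M"
  shows "\<exists>z. (\<lambda>x. f x - z) \<in> M"
  using q
proof (induction "degree q" arbitrary: q)
  have Mi: "fun_ideal S M" using M by (simp add: fun_maximal_def)
  {
    case 0
    then obtain a where a: "q = [:a:]" "a \<noteq> 0" by (metis degree_eq_zeroE pCons_0_0)
    with 0 have "(\<lambda>_. a) \<in> M" by simp
    from fun_idealD(4)[OF Mi this subalgD(1)[OF S, of "inverse a"]] a
    have "(\<lambda>_. 1) \<in> M" by simp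
    then show ?case using M by (simp add: fun_maximal_def)
  next
    case (Suc d)
    then obtain z where "poly q z = 0"
      using fundamental_theorem_of_algebra[of q] by (auto simp: constant_degree)
    then obtain r where r: "q = [:-z, 1:] * r" by (auto simp: poly_eq_0_iff_dvd)
    have rn: "r \<noteq> 0" using Suc r by auto
    have pS: "(\<lambda>x. poly p (f x)) \<in> S" for p
      unfolding poly_altdef
      by (intro subalg_sum[OF S] subalgD(1,3)[OF S] subalg_power[OF S] f)
    have "(\<lambda>x. (f x - z) * poly r (f x)) \<in> M" using Suc.prems r by (simp add: algebra_simps)
    then have "(\<lambda>x. f x - z) \<in> M \<or> (\<lambda>x. poly r (f x)) \<in> M"
      using fun_maximal_prime[OF S M subalg_diff[OF S f subalgD(1)[OF S]] pS] by simp
    moreover have "d = degree r"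
      using Suc.hyps(2) r rn degree_mult_eq[of "[:-z, 1:]" r] by auto
    ultimately show ?case using Suc.hyps(1)[of r] rn by blast
  }
qed

text \<open>The residue field has countable dimension, whereas the inverses of \<open>f - r\<close> for real \<open>r\<close>
  form an uncountable family.\<close>

lemma mpoly_fun_maximal_const:
  assumes M: "fun_maximal (mpoly_fun k) M" and f: "f \<in> mpoly_fun k"
  shows "\<exists>z. (\<lambda>x. f x - z) \<in> M"
proof (rule ccontr)
  assume neg: "\<not> ?thesis"
  note S = subalg_mpoly_fun[of k]
  have Mi: "fun_ideal (mpoly_fun k) M" using M by (simp add: fun_maximal_def)
  have "\<exists>g\<in>mpoly_fun k. (\<lambda>x. (f x - of_real r) * g x - 1) \<in> M" for r :: real
    using fun_maximal_inverse[OF S M subalg_diff[OF S f subalgD(1)[OF S]]] neg by metis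
  then obtain g where g: "\<And>r::real. g r \<in> mpoly_fun k"
    "\<And>r. (\<lambda>x. (f x - of_real r) * g r x - 1) \<in> M" by metis
  have "\<exists>d. infinite {r. g r \<in> deg_space k d}"
  proof (rule ccontr)
    assume "\<not> ?thesis"
    then have "countable (\<Union>d. {r. g r \<in> deg_space k d})"
      by (intro countable_UN) (auto intro: countable_finite)
    moreover have "(\<Union>d. {r. g r \<in> deg_space k d}) = UNIV"
      using mpoly_fun_deg_space g(1) by blast
    ultimately show False using uncountable_UNIV_real by simp
  qed
  then obtain d where "infinite {r. g r \<in> deg_space k d}" by blast
  then obtain R where R: "finite R" "card R = card (monomial k ` box k d) + 1"
    "R \<subseteq> {r. g r \<in> deg_space k d}"
    by (meson infinite_arbitrarily_large)
  obtain c where c: "\<exists>r\<in>R. c r \<noteq> 0" "\<And>x. (\<Sum>r\<in>R. c r * g r x) = 0"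
  proof (rule linear_dependence[of R "monomial k ` box k d" g])
    show "g r \<in> cfun.span (monomial k ` box k d)" if "r \<in> R" for r
      using R(3) that by (auto simp: deg_space_def)
  qed (use R finite_box in auto)
  \<comment> \<open>The numerator of the sum of the fractions \<open>c r / (f - r)\<close> over
    their common denominator; at the argument \<open>r\<close> only the summand of \<open>r\<close>
    survives, so \<open>Q\<close> is nonzero.\<close>
  define Q where "Q = (\<Sum>r\<in>R. smult (c r) (\<Prod>s\<in>R - {r}. [:- of_real s, 1:]))"
  have "Q \<noteq> 0"
  proof -
    obtain r where r: "r \<in> R" "c r \<noteq> 0" using c by blast
    have "poly Q (of_real r) = (\<Sum>r'\<in>R. if r' = r then c r * (\<Prod>s\<in>R - {r}. of_real r - of_real s) else 0)"
      unfolding Q_def poly_sum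
      by (rule sum.cong) (use r R(1) in \<open>auto simp: poly_prod intro!: bexI[of _ r]\<close>)
    also have "\<dots> = c r * (\<Prod>s\<in>R - {r}. of_real r - of_real s)" using r R(1) by simp
    finally show ?thesis using r R(1) by auto
  qed
  moreover have "(\<lambda>x. poly Q (f x)) \<in> M"
  proof -
    \<comment> \<open>\<open>h r\<close> is the common denominator without the factor of
      \<open>r\<close>. Multiplying the congruence for \<open>g r\<close> by
      \<open>c r * h r\<close> and summing leaves \<open>- poly Q (f x)\<close>, because the
      combination of the \<open>g r\<close> vanishes.\<close>
    define h where "h = (\<lambda>r x. \<Prod>s\<in>R - {r}. f x - complex_of_real s)"
    have hS: "h r \<in> mpoly_fun k" for r unfolding h_def
      by (intro subalg_prod[OF S] subalg_diff[OF S] f subalgD(1)[OF S])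
    have "(\<lambda>x. (c r * h r x) * ((f x - of_real r) * g r x - 1)) \<in> M" for r
      by (rule fun_idealD(4)[OF Mi g(2)]) (intro subalgD[OF S] hS)
    then have "(\<lambda>x. \<Sum>r\<in>R. (c r * h r x) * ((f x - of_real r) * g r x - 1)) \<in> M"
      by (intro fun_ideal_sum[OF Mi])
    moreover have "(\<Sum>r\<in>R. (c r * h r x) * ((f x - of_real r) * g r x - 1)) = - poly Q (f x)" for x
    proof -
      have hr: "h r x * (f x - of_real r) = (\<Prod>s\<in>R. f x - of_real s)" if "r \<in> R" for r
        using prod.remove[OF R(1) that, of "\<lambda>s. f x - of_real s"] by (simp add: h_def mult.commute)
      have "(\<Sum>r\<in>R. (c r * h r x) * ((f x - of_real r) * g r x - 1))
          = (\<Sum>r\<in>R. (\<Prod>s\<in>R. f x - of_real s) * (c r * g r x) - c r * h r x)"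
      proof (intro sum.cong refl)
        fix r assume "r \<in> R"
        have "(c r * h r x) * ((f x - of_real r) * g r x - 1)
            = (h r x * (f x - of_real r)) * (c r * g r x) - c r * h r x" by (simp add: algebra_simps)
        then show "(c r * h r x) * ((f x - of_real r) * g r x - 1)
            = (\<Prod>s\<in>R. f x - of_real s) * (c r * g r x) - c r * h r x"
          by (simp only: hr[OF \<open>r \<in> R\<close>])
      qed
      also have "\<dots> = (\<Prod>s\<in>R. f x - of_real s) * (\<Sum>r\<in>R. c r * g r x) - (\<Sum>r\<in>R. c r * h r x)"
        by (simp add: sum_subtractf sum_distrib_left)
      also have "(\<Sum>r\<in>R. c r * h r x) = poly Q (f x)"
        by (simp add: Q_def h_def poly_sum poly_prod)
      finally show ?thesis using c(2) by simp
    qed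
    ultimately have "(\<lambda>x. - poly Q (f x)) \<in> M" by simp
    from fun_idealD(4)[OF Mi this subalgD(1)[OF S, of "-1"]] show ?thesis by simp
  qed
  ultimately show False using fun_maximal_root[OF S M f] neg by blast
qed

text \<open>Modulo a maximal ideal above \<open>J\<close> every coordinate function is congruent to
  a number; these numbers are the coordinates of the common zero.\<close>

theorem weak_nullstellensatz:
  assumes J: "fun_ideal (mpoly_fun k) J" "(\<lambda>_. 1) \<notin> J"
  shows "\<exists>c. \<forall>f\<in>J. f c = 0"
proof -
  note S = subalg_mpoly_fun[of k]
  obtain M where M: "fun_maximal (mpoly_fun k) M" "J \<subseteq> M" using fun_maximal_exists[OF J] by blast
  have Mi: "fun_ideal (mpoly_fun k) M" using M by (simp add: fun_maximal_def)
  have "\<exists>c. \<forall>i<k. (\<lambda>t. t i - c i) \<in> M"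
    using mpoly_fun_maximal_const[OF M(1) mvar] by metis
  then obtain c where c: "\<And>i. i < k \<Longrightarrow> (\<lambda>t. t i - c i) \<in> M" by blast
  have ev: "(\<lambda>t. p t - p c) \<in> M" if "p \<in> mpoly_fun k" for p
    using that
  proof induction
    case (mconst a)
    show ?case using fun_idealD(2)[OF Mi] by simp
  next
    case (mvar i)
    then show ?case using c by simp
  next
    case (madd p q)
    from fun_idealD(3)[OF Mi madd.IH] show ?case by (simp add: algebra_simps)
  next
    case (mmult p q)
    from fun_idealD(3)[OF Mi fun_idealD(4)[OF Mi mmult.IH(2) mmult.hyps(1)]
      fun_idealD(4)[OF Mi mmult.IH(1) mpoly_fun.mconst[of "q c"]]]
    show ?case by (simp add: algebra_simps)
  qed
  have "f c = 0" if "f \<in> J" for f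
  proof (rule ccontr)
    assume "f c \<noteq> 0"
    have "f \<in> M" "f \<in> mpoly_fun k" using that M fun_idealD(1)[OF J(1)] by auto
    from fun_ideal_diff[OF S Mi this(1) ev[OF this(2)]] have "(\<lambda>_. f c) \<in> M" by simp
    from fun_idealD(4)[OF Mi this mpoly_fun.mconst[of "inverse (f c)"]] \<open>f c \<noteq> 0\<close>
    have "(\<lambda>_. 1) \<in> M" by simp
    then show False using M by (simp add: fun_maximal_def)
  qed
  then show ?thesis by blast
qed

section \<open>Lying over\<close>

text \<open>Elimination of one index at a time takes the place of a determinant: modulo
  \<open>I\<close> the factor \<open>1 - m a a\<close> is 1, and after multiplication by it
  \<open>u a\<close> is expressed by the other \<open>u j\<close>. The \<open>u i\<close> are
  arbitrary functions; in the application they are monomials of the larger ring.\<close>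

lemma nakayama:
  assumes S: "subalg S" and I: "fun_ideal S I" and K: "finite K"
    and m: "\<And>i j. i \<in> K \<Longrightarrow> j \<in> K \<Longrightarrow> m i j \<in> I"
    and u: "\<And>i x. i \<in> K \<Longrightarrow> u i x = (\<Sum>j\<in>K. m i j x * u j x)"
  shows "\<exists>d\<in>I. \<forall>i\<in>K. \<forall>x. (1 - d x) * u i x = 0"
  using K m u
proof (induction K arbitrary: m)
  case empty
  then show ?case using fun_idealD(2)[OF I] by blast
next
  case (insert a K)
  have IS: "f \<in> S" if "f \<in> I" for f using fun_idealD(1)[OF I] that by blast
  \<comment> \<open>Multiply the equation for \<open>u i\<close> by \<open>1 - m a a\<close>,
    substitute the equation for \<open>u a\<close>, and bring \<open>m a a * u i\<close> back to the
    right; all coefficients stay in \<open>I\<close>.\<close>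
  define m' where "m' = (\<lambda>i j x. (if i = j then m a a x else 0) + (1 - m a a x) * m i j x
    + m i a x * m a j x)"
  have m'I: "m' i j \<in> I" if "i \<in> K" "j \<in> K" for i j
  proof -
    have "(\<lambda>x. if i = j then m a a x else 0) \<in> I"
      using insert.prems(1)[of a a] fun_idealD(2)[OF I] by (cases "i = j") auto
    moreover have "(\<lambda>x. (1 - m a a x) * m i j x) \<in> I"
      using insert.prems(1) that
      by (intro fun_idealD(4)[OF I] subalg_diff[OF S] subalgD(1)[OF S] IS) auto
    moreover have "(\<lambda>x. m i a x * m a j x) \<in> I"
      using insert.prems(1) that by (intro fun_idealD(4)[OF I] IS) auto
    ultimately show ?thesis unfolding m'_def by (intro fun_idealD(3)[OF I])
  qed
  have ua: "(1 - m a a x) * u a x = (\<Sum>j\<in>K. m a j x * u j x)" for x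
    using insert.prems(2)[of a x] insert.hyps by (simp add: algebra_simps)
  have ui: "u i x = (\<Sum>j\<in>K. m' i j x * u j x)" if i: "i \<in> K" for i x
  proof -
    have "u i x = m i a x * u a x + (\<Sum>j\<in>K. m i j x * u j x)"
      using insert.prems(2)[of i x] insert.hyps i by simp
    then have "(1 - m a a x) * u i x
        = m i a x * ((1 - m a a x) * u a x) + (1 - m a a x) * (\<Sum>j\<in>K. m i j x * u j x)"
      by (simp add: algebra_simps)
    then have "u i x = m a a x * u i x + (1 - m a a x) * (\<Sum>j\<in>K. m i j x * u j x)
        + m i a x * (\<Sum>j\<in>K. m a j x * u j x)"
      unfolding ua by (simp add: algebra_simps)
    also have "m a a x * u i x = (\<Sum>j\<in>K. (if i = j then m a a x else 0) * u j x)"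
      using i insert.hyps by (simp add: if_distrib[of "\<lambda>z. z * _"] sum.delta cong: if_cong)
    finally show ?thesis
      by (simp add: m'_def distrib_right sum.distrib sum_distrib_left mult.assoc)
  qed
  from insert.IH[OF m'I ui] obtain d where d: "d \<in> I" "\<And>i x. i \<in> K \<Longrightarrow> (1 - d x) * u i x = 0"
    by blast
  \<comment> \<open>Chosen so that \<open>1 - ?d x\<close> is the product of \<open>1 - d x\<close>
    and \<open>1 - m a a x\<close>.\<close>
  let ?d = "\<lambda>x. (d x + m a a x) - d x * m a a x"
  have "?d \<in> I" using d insert.prems(1)[of a a] IS
    by (intro fun_ideal_diff[OF S I] fun_idealD(3,4)[OF I]) auto
  moreover have "(1 - ?d x) * u i x = 0" if "i \<in> insert a K" for i x
  proof -
    have split: "(1 - ?d x) * u i x = (1 - m a a x) * ((1 - d x) * u i x)"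
      "(1 - ?d x) * u i x = (1 - d x) * ((1 - m a a x) * u i x)" for i by (simp_all add: algebra_simps)
    show ?thesis
    proof (cases "i = a")
      case True
      have "(1 - d x) * (\<Sum>j\<in>K. m a j x * u j x) = (\<Sum>j\<in>K. m a j x * ((1 - d x) * u j x))"
        by (simp add: sum_distrib_left mult_ac)
      also have "\<dots> = 0" by (intro sum.neutral ballI) (simp only: d(2) mult_zero_right)
      finally show ?thesis unfolding split(2) using True ua by simp
    next
      case False
      then show ?thesis unfolding split(1) using d(2)[of i x] that by simp
    qed
  qed
  ultimately show ?case by (intro bexI[of _ ?d] ballI allI)
qed

lemma monomial_upd:
  assumes "i < k"
  shows "monomial k (e(i := q)) t = monomial k (e(i := 0)) t * t i ^ q"
proof -
  have "monomial k (e(i := q)) t = (\<Prod>j<k. t j ^ (e(i := 0)) j * (if j = i then t j ^ q else 1))"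
    unfolding monomial_def by (rule prod.cong) auto
  also have "\<dots> = monomial k (e(i := 0)) t * t i ^ q"
    using assms by (simp add: monomial_def prod.distrib prod.delta)
  finally show ?thesis .
qed

text \<open>The monomials with exponents below \<open>D\<close> generate the polynomial ring as a
  module over \<open>S\<close>. If the extension of \<open>I\<close> contained 1, Nakayama would put
  1 into \<open>I\<close>; so the extension is proper and has a zero.\<close>

theorem lying_over:
  assumes S: "subalg S" "S \<subseteq> mpoly_fun k"
    and int: "\<And>i. i < k \<Longrightarrow> \<exists>h. (\<forall>q<D. h q \<in> S) \<and> (\<forall>t. t i ^ D = (\<Sum>q<D. h q t * t i ^ q))"
    and D: "D > 0"
    and I: "fun_ideal S I" "(\<lambda>_. 1) \<notin> I"
  shows "\<exists>c. \<forall>f\<in>I. f c = 0"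
proof -
  let ?P = "mpoly_fun k"
  note P = subalg_mpoly_fun[of k]
  define K where "K = {..<k} \<rightarrow>\<^sub>E {..<D}"
  have K: "finite K" unfolding K_def by (intro finite_PiE) auto
  \<comment> \<open>The extended ideal, written in the finitely many generators, so that membership
    of the generators yields the square system that Nakayama asks for. The price is that closure
    under multiplication takes the integral equations.\<close>
  define J where "J = {(\<lambda>t. \<Sum>e\<in>K. m e t * monomial k e t) | m. \<forall>e\<in>K. m e \<in> I}"
  have JI: "(\<lambda>t. \<Sum>e\<in>K. m e t * monomial k e t) \<in> J" if "\<And>e. e \<in> K \<Longrightarrow> m e \<in> I" for m
    using that by (auto simp: J_def)
  have J0: "(\<lambda>_. 0) \<in> J" using JI[of "\<lambda>_ _. 0"] fun_idealD(2)[OF I(1)] by simp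
  have Jadd: "(\<lambda>t. f t + g t) \<in> J" if "f \<in> J" "g \<in> J" for f g
  proof -
    obtain m m' where m: "\<forall>e\<in>K. m e \<in> I" "\<forall>e\<in>K. m' e \<in> I"
      "f = (\<lambda>t. \<Sum>e\<in>K. m e t * monomial k e t)" "g = (\<lambda>t. \<Sum>e\<in>K. m' e t * monomial k e t)"
      using \<open>f \<in> J\<close> \<open>g \<in> J\<close> unfolding J_def by blast
    have "(\<lambda>t. \<Sum>e\<in>K. (m e t + m' e t) * monomial k e t) \<in> J"
      using m fun_idealD(3)[OF I(1)] by (intro JI[of "\<lambda>e t. m e t + m' e t"]) auto
    then show ?thesis by (simp add: m distrib_right sum.distrib)
  qed
  have Jsum: "(\<lambda>t. \<Sum>a\<in>A. f a t) \<in> J" if "\<And>a. a \<in> A \<Longrightarrow> f a \<in> J" for f and A :: "'z set"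
    using that by (induction A rule: infinite_finite_induct) (auto intro: J0 Jadd)
  have Jsingle: "(\<lambda>t. m t * monomial k e t) \<in> J" if m: "m \<in> I" and e: "e \<in> K" for m e
  proof -
    have "(\<lambda>t. \<Sum>e'\<in>K. (if e' = e then m t else 0) * monomial k e' t) \<in> J"
    proof (rule JI)
      fix e'
      show "(\<lambda>t. if e' = e then m t else 0) \<in> I"
        using m fun_idealD(2)[OF I(1)] by (cases "e' = e") auto
    qed
    then show ?thesis using K e by (simp add: if_distrib[of "\<lambda>z. z * _"] cong: if_cong)
  qed
  have monP: "monomial k e \<in> ?P" for e
    unfolding monomial_def[abs_def]
    by (intro subalg_prod[OF P] subalg_power[OF P] mpoly_fun.mvar) auto
  have Jvar: "(\<lambda>t. t i * f t) \<in> J" if i: "i < k" and f: "f \<in> J" for i f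
  proof -
    obtain m where m: "\<forall>e\<in>K. m e \<in> I" "f = (\<lambda>t. \<Sum>e\<in>K. m e t * monomial k e t)"
      using f unfolding J_def by blast
    have "(\<lambda>t. t i * (m e t * monomial k e t)) \<in> J" if e: "e \<in> K" for e
    proof -
      have me: "m e \<in> I" using m e by blast
      have up: "e(i := q) \<in> K" if "q < D" for q
        using e that i by (auto simp: K_def PiE_iff extensional_def)
      have mon: "monomial k e t = monomial k (e(i := 0)) t * t i ^ e i" for t
        using monomial_upd[OF i, of e "e i" t] by simp
      show ?thesis
      proof (cases "e i + 1 < D")
        case True
        from Jsingle[OF me up[OF this]] show ?thesis
          by (simp add: mon monomial_upd[OF i, of e "Suc (e i)"] mult_ac)
      next
        case False
        moreover have "e i < D" using e i by (auto simp: K_def)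
        ultimately have De: "D = Suc (e i)" by simp
        \<comment> \<open>The exponent of \<open>t i\<close> would reach \<open>D\<close>; the
          integral equation brings it back below.\<close>
        obtain h where h: "\<And>q. q < D \<Longrightarrow> h q \<in> S" "\<And>t. t i ^ D = (\<Sum>q<D. h q t * t i ^ q)"
          using int[OF i] by blast
        have "t i * (m e t * monomial k e t)
            = (\<Sum>q<D. (h q t * m e t) * monomial k (e(i := q)) t)" for t
        proof -
          have "t i * (m e t * monomial k e t) = m e t * monomial k (e(i := 0)) t * t i ^ D"
            unfolding De mon[of t] by simp
          also have "\<dots> = (\<Sum>q<D. (h q t * m e t) * (monomial k (e(i := 0)) t * t i ^ q))"
            unfolding h(2) by (simp add: sum_distrib_left mult_ac)
          also have "\<dots> = (\<Sum>q<D. (h q t * m e t) * monomial k (e(i := q)) t)"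
            by (simp only: monomial_upd[OF i, symmetric])
          finally show ?thesis .
        qed
        moreover have "(\<lambda>t. \<Sum>q<D. (h q t * m e t) * monomial k (e(i := q)) t) \<in> J"
          by (intro Jsum Jsingle fun_idealD(4)[OF I(1) me] h(1) up) auto
        ultimately show ?thesis by simp
      qed
    qed
    from Jsum[of K, OF this] show ?thesis by (simp add: m(2) sum_distrib_left)
  qed
  have Jmult: "\<forall>f\<in>J. (\<lambda>t. p t * f t) \<in> J" if "p \<in> ?P" for p
    using that
  proof induction
    case (mconst c)
    show ?case
    proof
      fix f assume "f \<in> J"
      then obtain m where m: "\<forall>e\<in>K. m e \<in> I" "f = (\<lambda>t. \<Sum>e\<in>K. m e t * monomial k e t)"
        unfolding J_def by blast
      have "(\<lambda>t. \<Sum>e\<in>K. (c * m e t) * monomial k e t) \<in> J"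
        using m fun_idealD(4)[OF I(1) _ subalgD(1)[OF S(1)]] by (intro JI[of "\<lambda>e t. c * m e t"]) auto
      then show "(\<lambda>t. c * f t) \<in> J" by (simp add: m sum_distrib_left mult.assoc)
    qed
  next
    case (mvar i)
    then show ?case using Jvar by blast
  next
    case (madd p q)
    then show ?case using Jadd[of "\<lambda>t. p t * _ t" "\<lambda>t. q t * _ t"]
      by (auto simp: distrib_right)
  next
    case (mmult p q)
    then show ?case by (simp add: mult.assoc)
  qed
  have JP: "J \<subseteq> ?P"
    using monP S(2) fun_idealD(1)[OF I(1)]
    by (auto simp: J_def intro!: subalg_sum[OF P] subalgD(3)[OF P])
  have Jid: "fun_ideal ?P J"
    unfolding fun_ideal_def using JP J0 Jadd Jmult by blast
  define z where "z = restrict (\<lambda>_. 0::nat) {..<k}"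
  have z: "z \<in> K" "monomial k z = (\<lambda>_. 1)" using D by (auto simp: z_def K_def monomial_def)
  have IJ: "I \<subseteq> J" using Jsingle[OF _ z(1)] by (auto simp: z(2))
  have "(\<lambda>_. 1) \<notin> J"
  proof
    assume "(\<lambda>_. 1) \<in> J"
    then have "monomial k e \<in> J" for e using Jmult[OF monP[of e]] by fastforce
    then have "\<forall>e. \<exists>m. (\<forall>e'\<in>K. m e' \<in> I) \<and> monomial k e = (\<lambda>t. \<Sum>e'\<in>K. m e' t * monomial k e' t)"
      by (simp add: J_def) metis
    then obtain m where m: "\<And>e e'. e' \<in> K \<Longrightarrow> m e e' \<in> I"
      "\<And>e. monomial k e = (\<lambda>t. \<Sum>e'\<in>K. m e e' t * monomial k e' t)" by metis
    \<comment> \<open>The generators are written as combinations of themselves with coefficients in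
      \<open>I\<close>; the constant monomial, of index \<open>z\<close>, then forces
      \<open>d\<close> to be 1.\<close>
    obtain d where "d \<in> I" "\<forall>e\<in>K. \<forall>t. (1 - d t) * monomial k e t = 0"
      using nakayama[OF S(1) I(1) K m(1) fun_cong[OF m(2)]] by blast
    with z have "d = (\<lambda>_. 1)" by (auto simp: fun_eq_iff)
    with \<open>d \<in> I\<close> I(2) show False by simp
  qed
  from weak_nullstellensatz[OF Jid this] IJ show ?thesis by blast
qed

section \<open>Invariants of pairs of matrices\<close>

lemma subalg_poly_fun: "subalg (poly_fun n)"
  unfolding subalg_def by (blast intro: poly_fun.intros)

text \<open>Serves three kinds of parameters \<open>a\<close>: a curve parameter
  (\<open>upoly\<close>), slice coordinates (\<open>mpoly_fun\<close>) and pairs of matrices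
  (\<open>poly_fun\<close>).\<close>

lemma poly_fun_pullback:
  assumes S: "subalg S" and p: "p \<in> poly_fun n"
    and A: "\<And>i j. i < n \<Longrightarrow> j < n \<Longrightarrow> (\<lambda>a. fst (y a) $$ (i, j)) \<in> S"
    and B: "\<And>i j. i < n \<Longrightarrow> j < n \<Longrightarrow> (\<lambda>a. snd (y a) $$ (i, j)) \<in> S"
  shows "(\<lambda>a. p (y a)) \<in> S"
  using p by induction (auto intro: A B subalgD[OF S])

definition upoly :: "(complex \<Rightarrow> complex) set" where
  "upoly = range poly"

lemma subalg_upoly: "subalg upoly"
  unfolding subalg_def upoly_def
proof (intro conjI allI ballI)
  show "(\<lambda>_. c) \<in> range poly" for c :: complex by (rule range_eqI[of _ _ "[:c:]"]) auto
  fix f g :: "complex \<Rightarrow> complex" assume "f \<in> range poly" "g \<in> range poly"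
  then obtain p q where "f = poly p" "g = poly q" by blast
  then have "(\<lambda>x. f x + g x) = poly (p + q)" "(\<lambda>x. f x * g x) = poly (p * q)" by auto
  then show "(\<lambda>x. f x + g x) \<in> range poly" "(\<lambda>x. f x * g x) \<in> range poly" by blast+
qed

lemma upoly_ident: "(\<lambda>s. s) \<in> upoly"
  unfolding upoly_def by (rule range_eqI[of _ _ "[:0, 1:]"]) auto

lemma upoly_zero:
  assumes "f \<in> upoly" "finite F" "\<And>s. s \<notin> F \<Longrightarrow> f s = 0"
  shows "f s = 0"
  using assms poly_zero_if_cofinite unfolding upoly_def by blast

lemma mat3_index:
  assumes "A \<in> carrier_mat n n" "B \<in> carrier_mat n n" "C \<in> carrier_mat n n" "i < n" "j < n"
  shows "(A * B * C) $$ (i, j) = (\<Sum>l<n. (\<Sum>k<n. A $$ (i, k) * B $$ (k, l)) * C $$ (l, j))"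
proof -
  have "(A * B * C) $$ (i, j) = row (A * B) i \<bullet> col C j"
    using assms by (intro index_mult_mat(1)) auto
  also have "\<dots> = (\<Sum>l<n. (A * B) $$ (i, l) * C $$ (l, j))"
    using assms by (auto simp: scalar_prod_def lessThan_atLeast0 intro!: sum.cong)
  also have "\<dots> = (\<Sum>l<n. (\<Sum>k<n. A $$ (i, k) * B $$ (k, l)) * C $$ (l, j))"
    by (rule sum.cong) (use assms in \<open>auto simp: scalar_prod_def lessThan_atLeast0\<close>)
  finally show ?thesis .
qed

lemma mem_ambient: "x \<in> ambient n \<longleftrightarrow> fst x \<in> carrier_mat n n \<and> snd x \<in> carrier_mat n n"
  by (cases x) (simp add: ambient_def)

lemma mem_Zn: "x \<in> Zn n \<longleftrightarrow> x \<in> ambient n \<and> fst x * snd x + snd x * fst x = 0\<^sub>m n n"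
  by (cases x) (simp add: ambient_def Zn_def)

lemma conj_ambient: "GLpair n g h \<Longrightarrow> x \<in> ambient n \<Longrightarrow> conj_act g h x \<in> ambient n"
  by (auto simp: GLpair_def mem_ambient conj_act_def)

lemma GLpair_sym: "GLpair n g h \<Longrightarrow> GLpair n h g"
  by (simp add: GLpair_def)

lemma GLpair_one: "GLpair n (1\<^sub>m n) (1\<^sub>m n)"
  by (simp add: GLpair_def)

lemma conj_mult:
  fixes g :: "complex mat"
  assumes "GLpair n g h" "A \<in> carrier_mat n n" "B \<in> carrier_mat n n"
  shows "(g * A * h) * (g * B * h) = g * (A * B) * h"
proof -
  have c: "g \<in> carrier_mat n n" "h \<in> carrier_mat n n" and hg: "h * g = 1\<^sub>m n"
    using assms by (auto simp: GLpair_def)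
  have "(g * A * h) * (g * B * h) = g * A * (h * g * B * h)"
    using c assms by (simp add: assoc_mult_mat[of _ n n _ n _ n])
  then show ?thesis unfolding hg using c assms by (simp add: assoc_mult_mat[of _ n n _ n _ n])
qed

lemma conj_Zn:
  assumes G: "GLpair n g h" and x: "x \<in> Zn n"
  shows "conj_act g h x \<in> Zn n"
proof -
  have c: "g \<in> carrier_mat n n" "h \<in> carrier_mat n n" using G by (auto simp: GLpair_def)
  obtain A B where AB: "x = (A, B)" by (cases x)
  have AB2: "A \<in> carrier_mat n n" "B \<in> carrier_mat n n" "A * B + B * A = 0\<^sub>m n n"
    using x by (auto simp: AB mem_Zn mem_ambient)
  have "(g * A * h) * (g * B * h) + (g * B * h) * (g * A * h) = g * (A * B) * h + g * (B * A) * h"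
    using conj_mult[OF G] AB2 by simp
  also have "\<dots> = (g * (A * B) + g * (B * A)) * h"
    using c AB2 by (simp add: add_mult_distrib_mat[of _ n n])
  also have "g * (A * B) + g * (B * A) = g * (A * B + B * A)"
    using c AB2 by (intro mult_add_distrib_mat[symmetric]) auto
  finally show ?thesis
    using c AB2 conj_ambient[OF G, of x] x by (simp add: mem_Zn conj_act_def AB)
qed

lemma conj_comp:
  assumes "GLpair n g h" "GLpair n g' h'" "x \<in> ambient n"
  shows "conj_act g h (conj_act g' h' x) = conj_act (g * g') (h' * h) x"
    and "GLpair n (g * g') (h' * h)"
proof -
  have c: "g \<in> carrier_mat n n" "h \<in> carrier_mat n n" "g' \<in> carrier_mat n n" "h' \<in> carrier_mat n n"
    "g * h = 1\<^sub>m n" "h * g = 1\<^sub>m n" "g' * h' = 1\<^sub>m n" "h' * g' = 1\<^sub>m n"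
    using assms by (auto simp: GLpair_def)
  have "g * (g' * A * h') * h = g * g' * A * (h' * h)" if A: "A \<in> carrier_mat n n" for A
  proof -
    have "g * (g' * A * h') * h = g * (g' * A * h' * h)"
      by (rule assoc_mult_mat) (use c A in auto)
    also have "g' * A * h' * h = g' * A * (h' * h)"
      by (rule assoc_mult_mat) (use c A in auto)
    also have "g * (g' * A * (h' * h)) = g * (g' * A) * (h' * h)"
      by (rule assoc_mult_mat[symmetric]) (use c A in auto)
    also have "g * (g' * A) = g * g' * A"
      by (rule assoc_mult_mat[symmetric]) (use c A in auto)
    finally show ?thesis .
  qed
  then show "conj_act g h (conj_act g' h' x) = conj_act (g * g') (h' * h) x"
    using assms(3) by (simp add: conj_act_def mem_ambient)
  have "P * Q * (R * S) = P * (Q * R) * S"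
    if "P \<in> carrier_mat n n" "Q \<in> carrier_mat n n" "R \<in> carrier_mat n n" "S \<in> carrier_mat n n"
    for P Q R S :: "complex mat"
  proof -
    have "P * Q * (R * S) = P * Q * R * S"
      by (rule assoc_mult_mat[symmetric]) (use that in auto)
    also have "P * Q * R = P * (Q * R)" by (rule assoc_mult_mat) (use that in auto)
    finally show ?thesis .
  qed
  from this[OF c(1,3,4,2)] this[OF c(4,2,1,3)]
  have "g * g' * (h' * h) = g * (g' * h') * h" "h' * h * (g * g') = h' * (h * g) * g'" .
  then show "GLpair n (g * g') (h' * h)" using c by (auto simp: GLpair_def)
qed

lemma conj_inverse:
  assumes "GLpair n g h" "x \<in> ambient n"
  shows "conj_act h g (conj_act g h x) = x"
proof -
  have "conj_act h g (conj_act g h x) = conj_act (1\<^sub>m n) (1\<^sub>m n) x"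
    using conj_comp(1)[OF GLpair_sym[OF assms(1)] assms] assms(1) by (simp add: GLpair_def)
  then show ?thesis using assms(2) by (cases x) (auto simp: conj_act_def mem_ambient)
qed

text \<open>Closed subsets stable under conjugation. The whole variety and every
  \<open>Z_pmr\<close> are instances, so the later arguments run once for both.\<close>

definition gvar :: "nat \<Rightarrow> pt set \<Rightarrow> bool" where
  "gvar n X \<longleftrightarrow> X \<subseteq> ambient n \<and> zar_closure n X \<subseteq> X
     \<and> (\<forall>g h. GLpair n g h \<longrightarrow> (\<forall>x\<in>X. conj_act g h x \<in> X))"

lemma gvarD:
  assumes "gvar n X"
  shows "x \<in> X \<Longrightarrow> x \<in> ambient n" "zar_closure n X \<subseteq> X"
    "GLpair n g h \<Longrightarrow> x \<in> X \<Longrightarrow> conj_act g h x \<in> X"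
  using assms unfolding gvar_def by blast+

lemma subset_zar_closure: "T \<subseteq> ambient n \<Longrightarrow> T \<subseteq> zar_closure n T"
  by (auto simp: zar_closure_def)

lemma zar_closure_vanish: "x \<in> zar_closure n T \<Longrightarrow> p \<in> poly_fun n \<Longrightarrow> (\<And>y. y \<in> T \<Longrightarrow> p y = 0) \<Longrightarrow> p x = 0"
  by (auto simp: zar_closure_def)

lemma gvar_Zn: "gvar n (Zn n)"
  unfolding gvar_def
proof (intro conjI allI impI ballI)
  show "Zn n \<subseteq> ambient n" by (auto simp: mem_Zn)
  show "zar_closure n (Zn n) \<subseteq> Zn n"
  proof
    fix x assume x: "x \<in> zar_closure n (Zn n)"
    then have xa: "x \<in> ambient n" by (simp add: zar_closure_def)
    define p where "p = (\<lambda>i j (y::pt). \<Sum>k<n. fst y $$ (i, k) * snd y $$ (k, j) + snd y $$ (i, k) * fst y $$ (k, j))"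
    have p: "p i j \<in> poly_fun n" if "i < n" "j < n" for i j unfolding p_def
      by (intro subalg_sum[OF subalg_poly_fun] poly_fun.intros) (use that in auto)
    have pe: "p i j y = (fst y * snd y + snd y * fst y) $$ (i, j)"
      if "y \<in> ambient n" "i < n" "j < n" for i j y
      using that by (auto simp: p_def mem_ambient scalar_prod_def lessThan_atLeast0 sum.distrib)
    have "p i j x = 0" if "i < n" "j < n" for i j
      by (rule zar_closure_vanish[OF x p[OF that]]) (use that in \<open>auto simp: mem_Zn pe\<close>)
    then have "(fst x * snd x + snd x * fst x) $$ (i, j) = 0" if "i < n" "j < n" for i j
      using pe[OF xa that] that by simp
    then have "fst x * snd x + snd x * fst x = 0\<^sub>m n n"
      by (intro eq_matI) (use xa in \<open>auto simp: mem_ambient\<close>)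
    then show "x \<in> Zn n" using xa by (simp add: mem_Zn)
  qed
qed (rule conj_Zn)

text \<open>Conjugation is a polynomial map preserving \<open>T\<close>, so an equation of
  \<open>T\<close> pulled back along it is again an equation of \<open>T\<close>.\<close>

lemma gvar_closure:
  assumes T: "T \<subseteq> ambient n" and G: "\<And>g h x. GLpair n g h \<Longrightarrow> x \<in> T \<Longrightarrow> conj_act g h x \<in> T"
  shows "gvar n (zar_closure n T)"
  unfolding gvar_def
proof (intro conjI allI impI ballI)
  show amb: "zar_closure n T \<subseteq> ambient n" by (auto simp: zar_closure_def)
  show "zar_closure n (zar_closure n T) \<subseteq> zar_closure n T" by (auto simp: zar_closure_def)
  fix g h x assume gh: "GLpair n g h" and x: "x \<in> zar_closure n T"
  \<comment> \<open>Conjugation written out in entries: membership in \<open>poly_fun\<close>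
    concerns all pairs, also those of the wrong size, where \<open>conj_act\<close> need not be
    given by these sums.\<close>
  define y where "y = (\<lambda>z::pt. (mat n n (\<lambda>(i, j). \<Sum>l<n. (\<Sum>k<n. g $$ (i, k) * fst z $$ (k, l)) * h $$ (l, j)),
      mat n n (\<lambda>(i, j). \<Sum>l<n. (\<Sum>k<n. g $$ (i, k) * snd z $$ (k, l)) * h $$ (l, j))))"
  have c: "g \<in> carrier_mat n n" "h \<in> carrier_mat n n" using gh by (auto simp: GLpair_def)
  have y: "conj_act g h z = y z" if "z \<in> ambient n" for z
    unfolding conj_act_def y_def prod.inject
  proof (intro conjI eq_matI)
    fix i j
    assume "i < dim_row (mat n n (\<lambda>(i, j). \<Sum>l<n. (\<Sum>k<n. g $$ (i, k) * fst z $$ (k, l)) * h $$ (l, j)))"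
      "j < dim_col (mat n n (\<lambda>(i, j). \<Sum>l<n. (\<Sum>k<n. g $$ (i, k) * fst z $$ (k, l)) * h $$ (l, j)))"
    then show "(g * fst z * h) $$ (i, j)
        = mat n n (\<lambda>(i, j). \<Sum>l<n. (\<Sum>k<n. g $$ (i, k) * fst z $$ (k, l)) * h $$ (l, j)) $$ (i, j)"
      using mat3_index[of g n "fst z" h i j] c that by (auto simp del: index_mult_mat(1) assoc_mult_mat simp: mem_ambient)
  next
    fix i j
    assume "i < dim_row (mat n n (\<lambda>(i, j). \<Sum>l<n. (\<Sum>k<n. g $$ (i, k) * snd z $$ (k, l)) * h $$ (l, j)))"
      "j < dim_col (mat n n (\<lambda>(i, j). \<Sum>l<n. (\<Sum>k<n. g $$ (i, k) * snd z $$ (k, l)) * h $$ (l, j)))"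
    then show "(g * snd z * h) $$ (i, j)
        = mat n n (\<lambda>(i, j). \<Sum>l<n. (\<Sum>k<n. g $$ (i, k) * snd z $$ (k, l)) * h $$ (l, j)) $$ (i, j)"
      using mat3_index[of g n "snd z" h i j] c that by (auto simp del: index_mult_mat(1) assoc_mult_mat simp: mem_ambient)
  qed (use c that in auto)
  have "p (conj_act g h x) = 0" if p: "p \<in> poly_fun n" "\<forall>z\<in>T. p z = 0" for p
  proof -
    have "(\<lambda>z. p (y z)) \<in> poly_fun n"
    proof (rule poly_fun_pullback[OF subalg_poly_fun p(1)])
      fix i j assume ij: "i < n" "j < n"
      have "(\<lambda>a. \<Sum>l<n. (\<Sum>k<n. g $$ (i, k) * fst a $$ (k, l)) * h $$ (l, j)) \<in> poly_fun n"
        "(\<lambda>a. \<Sum>l<n. (\<Sum>k<n. g $$ (i, k) * snd a $$ (k, l)) * h $$ (l, j)) \<in> poly_fun n"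
        by (intro subalg_sum[OF subalg_poly_fun] poly_fun.intros; use ij in auto)+
      then show "(\<lambda>a. fst (y a) $$ (i, j)) \<in> poly_fun n" "(\<lambda>a. snd (y a) $$ (i, j)) \<in> poly_fun n"
        using ij by (simp_all add: y_def)
    qed
    moreover have "p (y z) = 0" if "z \<in> T" for z
      using y[of z] G[OF gh that] p(2) T that by (metis subsetD)
    ultimately have "p (y x) = 0" by (rule zar_closure_vanish[OF x])
    then show ?thesis using y[of x] amb x by auto
  qed
  then show "conj_act g h x \<in> zar_closure n T"
    using conj_ambient[OF gh] amb x by (auto simp: zar_closure_def)
qed

text \<open>Having the same image in the quotient; successive degenerations are composed through its
  transitivity.\<close>

definition ieq :: "nat \<Rightarrow> pt set \<Rightarrow> pt \<Rightarrow> pt \<Rightarrow> bool" where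
  "ieq n X x y \<longleftrightarrow> (\<forall>f\<in>inv_ring n X. f x = f y)"

lemma ieq_trans: "ieq n X x y \<Longrightarrow> ieq n X y z \<Longrightarrow> ieq n X x z"
  unfolding ieq_def by metis

lemma ieq_conj: "GLpair n g h \<Longrightarrow> x \<in> X \<Longrightarrow> ieq n X x (conj_act g h x)"
  by (simp add: ieq_def inv_ring_def)

lemma inv_ringE:
  assumes "f \<in> inv_ring n X"
  obtains p where "p \<in> poly_fun n" "f = ext0 X p"
  using assms by (auto simp: inv_ring_def coord_ring_def)

lemma curve_limit_mem:
  assumes X: "gvar n X"
    and A: "\<And>i j. i < n \<Longrightarrow> j < n \<Longrightarrow> (\<lambda>s. fst (y s) $$ (i, j)) \<in> upoly"
    and B: "\<And>i j. i < n \<Longrightarrow> j < n \<Longrightarrow> (\<lambda>s. snd (y s) $$ (i, j)) \<in> upoly"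
    and amb: "\<And>s. y s \<in> ambient n"
    and F: "finite F" "\<And>s. s \<notin> F \<Longrightarrow> y s \<in> X"
  shows "y s \<in> X"
proof -
  have "p (y s) = 0" if p: "p \<in> poly_fun n" "\<forall>x\<in>X. p x = 0" for p
    by (rule upoly_zero[OF poly_fun_pullback[OF subalg_upoly p(1) A B] F(1)]) (use p F(2) in auto)
  then show ?thesis using gvarD(2)[OF X] amb by (auto simp: zar_closure_def)
qed

text \<open>An invariant is constant on the conjugates \<open>y s\<close> with
  \<open>s \<noteq> 0\<close>, and along the curve it is a polynomial in \<open>s\<close>, so the
  value persists at \<open>s = 0\<close>. Closedness keeps the limit in \<open>X\<close>.\<close>

lemma ieq_limit:
  assumes X: "gvar n X"
    and A: "\<And>i j. i < n \<Longrightarrow> j < n \<Longrightarrow> (\<lambda>s. fst (y s) $$ (i, j)) \<in> upoly"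
    and B: "\<And>i j. i < n \<Longrightarrow> j < n \<Longrightarrow> (\<lambda>s. snd (y s) $$ (i, j)) \<in> upoly"
    and amb: "\<And>s. y s \<in> ambient n"
    and x: "x \<in> X" and conj: "\<And>s. s \<noteq> 0 \<Longrightarrow> \<exists>g h. GLpair n g h \<and> y s = conj_act g h x"
  shows "y s \<in> X" "ieq n X x (y s)"
proof -
  have ys: "y s \<in> X" for s
  proof (rule curve_limit_mem[OF X A B amb, of "{0}"])
    fix s :: complex assume "s \<notin> {0}"
    with conj[of s] obtain g h where "GLpair n g h" "y s = conj_act g h x" by auto
    then show "y s \<in> X" using gvarD(3)[OF X _ x] by simp
  qed auto
  then show "y s \<in> X" .
  show "ieq n X x (y s)"
    unfolding ieq_def
  proof
    fix f assume f: "f \<in> inv_ring n X"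
    then obtain p where p: "p \<in> poly_fun n" "f = ext0 X p" by (rule inv_ringE)
    have "(\<lambda>s. p (y s) - p x) \<in> upoly"
      by (intro subalg_diff[OF subalg_upoly] poly_fun_pullback[OF subalg_upoly p(1) A B]
          subalgD(1)[OF subalg_upoly])
    then have "p (y s) - p x = 0"
    proof (rule upoly_zero[of _ "{0}"])
      fix s :: complex assume "s \<notin> {0}"
      with conj[of s] obtain g h where "GLpair n g h" "y s = conj_act g h x" by auto
      then have "f x = f (y s)" using f ieq_conj[OF _ x] by (auto simp: ieq_def)
      then show "p (y s) - p x = 0" using p(2) x ys by (simp add: ext0_def)
    qed simp
    then show "f x = f (y s)" using p(2) x ys by (simp add: ext0_def)
  qed
qed

text \<open>The entrywise form shows how the weights \<open>d\<close> scale each entry, which is how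
  the degenerating curves are recognised as conjugates.\<close>

lemma conj_diag:
  assumes d: "\<And>i. i < n \<Longrightarrow> d i \<noteq> 0" and x: "x \<in> ambient n"
  shows "\<exists>g h. GLpair n g h \<and> (mat n n (\<lambda>(i, j). d i * fst x $$ (i, j) / d j),
     mat n n (\<lambda>(i, j). d i * snd x $$ (i, j) / d j)) = conj_act g h x"
proof (intro exI conjI)
  let ?g = "mat n n (\<lambda>(i, j). if i = j then d i else 0)"
  let ?h = "mat n n (\<lambda>(i, j). if i = j then inverse (d i) else 0)"
  have "?g * ?h = 1\<^sub>m n"
    by (rule eq_matI) (use d in \<open>auto simp: scalar_prod_def if_distrib[of "\<lambda>z. _ * z"] cong: if_cong\<close>)
  moreover have "?h * ?g = 1\<^sub>m n"
    by (rule eq_matI) (use d in \<open>auto simp: scalar_prod_def if_distrib[of "\<lambda>z. _ * z"] cong: if_cong\<close>)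
  ultimately show "GLpair n ?g ?h" by (simp add: GLpair_def)
  have "mat n n (\<lambda>(i, j). d i * A $$ (i, j) / d j) = ?g * A * ?h" if A: "A \<in> carrier_mat n n" for A
  proof (rule eq_matI)
    fix i j assume "i < dim_row (?g * A * ?h)" "j < dim_col (?g * A * ?h)"
    then have ij: "i < n" "j < n" by auto
    have "(?g * A * ?h) $$ (i, j) = (\<Sum>l<n. (\<Sum>k<n. ?g $$ (i, k) * A $$ (k, l)) * ?h $$ (l, j))"
      by (rule mat3_index) (use A ij in auto)
    also have "\<dots> = (\<Sum>l<n. (\<Sum>k<n. (if k = i then d i * A $$ (i, l) else 0)) * (if l = j then inverse (d j) else 0))"
      using ij by (intro sum.cong arg_cong2[where f="(*)"]) auto
    also have "\<dots> = (\<Sum>l<n. (if l = j then d i * A $$ (i, j) * inverse (d j) else 0))"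
      using ij by (intro sum.cong) auto
    also have "\<dots> = d i * A $$ (i, j) / d j" using ij by (simp add: field_simps)
    finally show "mat n n (\<lambda>(i, j). d i * A $$ (i, j) / d j) $$ (i, j) = (?g * A * ?h) $$ (i, j)"
      using ij by simp
  qed (use A in auto)
  then show "(mat n n (\<lambda>(i, j). d i * fst x $$ (i, j) / d j),
     mat n n (\<lambda>(i, j). d i * snd x $$ (i, j) / d j)) = conj_act ?g ?h x"
    using x by (simp add: conj_act_def mem_ambient)
qed

lemma conj_perm:
  assumes \<pi>: "\<And>i. i < n \<Longrightarrow> \<pi> i < n \<and> \<sigma> (\<pi> i) = i" and \<sigma>: "\<And>i. i < n \<Longrightarrow> \<sigma> i < n \<and> \<pi> (\<sigma> i) = i"
    and x: "x \<in> ambient n"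
  shows "\<exists>g h. GLpair n g h \<and> (mat n n (\<lambda>(i, j). fst x $$ (\<pi> i, \<pi> j)),
     mat n n (\<lambda>(i, j). snd x $$ (\<pi> i, \<pi> j))) = conj_act g h x"
proof (intro exI conjI)
  let ?g = "mat n n (\<lambda>(i, j). if j = \<pi> i then 1 else 0 :: complex)"
  let ?h = "mat n n (\<lambda>(i, j). if i = \<pi> j then 1 else 0 :: complex)"
  have inj: "\<pi> i = \<pi> j \<longleftrightarrow> i = j" if "i < n" "j < n" for i j using \<pi> that by metis
  have gh: "?g * ?h = 1\<^sub>m n"
  proof (rule eq_matI)
    fix i j assume "i < dim_row (1\<^sub>m n)" "j < dim_col (1\<^sub>m n)"
    then have ij: "i < n" "j < n" by auto
    have "(?g * ?h) $$ (i, j) = (\<Sum>k\<in>{0..<n}. ?g $$ (i, k) * ?h $$ (k, j))"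
      using ij by (simp add: scalar_prod_def)
    also have "\<dots> = (\<Sum>k\<in>{0..<n}. (if k = \<pi> i then (if \<pi> i = \<pi> j then 1 else 0) else 0))"
      using ij by (intro sum.cong) auto
    finally have "(?g * ?h) $$ (i, j)
        = (\<Sum>k\<in>{0..<n}. (if k = \<pi> i then (if \<pi> i = \<pi> j then 1 else 0) else 0))" .
    then show "(?g * ?h) $$ (i, j) = 1\<^sub>m n $$ (i, j)" using ij \<pi> inj by simp
  qed auto
  then have "?h * ?g = 1\<^sub>m n" by (intro mat_mult_left_right_inverse[OF _ _ gh]) auto
  with gh show "GLpair n ?g ?h" by (simp add: GLpair_def)
  have "mat n n (\<lambda>(i, j). A $$ (\<pi> i, \<pi> j)) = ?g * A * ?h" if A: "A \<in> carrier_mat n n" for A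
  proof (rule eq_matI)
    fix i j assume "i < dim_row (?g * A * ?h)" "j < dim_col (?g * A * ?h)"
    then have ij: "i < n" "j < n" by auto
    have "(?g * A * ?h) $$ (i, j) = (\<Sum>l<n. (\<Sum>k<n. ?g $$ (i, k) * A $$ (k, l)) * ?h $$ (l, j))"
      by (rule mat3_index) (use A ij in auto)
    also have "\<dots> = (\<Sum>l<n. (\<Sum>k<n. (if k = \<pi> i then A $$ (\<pi> i, l) else 0)) * (if l = \<pi> j then 1 else 0))"
      using ij by (intro sum.cong arg_cong2[where f="(*)"]) auto
    also have "\<dots> = (\<Sum>l<n. (if l = \<pi> j then A $$ (\<pi> i, \<pi> j) else 0))"
      using ij \<pi> by (intro sum.cong) auto
    also have "\<dots> = A $$ (\<pi> i, \<pi> j)" using ij \<pi> by simp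
    finally show "mat n n (\<lambda>(i, j). A $$ (\<pi> i, \<pi> j)) $$ (i, j) = (?g * A * ?h) $$ (i, j)"
      using ij by simp
  qed (use A in auto)
  then show "(mat n n (\<lambda>(i, j). fst x $$ (\<pi> i, \<pi> j)),
     mat n n (\<lambda>(i, j). snd x $$ (\<pi> i, \<pi> j))) = conj_act ?g ?h x"
    using x by (simp add: conj_act_def mem_ambient)
qed

section \<open>Degeneration to the slices\<close>

lemma eigenvector_exists:
  fixes C :: "complex mat"
  assumes C: "C \<in> carrier_mat n n" and n: "n > 0"
  obtains v a where "v \<in> carrier_vec n" "v \<noteq> 0\<^sub>v n" "C *\<^sub>v v = a \<cdot>\<^sub>v v"
proof -
  have "degree (char_poly C) = n" using degree_monic_char_poly[OF C] by simp
  then have "\<not> constant (poly (char_poly C))" using n by (simp add: constant_degree)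
  then obtain a where "poly (char_poly C) a = 0" using fundamental_theorem_of_algebra by blast
  then have "eigenvalue C a" using eigenvalue_root_char_poly[OF C] by simp
  then show ?thesis using that C by (auto simp: eigenvalue_def eigenvector_def)
qed

lemma mult_mat_vec_index:
  assumes "A \<in> carrier_mat n n" "v \<in> carrier_vec n" "i < n"
  shows "(A *\<^sub>v v) $ i = (\<Sum>j<n. A $$ (i, j) * v $ j)"
  using assms by (auto simp: scalar_prod_def lessThan_atLeast0 intro!: sum.cong)

text \<open>Induction on the length of the initial segment supporting an eigenvector
  \<open>v\<close> of \<open>A\<close>: \<open>T\<close> minus its last relevant diagonal entry
  preserves the eigenspace of \<open>A\<close> and, \<open>T\<close> being triangular, shortens the
  support. Once it kills \<open>v\<close>, a common eigenvector is found.\<close>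

lemma common_eigenvector_triangular:
  fixes A T :: "complex mat"
  assumes A: "A \<in> carrier_mat n n" and T: "T \<in> carrier_mat n n" "upper_triangular T"
    and comm: "A * T = T * A" and n: "n > 0"
  obtains v a c where "v \<in> carrier_vec n" "v \<noteq> 0\<^sub>v n" "A *\<^sub>v v = a \<cdot>\<^sub>v v" "T *\<^sub>v v = c \<cdot>\<^sub>v v"
proof -
  obtain v0 a where v0: "v0 \<in> carrier_vec n" "v0 \<noteq> 0\<^sub>v n" "A *\<^sub>v v0 = a \<cdot>\<^sub>v v0"
    using eigenvector_exists[OF A n] by metis
  have "\<exists>w c. w \<in> carrier_vec n \<and> w \<noteq> 0\<^sub>v n \<and> A *\<^sub>v w = a \<cdot>\<^sub>v w \<and> T *\<^sub>v w = c \<cdot>\<^sub>v w"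
    if "k \<le> n" "v \<in> carrier_vec n" "v \<noteq> 0\<^sub>v n" "A *\<^sub>v v = a \<cdot>\<^sub>v v"
      "\<And>i. k \<le> i \<Longrightarrow> i < n \<Longrightarrow> v $ i = 0" for k v
    using that
  proof (induction k arbitrary: v)
    case 0
    then have "v = 0\<^sub>v n" by (intro eq_vecI) auto
    then show ?case using 0 by simp
  next
    case (Suc k)
    define c where "c = T $$ (k, k)"
    define v' where "v' = T *\<^sub>v v - c \<cdot>\<^sub>v v"
    have Tv: "T *\<^sub>v v \<in> carrier_vec n" using T Suc.prems by auto
    have v': "v' \<in> carrier_vec n" unfolding v'_def using Tv Suc.prems by auto
    show ?case
    proof (cases "v' = 0\<^sub>v n")
      case True
      have "T *\<^sub>v v = c \<cdot>\<^sub>v v"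
      proof (rule eq_vecI)
        fix i assume "i < dim_vec (c \<cdot>\<^sub>v v)"
        then have i: "i < n" using Suc.prems by auto
        then have "v' $ i = 0" using True by simp
        then show "(T *\<^sub>v v) $ i = (c \<cdot>\<^sub>v v) $ i"
          using i Tv Suc.prems unfolding v'_def by (auto simp del: index_mult_mat_vec)
      qed (use T Suc.prems in auto)
      then show ?thesis using Suc.prems by blast
    next
      case False
      have "A *\<^sub>v v' = A *\<^sub>v (T *\<^sub>v v) - A *\<^sub>v (c \<cdot>\<^sub>v v)"
        unfolding v'_def by (rule mult_minus_distrib_mat_vec[OF A Tv]) (use Suc.prems in auto)
      also have "A *\<^sub>v (T *\<^sub>v v) = (T * A) *\<^sub>v v"
        unfolding comm[symmetric] by (rule assoc_mult_mat_vec[symmetric, OF A T(1) Suc.prems(2)])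
      also have "\<dots> = T *\<^sub>v (a \<cdot>\<^sub>v v)"
        using assoc_mult_mat_vec[OF T(1) A Suc.prems(2)] Suc.prems(4) by simp
      also have "\<dots> = a \<cdot>\<^sub>v (T *\<^sub>v v)" by (rule mult_mat_vec[OF T(1) Suc.prems(2)])
      also have "A *\<^sub>v (c \<cdot>\<^sub>v v) = c \<cdot>\<^sub>v (a \<cdot>\<^sub>v v)"
        using mult_mat_vec[OF A Suc.prems(2)] Suc.prems(4) by simp
      also have "a \<cdot>\<^sub>v (T *\<^sub>v v) - c \<cdot>\<^sub>v (a \<cdot>\<^sub>v v) = a \<cdot>\<^sub>v v'"
        unfolding v'_def
        by (rule eq_vecI) (use Tv T Suc.prems in \<open>auto simp: algebra_simps simp del: index_mult_mat_vec\<close>)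
      finally have Av': "A *\<^sub>v v' = a \<cdot>\<^sub>v v'" .
      have "v' $ i = 0" if i: "k \<le> i" "i < n" for i
      proof -
        have "(T *\<^sub>v v) $ i = (\<Sum>j<n. T $$ (i, j) * v $ j)"
          by (rule mult_mat_vec_index) (use T Suc.prems i in auto)
        also have "\<dots> = (\<Sum>j<n. if j = k then T $$ (i, k) * v $ k else 0)"
        proof (rule sum.cong[OF refl])
          fix j assume j: "j \<in> {..<n}"
          consider "j < k" | "j = k" | "j > k" by linarith
          then show "T $$ (i, j) * v $ j = (if j = k then T $$ (i, k) * v $ k else 0)"
          proof cases
            case 1
            then have "T $$ (i, j) = 0" using T i j by (auto simp: upper_triangular_def)
            with 1 show ?thesis by simp
          next
            case 3
            then show ?thesis using Suc.prems(5)[of j] j by simp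
          qed simp
        qed
        also have "\<dots> = T $$ (i, k) * v $ k" using i by simp
        also have "\<dots> = c * v $ i"
        proof (cases "i = k")
          case False
          then have "T $$ (i, k) = 0" using T i by (auto simp: upper_triangular_def)
          moreover have "v $ i = 0" using Suc.prems(5)[of i] i False by simp
          ultimately show ?thesis by simp
        qed (simp add: c_def)
        finally have "(T *\<^sub>v v) $ i = c * v $ i" .
        then show ?thesis
          unfolding v'_def using i Tv T Suc.prems by (simp del: index_mult_mat_vec)
      qed
      then show ?thesis using Suc.IH[of v'] v' False Av' Suc.prems(1) by auto
    qed
  qed
  from this[of n v0] v0 that show ?thesis by auto
qed

lemma schur_form:
  fixes C :: "complex mat"
  assumes C: "C \<in> carrier_mat n n"
  obtains T P Q where "GLpair n P Q" "T \<in> carrier_mat n n" "upper_triangular T" "C = P * T * Q"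
proof -
  obtain es where es: "char_poly C = (\<Prod>e\<leftarrow>es. [:- e, 1:])" using char_poly_factorized[OF C] by blast
  obtain T P Q where TPQ: "schur_decomposition C es = (T, P, Q)" by (metis surj_pair)
  from schur_decomposition[OF C es TPQ] have s: "similar_mat_wit C T P Q" "upper_triangular T" by auto
  from similar_mat_witD2[OF C s(1)] show ?thesis
    using that[of P Q T] s(2) by (simp add: GLpair_def)
qed

lemma common_eigenvector:
  fixes A C :: "complex mat"
  assumes A: "A \<in> carrier_mat n n" and C: "C \<in> carrier_mat n n"
    and comm: "A * C = C * A" and n: "n > 0"
  obtains v a c where "v \<in> carrier_vec n" "v \<noteq> 0\<^sub>v n" "A *\<^sub>v v = a \<cdot>\<^sub>v v" "C *\<^sub>v v = c \<cdot>\<^sub>v v"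
proof -
  obtain T P Q where G: "GLpair n P Q" and T: "T \<in> carrier_mat n n" "upper_triangular T"
    and CT: "C = P * T * Q" using schur_form[OF C] by blast
  have PQ: "P \<in> carrier_mat n n" "Q \<in> carrier_mat n n" "P * Q = 1\<^sub>m n" "Q * P = 1\<^sub>m n"
    using G by (auto simp: GLpair_def)
  have TC: "T = Q * C * P"
    using conj_inverse[OF G, of "(T, T)"] T by (simp add: CT conj_act_def mem_ambient)
  let ?A = "Q * A * P"
  have A': "?A \<in> carrier_mat n n" using A PQ by auto
  have "?A * T = T * ?A"
    unfolding TC conj_mult[OF GLpair_sym[OF G] A C] conj_mult[OF GLpair_sym[OF G] C A] comm ..
  then obtain w a c where w: "w \<in> carrier_vec n" "w \<noteq> 0\<^sub>v n" "?A *\<^sub>v w = a \<cdot>\<^sub>v w" "T *\<^sub>v w = c \<cdot>\<^sub>v w"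
    using common_eigenvector_triangular[OF A' T _ n] by blast
  have transport: "M *\<^sub>v (P *\<^sub>v w) = e \<cdot>\<^sub>v (P *\<^sub>v w)"
    if M: "M \<in> carrier_mat n n" and e: "(Q * M * P) *\<^sub>v w = e \<cdot>\<^sub>v w" for M e
  proof -
    have "M = P * (Q * M * P) * Q"
      using conj_inverse[OF GLpair_sym[OF G], of "(M, M)"] M by (simp add: conj_act_def mem_ambient)
    then have "M * P = P * (Q * M * P) * Q * P" by simp
    also have "\<dots> = P * (Q * M * P) * (Q * P)"
      by (rule assoc_mult_mat) (use M PQ in auto)
    also have "\<dots> = P * (Q * M * P)" unfolding PQ(4)
      by (rule right_mult_one_mat) (use M PQ in auto)
    finally have MP: "M * P = P * (Q * M * P)" .
    have "M *\<^sub>v (P *\<^sub>v w) = (M * P) *\<^sub>v w" by (rule assoc_mult_mat_vec[symmetric, OF M PQ(1) w(1)])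
    also have "\<dots> = P *\<^sub>v ((Q * M * P) *\<^sub>v w)"
      unfolding MP by (rule assoc_mult_mat_vec[OF PQ(1) _ w(1)]) (use M PQ in auto)
    also have "\<dots> = e \<cdot>\<^sub>v (P *\<^sub>v w)" unfolding e by (rule mult_mat_vec[OF PQ(1) w(1)])
    finally show ?thesis .
  qed
  have "P *\<^sub>v w \<noteq> 0\<^sub>v n"
  proof
    assume 0: "P *\<^sub>v w = 0\<^sub>v n"
    have "w = (Q * P) *\<^sub>v w" using PQ w by simp
    also have "\<dots> = Q *\<^sub>v (P *\<^sub>v w)" by (rule assoc_mult_mat_vec[OF PQ(2,1) w(1)])
    also have "\<dots> = 0\<^sub>v n" unfolding 0 using PQ by (intro eq_vecI) auto
    finally show False using w by simp
  qed
  moreover have "P *\<^sub>v w \<in> carrier_vec n" using PQ w by auto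
  ultimately show ?thesis using that transport[OF A w(3)] transport[OF C] w(4) TC by metis
qed

text \<open>For a common eigenvector \<open>v\<close> of \<open>A\<close> and \<open>B * B\<close>,
  the vectors \<open>v\<close> and \<open>B v\<close> span an invariant subspace. Whether it
  contains a common eigenvector is decided by the vanishing of \<open>B v\<close>, of
  \<open>a\<close> and of the eigenvalue \<open>c\<close> of \<open>B * B\<close>.\<close>

lemma anticommuting_eigenvectors:
  assumes x: "(A, B) \<in> Zn n" and n: "n > 0"
  shows "(\<exists>v a b. v \<in> carrier_vec n \<and> v \<noteq> 0\<^sub>v n \<and> a * b = 0 \<and> A *\<^sub>v v = a \<cdot>\<^sub>v v \<and> B *\<^sub>v v = b \<cdot>\<^sub>v v)
    \<or> (\<exists>v w a b. v \<in> carrier_vec n \<and> v \<noteq> 0\<^sub>v n \<and> w \<in> carrier_vec n \<and> w \<noteq> 0\<^sub>v n \<and> a \<noteq> 0 \<and> b \<noteq> 0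
      \<and> A *\<^sub>v v = a \<cdot>\<^sub>v v \<and> A *\<^sub>v w = (- a) \<cdot>\<^sub>v w \<and> B *\<^sub>v v = b \<cdot>\<^sub>v w \<and> B *\<^sub>v w = b \<cdot>\<^sub>v v)"
proof -
  have A: "A \<in> carrier_mat n n" and B: "B \<in> carrier_mat n n" and AB: "A * B + B * A = 0\<^sub>m n n"
    using x by (auto simp: mem_Zn mem_ambient)
  have anti: "A * B = (- 1) \<cdot>\<^sub>m (B * A)"
  proof (rule eq_matI)
    fix i j assume "i < dim_row ((- 1) \<cdot>\<^sub>m (B * A))" "j < dim_col ((- 1) \<cdot>\<^sub>m (B * A))"
    then have ij: "i < n" "j < n" using A B by auto
    then have "(A * B + B * A) $$ (i, j) = 0" using AB by simp
    moreover have "(A * B + B * A) $$ (i, j) = (A * B) $$ (i, j) + (B * A) $$ (i, j)"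
      by (rule index_add_mat(1)) (use A B ij in auto)
    ultimately have "(A * B) $$ (i, j) = - ((B * A) $$ (i, j))" by (simp add: eq_neg_iff_add_eq_0)
    then show "(A * B) $$ (i, j) = ((- 1) \<cdot>\<^sub>m (B * A)) $$ (i, j)"
      using ij A B by (simp del: index_mult_mat(1))
  qed (use A B in auto)
  have ABv: "A *\<^sub>v (B *\<^sub>v v) = (- e) \<cdot>\<^sub>v (B *\<^sub>v v)" if v: "v \<in> carrier_vec n" "A *\<^sub>v v = e \<cdot>\<^sub>v v" for v e
  proof -
    have "A *\<^sub>v (B *\<^sub>v v) = ((- 1) \<cdot>\<^sub>m (B * A)) *\<^sub>v v"
      unfolding anti[symmetric] by (rule assoc_mult_mat_vec[symmetric, OF A B v(1)])
    also have "\<dots> = (- 1) \<cdot>\<^sub>v ((B * A) *\<^sub>v v)"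
    proof (rule eq_vecI)
      fix i assume "i < dim_vec ((- 1) \<cdot>\<^sub>v ((B * A) *\<^sub>v v))"
      then have i: "i < n" using B by auto
      have "row ((- 1) \<cdot>\<^sub>m (B * A)) i = (- 1) \<cdot>\<^sub>v row (B * A) i"
        by (rule eq_vecI) (use A B i in auto)
      then show "(((- 1) \<cdot>\<^sub>m (B * A)) *\<^sub>v v) $ i = ((- 1) \<cdot>\<^sub>v ((B * A) *\<^sub>v v)) $ i"
        using A B v i by (simp add: smult_scalar_prod_distrib[of _ n] del: assoc_mult_mat_vec row_mult)
    qed (use A B in auto)
    also have "(B * A) *\<^sub>v v = e \<cdot>\<^sub>v (B *\<^sub>v v)"
      using assoc_mult_mat_vec[OF B A v(1)] mult_mat_vec[OF B v(1)] v(2) by simp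
    finally show ?thesis by (simp add: smult_smult_assoc)
  qed
  \<comment> \<open>Moving \<open>A\<close> past \<open>B\<close> twice changes the sign
    twice.\<close>
  have "A * (B * B) = (A * B) * B" by (rule assoc_mult_mat[symmetric, OF A B B])
  also have "\<dots> = (- 1) \<cdot>\<^sub>m (B * A * B)" unfolding anti
    by (rule mult_smult_assoc_mat[of _ n n _ n]) (use A B in auto)
  also have "B * A * B = B * (A * B)" by (rule assoc_mult_mat[OF B A B])
  also have "\<dots> = (- 1) \<cdot>\<^sub>m (B * (B * A))" unfolding anti
    by (rule mult_smult_distrib[of _ n n _ n]) (use A B in auto)
  also have "(- 1) \<cdot>\<^sub>m ((- 1) \<cdot>\<^sub>m (B * (B * A))) = B * (B * A)"
    by (rule eq_matI) auto
  also have "\<dots> = (B * B) * A" by (rule assoc_mult_mat[symmetric, OF B B A])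
  finally obtain v a c where v: "v \<in> carrier_vec n" "v \<noteq> 0\<^sub>v n" "A *\<^sub>v v = a \<cdot>\<^sub>v v" "(B * B) *\<^sub>v v = c \<cdot>\<^sub>v v"
    using common_eigenvector[OF A _ _ n, of "B * B"] B by auto
  have BBv: "B *\<^sub>v (B *\<^sub>v v) = c \<cdot>\<^sub>v v" using v assoc_mult_mat_vec[OF B B v(1)] by simp
  have Bv: "B *\<^sub>v v \<in> carrier_vec n" using B v by auto
  define b where "b = csqrt c"
  have bb: "b * b = c" using power2_csqrt[of c] by (simp add: b_def power2_eq_square)
  consider "B *\<^sub>v v = 0\<^sub>v n" | "B *\<^sub>v v \<noteq> 0\<^sub>v n" "a = 0" | "B *\<^sub>v v \<noteq> 0\<^sub>v n" "a \<noteq> 0" "c = 0"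
    | "B *\<^sub>v v \<noteq> 0\<^sub>v n" "a \<noteq> 0" "c \<noteq> 0" by blast
  then show ?thesis
  proof cases
    case 1
    then have "B *\<^sub>v v = 0 \<cdot>\<^sub>v v" using v by (intro eq_vecI) auto
    then show ?thesis using v by (intro disjI1 exI[of _ v] exI[of _ a] exI[of _ 0]) auto
  next
    case 2
    \<comment> \<open>\<open>A\<close> kills both \<open>v\<close> and \<open>B v\<close>, and
      \<open>B * B\<close> multiplies \<open>v\<close> by \<open>b * b\<close>: hence
      \<open>B u = b u\<close>, unless \<open>u = 0\<close> and \<open>v\<close> itself has
      eigenvalue \<open>- b\<close>.\<close>
    define u where "u = B *\<^sub>v v + b \<cdot>\<^sub>v v"
    have u: "u \<in> carrier_vec n" unfolding u_def using Bv v by auto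
    have BvA: "A *\<^sub>v (B *\<^sub>v v) = 0 \<cdot>\<^sub>v (B *\<^sub>v v)" using ABv[OF v(1,3)] 2 by simp
    show ?thesis
    proof (cases "u = 0\<^sub>v n")
      case True
      have "B *\<^sub>v v = (- b) \<cdot>\<^sub>v v"
      proof (rule eq_vecI)
        fix i assume "i < dim_vec ((- b) \<cdot>\<^sub>v v)"
        then have i: "i < n" using v by auto
        then have "u $ i = 0" using True by simp
        then show "(B *\<^sub>v v) $ i = ((- b) \<cdot>\<^sub>v v) $ i"
          unfolding u_def using i v Bv by (simp add: eq_neg_iff_add_eq_0 del: index_mult_mat_vec)
      qed (use B v in auto)
      then show ?thesis using v 2 by (intro disjI1 exI[of _ v] exI[of _ a] exI[of _ "- b"]) auto
    next
      case False
      have "A *\<^sub>v u = A *\<^sub>v (B *\<^sub>v v) + A *\<^sub>v (b \<cdot>\<^sub>v v)" unfolding u_def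
        by (rule mult_add_distrib_mat_vec[OF A Bv]) (use v in auto)
      also have "A *\<^sub>v (b \<cdot>\<^sub>v v) = b \<cdot>\<^sub>v (0 \<cdot>\<^sub>v v)" using mult_mat_vec[OF A v(1)] v(3) 2 by simp
      finally have "A *\<^sub>v u = 0 \<cdot>\<^sub>v (B *\<^sub>v v) + b \<cdot>\<^sub>v (0 \<cdot>\<^sub>v v)" unfolding BvA .
      also have "\<dots> = 0 \<cdot>\<^sub>v u" unfolding u_def
        by (rule eq_vecI) (use v Bv B in \<open>auto simp del: index_mult_mat_vec\<close>)
      finally have Au: "A *\<^sub>v u = 0 \<cdot>\<^sub>v u" .
      have "B *\<^sub>v u = B *\<^sub>v (B *\<^sub>v v) + B *\<^sub>v (b \<cdot>\<^sub>v v)" unfolding u_def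
        by (rule mult_add_distrib_mat_vec[OF B Bv]) (use v in auto)
      also have "B *\<^sub>v (b \<cdot>\<^sub>v v) = b \<cdot>\<^sub>v (B *\<^sub>v v)" by (rule mult_mat_vec[OF B v(1)])
      also have "B *\<^sub>v (B *\<^sub>v v) + b \<cdot>\<^sub>v (B *\<^sub>v v) = b \<cdot>\<^sub>v u" unfolding BBv u_def bb[symmetric]
        by (rule eq_vecI) (use v Bv B in \<open>auto simp: algebra_simps simp del: index_mult_mat_vec\<close>)
      finally have "B *\<^sub>v u = b \<cdot>\<^sub>v u" .
      then show ?thesis using u False Au by (intro disjI1 exI[of _ u] exI[of _ 0] exI[of _ b]) auto
    qed
  next
    case 3
    have "B *\<^sub>v (B *\<^sub>v v) = 0 \<cdot>\<^sub>v (B *\<^sub>v v)" unfolding BBv 3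
      by (rule eq_vecI) (use v B Bv in \<open>auto simp del: index_mult_mat_vec\<close>)
    then show ?thesis using 3 Bv ABv[OF v(1,3)]
      by (intro disjI1 exI[of _ "B *\<^sub>v v"] exI[of _ "- a"] exI[of _ 0]) auto
  next
    case 4
    have b0: "b \<noteq> 0" using bb 4 by auto
    \<comment> \<open>Normalised so that both off-diagonal entries of \<open>B\<close> in the basis
      \<open>v\<close>, \<open>w\<close> equal \<open>b\<close>, as in the blocks of the
      slices.\<close>
    define w where "w = inverse b \<cdot>\<^sub>v (B *\<^sub>v v)"
    have w: "w \<in> carrier_vec n" unfolding w_def using Bv by auto
    have Bvw: "B *\<^sub>v v = b \<cdot>\<^sub>v w" unfolding w_def using b0 by (simp add: smult_smult_assoc)
    have "w \<noteq> 0\<^sub>v n"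
    proof
      assume "w = 0\<^sub>v n"
      then have "B *\<^sub>v v = 0\<^sub>v n" unfolding Bvw by (intro eq_vecI) auto
      then show False using 4 by simp
    qed
    moreover have "A *\<^sub>v w = (- a) \<cdot>\<^sub>v w" unfolding w_def mult_mat_vec[OF A Bv] ABv[OF v(1,3)]
      by (simp add: smult_smult_assoc mult.commute)
    moreover have "B *\<^sub>v w = b \<cdot>\<^sub>v v" 
    proof -
      have "inverse b * (b * b) = b" using b0 by simp
      then show ?thesis unfolding w_def mult_mat_vec[OF B Bv] BBv bb[symmetric]
        by (simp only: smult_smult_assoc)
    qed
    ultimately show ?thesis using v w Bvw 4 b0
      by (intro disjI2 exI[of _ v] exI[of _ w] exI[of _ a] exI[of _ b]) auto
  qed
qed

section \<open>Completing one or two vectors to a basis\<close>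

lemma trivial_kernel_GLpair:
  fixes h :: "complex mat"
  assumes h: "h \<in> carrier_mat n n"
    and ker: "\<And>x. x \<in> carrier_vec n \<Longrightarrow> h *\<^sub>v x = 0\<^sub>v n \<Longrightarrow> x = 0\<^sub>v n"
  obtains g where "GLpair n g h"
proof -
  have "det h \<noteq> 0" using det_0_iff_vec_prod_zero[OF h] ker by blast
  then have "h \<in> Units (ring_mat TYPE(complex) n ())" by (rule det_non_zero_imp_unit[OF h])
  then obtain g where "g \<in> carrier_mat n n" "g * h = 1\<^sub>m n" "h * g = 1\<^sub>m n"
    by (auto simp: Units_def ring_mat_def)
  then show ?thesis using that h by (simp add: GLpair_def)
qed

lemma complete_basis1:
  fixes v :: "complex vec"
  assumes v: "v \<in> carrier_vec n" "v \<noteq> 0\<^sub>v n" and n: "n > 0"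
  obtains g h where "GLpair n g h" "col h 0 = v"
proof -
  obtain k where k: "k < n" "v $ k \<noteq> 0"
  proof (rule ccontr)
    assume "\<not> thesis"
    then have "v = 0\<^sub>v n" using that v by (intro eq_vecI) auto
    then show False using v by simp
  qed
  \<comment> \<open>The columns after the first are the unit vectors other than the one at
    \<open>k\<close>, where \<open>v\<close> is nonzero.\<close>
  define \<pi> where "\<pi> = transpose 0 k"
  have \<pi>n: "\<pi> i < n" if "i < n" for i using that k n by (auto simp: \<pi>_def transpose_def)
  have inj: "\<pi> i = \<pi> j \<longleftrightarrow> i = j" for i j
    unfolding \<pi>_def by (metis transpose_involutory)
  define h where "h = mat n n (\<lambda>(i, j). if j = 0 then v $ i else if i = \<pi> j then 1 else 0)"
  have h: "h \<in> carrier_mat n n" by (simp add: h_def)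
  have "x = 0\<^sub>v n" if x: "x \<in> carrier_vec n" "h *\<^sub>v x = 0\<^sub>v n" for x
  proof -
    have row: "v $ \<pi> j * x $ 0 + (if j = 0 then 0 else x $ j) = 0" if j: "j < n" for j
    proof -
      have "0 = (\<Sum>l<n. h $$ (\<pi> j, l) * x $ l)"
        using mult_mat_vec_index[OF h x(1) \<pi>n[OF j]] x(2) \<pi>n[OF j] by simp
      also have "\<dots> = (\<Sum>l<n. (if l = 0 then v $ \<pi> j * x $ 0 else 0) + (if l = j then (if j = 0 then 0 else x $ j) else 0))"
        using \<pi>n[OF j] by (intro sum.cong) (auto simp: h_def inj)
      also have "\<dots> = v $ \<pi> j * x $ 0 + (if j = 0 then 0 else x $ j)"
        using j by (simp add: sum.distrib)
      finally show ?thesis by simp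
    qed
    have x0: "x $ 0 = 0" using row[of 0] n k by (simp add: \<pi>_def)
    show ?thesis
    proof (rule eq_vecI)
      fix j assume "j < dim_vec (0\<^sub>v n)"
      then show "x $ j = 0\<^sub>v n $ j" using row[of j] x0 by (auto split: if_splits)
    qed (use x in auto)
  qed
  then obtain g where g: "GLpair n g h" using trivial_kernel_GLpair[OF h] by blast
  have "col h 0 = v" by (rule eq_vecI) (use v n in \<open>auto simp: h_def\<close>)
  with g that show ?thesis by blast
qed

lemma complete_basis2:
  fixes v w :: "complex vec"
  assumes v: "v \<in> carrier_vec n" "v \<noteq> 0\<^sub>v n" and w: "w \<in> carrier_vec n" and n: "n > 0"
    and indep: "\<And>e. w \<noteq> e \<cdot>\<^sub>v v"
  obtains g h where "GLpair n g h" "col h 0 = v" "col h 1 = w" "n \<ge> 2"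
proof -
  obtain k where k: "k < n" "v $ k \<noteq> 0"
  proof (rule ccontr)
    assume "\<not> thesis"
    then have "v = 0\<^sub>v n" using that v by (intro eq_vecI) auto
    then show False using v by simp
  qed
  obtain l where l: "l < n" "v $ k * w $ l \<noteq> v $ l * w $ k"
  proof (rule ccontr)
    assume "\<not> thesis"
    then have "w = (w $ k / v $ k) \<cdot>\<^sub>v v"
      using that v w k by (intro eq_vecI) (auto simp: field_simps)
    then show False using indep by blast
  qed
  have kl: "k \<noteq> l" using l by (metis mult.commute)
  then have n2: "n \<ge> 2" using k l by linarith
  \<comment> \<open>The place to which the swap of 0 and \<open>k\<close> sends \<open>l\<close>;
    with it \<open>\<pi>\<close> maps 0 to \<open>k\<close> and 1 to \<open>l\<close>, the rows of a
    nonzero minor of \<open>v\<close> and \<open>w\<close>.\<close>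
  define m where "m = transpose 0 k l"
  have m: "m \<noteq> 0" "m < n" using kl l k n by (auto simp: m_def transpose_def split: if_splits)
  define \<pi> where "\<pi> = transpose 0 k \<circ> transpose 1 m"
  have \<pi>n: "\<pi> i < n" if "i < n" for i using that k n n2 m by (auto simp: \<pi>_def transpose_def)
  have inj: "\<pi> i = \<pi> j \<longleftrightarrow> i = j" for i j
    unfolding \<pi>_def o_def by (metis transpose_involutory)
  have \<pi>0: "\<pi> 0 = k" using m by (simp add: \<pi>_def transpose_def)
  have \<pi>1: "\<pi> 1 = l" by (simp add: \<pi>_def m_def)
  define h where "h = mat n n (\<lambda>(i, j). if j = 0 then v $ i else if j = 1 then w $ i else if i = \<pi> j then 1 else 0)"
  have h: "h \<in> carrier_mat n n" by (simp add: h_def)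
  have "x = 0\<^sub>v n" if x: "x \<in> carrier_vec n" "h *\<^sub>v x = 0\<^sub>v n" for x
  proof -
    have row: "v $ \<pi> j * x $ 0 + w $ \<pi> j * x $ 1 + (if j < 2 then 0 else x $ j) = 0" if j: "j < n" for j
    proof -
      have "0 = (\<Sum>l<n. h $$ (\<pi> j, l) * x $ l)"
        using mult_mat_vec_index[OF h x(1) \<pi>n[OF j]] x(2) \<pi>n[OF j] by simp
      also have "\<dots> = (\<Sum>l<n. (if l = 0 then v $ \<pi> j * x $ 0 else 0) + (if l = 1 then w $ \<pi> j * x $ 1 else 0)
          + (if l = j then (if j < 2 then 0 else x $ j) else 0))"
        using \<pi>n[OF j] by (intro sum.cong) (auto simp: h_def inj)
      also have "\<dots> = v $ \<pi> j * x $ 0 + w $ \<pi> j * x $ 1 + (if j < 2 then 0 else x $ j)"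
        using j n2 by (simp add: sum.distrib)
      finally show ?thesis by simp
    qed
    have e0: "v $ k * x $ 0 + w $ k * x $ 1 = 0" using row[of 0] n \<pi>0 by simp
    have e1: "v $ l * x $ 0 + w $ l * x $ 1 = 0" using row[of 1] n2 \<pi>1 by simp
    have "(v $ k * w $ l - v $ l * w $ k) * x $ 1
        = v $ k * (v $ l * x $ 0 + w $ l * x $ 1) - v $ l * (v $ k * x $ 0 + w $ k * x $ 1)"
      by (simp add: algebra_simps)
    then have x1: "x $ 1 = 0" using e0 e1 l by simp
    then have x0: "x $ 0 = 0" using e0 k by simp
    show ?thesis
    proof (rule eq_vecI)
      fix j assume "j < dim_vec (0\<^sub>v n)"
      moreover have "j < 2 \<Longrightarrow> x $ j = 0" using x0 x1 by (auto simp: less_2_cases_iff)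
      ultimately show "x $ j = 0\<^sub>v n $ j" using row[of j] x0 x1 by (auto split: if_splits)
    qed (use x in auto)
  qed
  then obtain g where g: "GLpair n g h" using trivial_kernel_GLpair[OF h] by blast
  have "col h 0 = v" "col h 1 = w"
    by (rule eq_vecI; use v w n n2 in \<open>auto simp: h_def\<close>)+
  with g that n2 show ?thesis by blast
qed

lemma conj_col:
  fixes A :: "complex mat"
  assumes G: "GLpair n g h" and A: "A \<in> carrier_mat n n" and j: "j < n" "j' < n"
    and eq: "A *\<^sub>v col h j = a \<cdot>\<^sub>v col h j'" and i: "i < n"
  shows "(g * A * h) $$ (i, j) = (if i = j' then a else 0)"
proof -
  have c: "g \<in> carrier_mat n n" "h \<in> carrier_mat n n" and gh: "g * h = 1\<^sub>m n"
    using G by (auto simp: GLpair_def)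
  have "g * A * h = g * (A * h)" by (rule assoc_mult_mat[OF c(1) A c(2)])
  then have "(g * A * h) $$ (i, j) = row g i \<bullet> col (A * h) j"
    using c A i j by (simp del: assoc_mult_mat)
  also have "col (A * h) j = A *\<^sub>v col h j"
    by (rule eq_vecI) (use c A j in auto)
  also have "row g i \<bullet> (A *\<^sub>v col h j) = a * (row g i \<bullet> col h j')"
    unfolding eq using c i j by simp
  also have "row g i \<bullet> col h j' = (g * h) $$ (i, j')" using c i j by simp
  finally show ?thesis unfolding gh using i j by simp
qed


section \<open>Block sums of pairs and the slices\<close>

definition block_sum :: "nat \<Rightarrow> nat \<Rightarrow> pt \<Rightarrow> pt \<Rightarrow> pt" where
  "block_sum k l b y = (four_block_mat (fst b) (0\<^sub>m k l) (0\<^sub>m l k) (fst y),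
     four_block_mat (snd b) (0\<^sub>m k l) (0\<^sub>m l k) (snd y))"

abbreviation bdiag :: "nat \<Rightarrow> nat \<Rightarrow> complex mat \<Rightarrow> complex mat \<Rightarrow> complex mat" where
  "bdiag k l X Y \<equiv> four_block_mat X (0\<^sub>m k l) (0\<^sub>m l k) Y"

lemma bdiag_mult:
  assumes "X \<in> carrier_mat k k" "Y \<in> carrier_mat l l" "X' \<in> carrier_mat k k" "Y' \<in> carrier_mat l l"
  shows "bdiag k l X Y * bdiag k l X' Y' = bdiag k l (X * X') (Y * Y')"
  using assms by (subst mult_four_block_mat[of _ k k _ l _ l]) auto

lemma bdiag_eq_zero_iff:
  assumes X: "X \<in> carrier_mat k k" and Y: "Y \<in> carrier_mat l l"
  shows "bdiag k l X Y = 0\<^sub>m (k + l) (k + l) \<longleftrightarrow> X = 0\<^sub>m k k \<and> Y = 0\<^sub>m l l"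
proof
  assume 0: "bdiag k l X Y = 0\<^sub>m (k + l) (k + l)"
  have "X $$ (i, j) = 0" if "i < k" "j < k" for i j
    using arg_cong[OF 0, of "\<lambda>M. M $$ (i, j)"] X Y that by simp
  moreover have "Y $$ (i, j) = 0" if "i < l" "j < l" for i j
    using arg_cong[OF 0, of "\<lambda>M. M $$ (k + i, k + j)"] X Y that by simp
  ultimately show "X = 0\<^sub>m k k \<and> Y = 0\<^sub>m l l" using X Y by (intro conjI eq_matI) auto
qed simp

lemma block_sum_ambient: "b \<in> ambient k \<Longrightarrow> y \<in> ambient l \<Longrightarrow> block_sum k l b y \<in> ambient (k + l)"
  by (auto simp: mem_ambient block_sum_def)

lemma block_sum_mem_Zn:
  assumes b: "b \<in> ambient k" and y: "y \<in> ambient l"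
  shows "block_sum k l b y \<in> Zn (k + l) \<longleftrightarrow> b \<in> Zn k \<and> y \<in> Zn l"
proof -
  have c: "fst b \<in> carrier_mat k k" "snd b \<in> carrier_mat k k" "fst y \<in> carrier_mat l l" "snd y \<in> carrier_mat l l"
    using b y by (auto simp: mem_ambient)
  let ?X = "fst b * snd b + snd b * fst b" and ?Y = "fst y * snd y + snd y * fst y"
  have X: "?X \<in> carrier_mat k k" and Y: "?Y \<in> carrier_mat l l" using c by auto
  have "fst (block_sum k l b y) * snd (block_sum k l b y) + snd (block_sum k l b y) * fst (block_sum k l b y)
      = bdiag k l (fst b * snd b) (fst y * snd y) + bdiag k l (snd b * fst b) (snd y * fst y)"
    using c by (simp add: block_sum_def bdiag_mult)
  also have "\<dots> = bdiag k l ?X ?Y"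
    using c by (subst add_four_block_mat[of _ k k _ l _ l]) auto
  finally have eq: "block_sum k l b y \<in> Zn (k + l) \<longleftrightarrow> bdiag k l ?X ?Y = 0\<^sub>m (k + l) (k + l)"
    using block_sum_ambient[OF b y] by (simp add: mem_Zn)
  then show ?thesis using bdiag_eq_zero_iff[OF X Y] b y by (simp add: mem_Zn)
qed

lemma block_sum_conj:
  assumes b: "b \<in> ambient k" and y: "y \<in> ambient l" and G: "GLpair l g h"
  shows "GLpair (k + l) (bdiag k l (1\<^sub>m k) g) (bdiag k l (1\<^sub>m k) h)"
    "conj_act (bdiag k l (1\<^sub>m k) g) (bdiag k l (1\<^sub>m k) h) (block_sum k l b y) = block_sum k l b (conj_act g h y)"
proof -
  have c: "fst b \<in> carrier_mat k k" "snd b \<in> carrier_mat k k" "fst y \<in> carrier_mat l l" "snd y \<in> carrier_mat l l"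
    "g \<in> carrier_mat l l" "h \<in> carrier_mat l l" "g * h = 1\<^sub>m l" "h * g = 1\<^sub>m l"
    using b y G by (auto simp: mem_ambient GLpair_def)
  show "GLpair (k + l) (bdiag k l (1\<^sub>m k) g) (bdiag k l (1\<^sub>m k) h)"
    using c by (auto simp: GLpair_def bdiag_mult)
  have "bdiag k l (1\<^sub>m k) g * bdiag k l P Q * bdiag k l (1\<^sub>m k) h = bdiag k l P (g * Q * h)"
    if "P \<in> carrier_mat k k" "Q \<in> carrier_mat l l" for P Q
    using that c bdiag_mult[of "1\<^sub>m k" k g l P Q] bdiag_mult[of P k "g * Q" l "1\<^sub>m k" h] by auto
  then show "conj_act (bdiag k l (1\<^sub>m k) g) (bdiag k l (1\<^sub>m k) h) (block_sum k l b y) = block_sum k l b (conj_act g h y)"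
    using c by (simp add: conj_act_def block_sum_def)
qed

text \<open>Adding the fixed summand \<open>b\<close> turns an invariant of the large pairs into one
  of the small pairs, because the smaller group acts through the lower right block.\<close>

lemma block_sum_ieq:
  assumes b: "b \<in> Zn k" and y: "y \<in> Zn l" "y' \<in> Zn l" and eq: "ieq l (Zn l) y y'"
  shows "ieq (k + l) (Zn (k + l)) (block_sum k l b y) (block_sum k l b y')"
  unfolding ieq_def
proof
  fix f assume f: "f \<in> inv_ring (k + l) (Zn (k + l))"
  then obtain p where p: "p \<in> poly_fun (k + l)" "f = ext0 (Zn (k + l)) p" by (rule inv_ringE)
  have ba: "b \<in> ambient k" using b by (simp add: mem_Zn)
  \<comment> \<open>The block sum in entries, so that composition with it is polynomial on all pairs
    and not only on those of size \<open>l\<close>.\<close>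
  define D where "D = (\<lambda>z::pt. (mat (k + l) (k + l) (\<lambda>(i, j). if i < k \<and> j < k then fst b $$ (i, j)
        else if k \<le> i \<and> k \<le> j then fst z $$ (i - k, j - k) else 0),
      mat (k + l) (k + l) (\<lambda>(i, j). if i < k \<and> j < k then snd b $$ (i, j)
        else if k \<le> i \<and> k \<le> j then snd z $$ (i - k, j - k) else 0)))"
  have D: "D z = block_sum k l b z" if "z \<in> ambient l" for z
    using that ba by (auto simp: D_def block_sum_def mem_ambient intro!: eq_matI)
  define q where "q = (\<lambda>z. p (D z))"
  have q: "q \<in> poly_fun l" unfolding q_def
  proof (rule poly_fun_pullback[OF subalg_poly_fun p(1)])
    fix i j assume ij: "i < k + l" "j < k + l"
    consider "i < k \<and> j < k" | "k \<le> i \<and> k \<le> j" | "\<not> (i < k \<and> j < k)" "\<not> (k \<le> i \<and> k \<le> j)" by blast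
    then have "(\<lambda>a. fst (D a) $$ (i, j)) \<in> poly_fun l \<and> (\<lambda>a. snd (D a) $$ (i, j)) \<in> poly_fun l"
    proof cases
      case 1
      then show ?thesis using ij by (simp add: D_def poly_fun.const)
    next
      case 2
      then have "i - k < l" "j - k < l" using ij by auto
      then show ?thesis using ij 2 poly_fun.coordA[of "i - k" l "j - k"] poly_fun.coordB[of "i - k" l "j - k"]
        by (simp add: D_def)
    next
      case 3
      then show ?thesis using ij by (auto simp: D_def poly_fun.const)
    qed
    then show "(\<lambda>a. fst (D a) $$ (i, j)) \<in> poly_fun l" "(\<lambda>a. snd (D a) $$ (i, j)) \<in> poly_fun l" by auto
  qed
  have qf: "q z = f (block_sum k l b z)" if "z \<in> Zn l" for z
    using that D[of z] block_sum_mem_Zn[OF ba, of z l] b p(2) by (simp add: q_def ext0_def mem_Zn)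
  have "ext0 (Zn l) q \<in> inv_ring l (Zn l)"
    unfolding inv_ring_def
  proof (intro CollectI conjI allI impI ballI)
    show "ext0 (Zn l) q \<in> coord_ring l (Zn l)" using q by (simp add: coord_ring_def)
    fix g h z assume G: "GLpair l g h" and z: "z \<in> Zn l"
    have za: "z \<in> ambient l" using z by (simp add: mem_Zn)
    have "block_sum k l b z \<in> Zn (k + l)" using block_sum_mem_Zn[OF ba za] b z by blast
    from ieq_conj[OF block_sum_conj(1)[OF ba za G] this]
    have "f (block_sum k l b (conj_act g h z)) = f (block_sum k l b z)"
      using f unfolding ieq_def block_sum_conj(2)[OF ba za G] by metis
    then show "ext0 (Zn l) q (conj_act g h z) = ext0 (Zn l) q z"
      using z conj_Zn[OF G z] by (simp add: ext0_def qf)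
  qed
  then have "ext0 (Zn l) q y = ext0 (Zn l) q y'" using eq by (simp add: ieq_def)
  then show "f (block_sum k l b y) = f (block_sum k l b y')" using y by (simp add: ext0_def qf)
qed

text \<open>Scaling the first \<open>k\<close> basis vectors and letting the scale tend to zero kills the
  off-diagonal block.\<close>

lemma block_triangular_ieq:
  assumes x: "x \<in> Zn (k + l)"
    and 0: "\<And>i j. k \<le> i \<Longrightarrow> i < k + l \<Longrightarrow> j < k \<Longrightarrow> fst x $$ (i, j) = 0 \<and> snd x $$ (i, j) = 0"
  obtains y where "y \<in> Zn l"
    "(mat k k (\<lambda>ij. fst x $$ ij), mat k k (\<lambda>ij. snd x $$ ij)) \<in> Zn k"
    "ieq (k + l) (Zn (k + l)) x (block_sum k l (mat k k (\<lambda>ij. fst x $$ ij), mat k k (\<lambda>ij. snd x $$ ij)) y)"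
proof -
  let ?n = "k + l"
  let ?b = "(mat k k (\<lambda>ij. fst x $$ ij), mat k k (\<lambda>ij. snd x $$ ij))"
  define y where "y = (mat l l (\<lambda>(i, j). fst x $$ (i + k, j + k)), mat l l (\<lambda>(i, j). snd x $$ (i + k, j + k)))"
  define z where "z = (\<lambda>s. (mat ?n ?n (\<lambda>(i, j). if i < k \<and> k \<le> j then s * fst x $$ (i, j) else fst x $$ (i, j)),
     mat ?n ?n (\<lambda>(i, j). if i < k \<and> k \<le> j then s * snd x $$ (i, j) else snd x $$ (i, j))))"
  have xa: "x \<in> ambient ?n" using x by (simp add: mem_Zn)
  have za: "z s \<in> ambient ?n" for s by (simp add: z_def mem_ambient)
  have zA: "(\<lambda>s. fst (z s) $$ (i, j)) \<in> upoly" "(\<lambda>s. snd (z s) $$ (i, j)) \<in> upoly" if "i < ?n" "j < ?n" for i j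
  proof -
    have scale: "(\<lambda>s. if P then s * e else e) \<in> upoly" for P and e :: complex
      using subalgD(3)[OF subalg_upoly upoly_ident subalgD(1)[OF subalg_upoly, of e]]
        subalgD(1)[OF subalg_upoly, of e] by (cases P) auto
    show "(\<lambda>s. fst (z s) $$ (i, j)) \<in> upoly" "(\<lambda>s. snd (z s) $$ (i, j)) \<in> upoly"
      using that scale by (simp_all add: z_def)
  qed
  have zc: "\<exists>g h. GLpair ?n g h \<and> z s = conj_act g h x" if s: "s \<noteq> 0" for s
  proof -
    define d where "d = (\<lambda>i. if i < k then s else 1)"
    have "z s = (mat ?n ?n (\<lambda>(i, j). d i * fst x $$ (i, j) / d j), mat ?n ?n (\<lambda>(i, j). d i * snd x $$ (i, j) / d j))"
      using 0 s by (auto simp: z_def d_def intro!: eq_matI)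
    then show ?thesis using conj_diag[of ?n d x] xa s by (simp add: d_def)
  qed
  have z0: "z 0 = block_sum k l ?b y"
    using xa 0 by (auto simp: z_def block_sum_def y_def mem_ambient intro!: eq_matI)
  have lim: "z 0 \<in> Zn ?n" "ieq ?n (Zn ?n) x (z 0)"
    using ieq_limit[OF gvar_Zn zA za x zc] by blast+
  have "?b \<in> ambient k" "y \<in> ambient l" by (auto simp: y_def mem_ambient)
  from lim block_sum_mem_Zn[OF this] show ?thesis using that[of y] unfolding z0 by blast
qed

text \<open>The first \<open>2 * p\<close> coordinates are the parameters \<open>a\<close> (even index) and \<open>b\<close> (odd index) of the
  two-dimensional blocks; then follow \<open>m\<close> eigenvalues of \<open>A\<close> and the remaining eigenvalues of \<open>B\<close>.\<close>

definition phi :: "nat \<Rightarrow> nat \<Rightarrow> nat \<Rightarrow> (nat \<Rightarrow> complex) \<Rightarrow> pt" where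
  "phi n p m t =
    (mat n n (\<lambda>(i, j). if i \<noteq> j then 0 else if i < 2 * p then (if even i then t i else - t (i - 1))
        else if i < 2 * p + m then t i else 0),
     mat n n (\<lambda>(i, j). if i < 2 * p then (if even i \<and> j = Suc i then t j else if odd i \<and> i = Suc j then t i else 0)
        else if i < 2 * p + m then 0 else if i = j then t i else 0))"

lemma phi_ambient: "phi n p m t \<in> ambient n"
  by (simp add: phi_def mem_ambient)

text \<open>With \<open>A\<close> diagonal, anticommuting means that
  \<open>B $$ (i, j) * (d i + d j)\<close> vanishes for every entry; the entries of \<open>B\<close>
  either join opposite eigenvalues or lie where \<open>A\<close> is zero.\<close>

lemma phi_Zn:
  assumes n: "2 * p + m \<le> n"
  shows "phi n p m t \<in> Zn n"
proof -
  let ?A = "fst (phi n p m t)" and ?B = "snd (phi n p m t)"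
  define d where "d = (\<lambda>i. ?A $$ (i, i))"
  have A: "?A = mat n n (\<lambda>(i, j). if i = j then d i else 0)" by (auto simp: phi_def d_def intro!: eq_matI)
  have B: "?B \<in> carrier_mat n n" by (simp add: phi_def)
  have AB: "(?A * ?B) $$ (i, j) = d i * ?B $$ (i, j)" if "i < n" "j < n" for i j
  proof -
    have "(?A * ?B) $$ (i, j) = (\<Sum>k\<in>{0..<n}. ?A $$ (i, k) * ?B $$ (k, j))"
      using that B by (simp add: scalar_prod_def A)
    also have "\<dots> = (\<Sum>k\<in>{0..<n}. if k = i then d i * ?B $$ (i, j) else 0)"
      using that by (intro sum.cong) (auto simp: A)
    finally show ?thesis using that by simp
  qed
  have BA: "(?B * ?A) $$ (i, j) = ?B $$ (i, j) * d j" if "i < n" "j < n" for i j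
  proof -
    have "(?B * ?A) $$ (i, j) = (\<Sum>k\<in>{0..<n}. ?B $$ (i, k) * ?A $$ (k, j))"
      using that B by (simp add: scalar_prod_def A)
    also have "\<dots> = (\<Sum>k\<in>{0..<n}. if k = j then ?B $$ (i, j) * d j else 0)"
      using that by (intro sum.cong) (auto simp: A)
    finally show ?thesis using that by simp
  qed
  have "?B $$ (i, j) * (d i + d j) = 0" if "i < n" "j < n" for i j
    using that n by (auto simp: phi_def d_def elim!: evenE oddE)
  then have "(?A * ?B + ?B * ?A) $$ (i, j) = 0" if "i < n" "j < n" for i j
    using that B AB BA by (subst index_add_mat(1)) (auto simp: algebra_simps A)
  then have "?A * ?B + ?B * ?A = 0\<^sub>m n n"
    by (intro eq_matI) (use B in \<open>auto simp: A\<close>)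
  then show ?thesis by (simp add: mem_Zn phi_ambient)
qed

text \<open>A new two-dimensional block goes to the front, so the parameters merely shift by
  two.\<close>

lemma phi_block_sum_two:
  assumes b: "b \<in> ambient 2"
    and A: "fst b $$ (0, 0) = \<alpha>" "fst b $$ (0, 1) = 0" "fst b $$ (1, 0) = 0" "fst b $$ (1, 1) = - \<alpha>"
    and B: "snd b $$ (0, 0) = 0" "snd b $$ (0, 1) = \<beta>" "snd b $$ (1, 0) = \<beta>" "snd b $$ (1, 1) = 0"
    and l: "2 * p + m \<le> l"
  shows "block_sum 2 l b (phi l p m t)
    = phi (2 + l) (Suc p) m (\<lambda>i. if i = 0 then \<alpha> else if i = 1 then \<beta> else t (i - 2))"
proof -
  have c: "fst b \<in> carrier_mat 2 2" "snd b \<in> carrier_mat 2 2" using b by (auto simp: mem_ambient)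
  have split: "i = 0 \<or> i = Suc 0 \<or> (\<exists>i'. i = Suc (Suc i'))" for i :: nat
    by (metis not0_implies_Suc)
  show ?thesis
    unfolding block_sum_def phi_def prod.inject
  proof (intro conjI eq_matI, goal_cases)
    case (1 i j)
    then show ?case using split[of i] split[of j] c A
      by (elim disjE exE) simp_all
  next
    case (4 i j)
    then show ?case using split[of i] split[of j] c B
      by (elim disjE exE; simp; auto)
  qed (use c in auto)
qed

text \<open>Moves the first basis vector to position \<open>q\<close>; a permutation of the basis is
  a conjugation.\<close>

lemma rotate_ieq:
  assumes X: "X \<in> Zn (1 + l)" and q: "q \<le> l"
    and \<pi>: "\<pi> = (\<lambda>i. if i < q then Suc i else if i = q then 0 else i)"
  shows "ieq (1 + l) (Zn (1 + l)) X (mat (1 + l) (1 + l) (\<lambda>(i, j). fst X $$ (\<pi> i, \<pi> j)),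
     mat (1 + l) (1 + l) (\<lambda>(i, j). snd X $$ (\<pi> i, \<pi> j)))"
proof -
  have "\<exists>g h. GLpair (1 + l) g h \<and> (mat (1 + l) (1 + l) (\<lambda>(i, j). fst X $$ (\<pi> i, \<pi> j)),
     mat (1 + l) (1 + l) (\<lambda>(i, j). snd X $$ (\<pi> i, \<pi> j))) = conj_act g h X"
    by (rule conj_perm[where \<sigma> = "\<lambda>i. if i = 0 then q else if i \<le> q then i - 1 else i"])
       (use q X in \<open>auto simp: \<pi> mem_Zn\<close>)
  then show ?thesis using ieq_conj[OF _ X] by metis
qed

text \<open>The entrywise core of the next lemma. \<open>\<pi>\<close> and \<open>t'\<close> are
  given by their values in the three ranges below, at and above \<open>q\<close>, so that each case
  simplifies directly.\<close>

lemma phi_block_sum_one_entries: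
  assumes c1: "dim_row (fst b) = 1" "dim_col (fst b) = 1" "dim_row (snd b) = 1" "dim_col (snd b) = 1"
    and l: "2 * p + m \<le> l" and ab: "fst b $$ (0, 0) = \<alpha>" "snd b $$ (0, 0) = \<beta>"
    and cases: "m' = m \<and> q = 2 * p + m \<and> \<alpha> = 0 \<and> e = \<beta> \<or> m' = Suc m \<and> q = 2 * p \<and> \<beta> = 0 \<and> e = \<alpha>"
    and \<pi>: "\<And>i. i < q \<Longrightarrow> \<pi> i = Suc i" "\<pi> q = 0" "\<And>i. q < i \<Longrightarrow> \<pi> i = i"
    and t': "\<And>i. i < q \<Longrightarrow> t' i = t i" "t' q = e" "\<And>i. q < i \<Longrightarrow> t' i = t (i - 1)"
    and ij: "i < Suc l" "j < Suc l"
  shows "fst (block_sum 1 l b (phi l p m t)) $$ (\<pi> i, \<pi> j) = fst (phi (1 + l) p m' t') $$ (i, j) \<and>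
    snd (block_sum 1 l b (phi l p m t)) $$ (\<pi> i, \<pi> j) = snd (phi (1 + l) p m' t') $$ (i, j)"
proof -
  have par: "2 * p = Suc i \<longleftrightarrow> False" if "even i" for i using that by presburger
  have trichotomy: "i < q \<or> i = q \<or> (\<exists>i'. q \<le> i' \<and> i = Suc i')" for i
    by (cases i) auto
  show ?thesis
    using cases trichotomy[of i] trichotomy[of j]
    apply (elim disjE exE conjE; hypsubst?;
        (use \<pi> t' c1 l ab ij par in \<open>simp add: block_sum_def phi_def\<close>)?)
         apply auto
    apply blast
    done
qed

lemma phi_block_sum_one:
  assumes b: "b \<in> Zn 1" and l: "2 * p + m \<le> l"
    and ab: "fst b $$ (0, 0) = \<alpha>" "snd b $$ (0, 0) = \<beta>" "\<alpha> * \<beta> = 0"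
  shows "\<exists>m' t'. 2 * p + m' \<le> Suc l
    \<and> ieq (1 + l) (Zn (1 + l)) (block_sum 1 l b (phi l p m t)) (phi (1 + l) p m' t')"
proof -
  have c1: "dim_row (fst b) = 1" "dim_col (fst b) = 1" "dim_row (snd b) = 1" "dim_col (snd b) = 1"
    using b by (auto simp: mem_Zn mem_ambient)
  have X: "block_sum 1 l b (phi l p m t) \<in> Zn (1 + l)"
    using block_sum_mem_Zn[of b 1 "phi l p m t" l] b phi_Zn[OF l] by (simp add: mem_Zn)
  \<comment> \<open>One of the two eigenvalues vanishes: an eigenvalue of \<open>B\<close> is
    inserted behind the \<open>m\<close> eigenvalues of \<open>A\<close>, an eigenvalue of
    \<open>A\<close> directly behind the two-dimensional blocks.\<close>
  obtain m' q e where cases: "m' = m \<and> q = 2 * p + m \<and> \<alpha> = 0 \<and> e = \<beta>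
      \<or> m' = Suc m \<and> q = 2 * p \<and> \<beta> = 0 \<and> e = \<alpha>"
    using ab(3) by auto
  define \<pi> where "\<pi> = (\<lambda>i. if i < q then Suc i else if i = q then 0 else i)"
  define t' where "t' = (\<lambda>i. if i < q then t i else if i = q then e else t (i - 1))"
  have entries: "fst (block_sum 1 l b (phi l p m t)) $$ (\<pi> i, \<pi> j) = fst (phi (1 + l) p m' t') $$ (i, j) \<and>
    snd (block_sum 1 l b (phi l p m t)) $$ (\<pi> i, \<pi> j) = snd (phi (1 + l) p m' t') $$ (i, j)"
    if "i < Suc l" "j < Suc l" for i j
    by (rule phi_block_sum_one_entries[OF c1 l ab(1,2) cases]) (auto simp: \<pi>_def t'_def that)
  have "(mat (1 + l) (1 + l) (\<lambda>(i, j). fst (block_sum 1 l b (phi l p m t)) $$ (\<pi> i, \<pi> j)),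
     mat (1 + l) (1 + l) (\<lambda>(i, j). snd (block_sum 1 l b (phi l p m t)) $$ (\<pi> i, \<pi> j)))
     = phi (1 + l) p m' t'"
    by (rule prod_eqI; rule eq_matI) (use entries phi_ambient[of "1 + l" p m' t'] in \<open>auto simp: mem_ambient\<close>)
  moreover have "q \<le> l" "2 * p + m' \<le> Suc l" using cases l by auto
  ultimately show ?thesis using rotate_ieq[OF X _ \<pi>_def] by metis
qed

text \<open>An invariant subspace of dimension one or two is split off by degeneration; the
  complementary block is again a smaller anticommuting pair, to which induction applies.\<close>

theorem Zn_ieq_phi:
  assumes "x \<in> Zn n"
  shows "\<exists>p m t. 2 * p + m \<le> n \<and> ieq n (Zn n) x (phi n p m t)"
  using assms
proof (induction n arbitrary: x rule: less_induct)
  case (less n)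
  note IH = less.IH
  have xa: "x \<in> ambient n" using less.prems by (simp add: mem_Zn)
  obtain A B where AB: "x = (A, B)" by (cases x)
  have c: "A \<in> carrier_mat n n" "B \<in> carrier_mat n n" using xa by (auto simp: AB mem_ambient)
  show ?case
  proof (cases "n = 0")
    case True
    then have "x = phi n 0 0 undefined" using c by (auto simp: AB phi_def intro!: eq_matI)
    then show ?thesis by (intro exI[of _ 0] exI[of _ undefined]) (auto simp: ieq_def)
  next
    case False
    then have n: "n > 0" by simp
    from anticommuting_eigenvectors[OF less.prems[unfolded AB] n] show ?thesis
    proof (elim disjE exE conjE)
      fix v a b
      assume v: "v \<in> carrier_vec n" "v \<noteq> 0\<^sub>v n" and ab: "a * b = 0"
        and Av: "A *\<^sub>v v = a \<cdot>\<^sub>v v" and Bv: "B *\<^sub>v v = b \<cdot>\<^sub>v v"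
      obtain g h where G: "GLpair n g h" "col h 0 = v" using complete_basis1[OF v n] by blast
      define z where "z = conj_act g h x"
      have z: "z \<in> Zn n" unfolding z_def by (rule conj_Zn[OF G(1) less.prems])
      have xz: "ieq n (Zn n) x z" unfolding z_def by (rule ieq_conj[OF G(1) less.prems])
      have zcol: "fst z $$ (i, 0) = (if i = 0 then a else 0)" "snd z $$ (i, 0) = (if i = 0 then b else 0)"
        if "i < n" for i
        using conj_col[OF G(1) c(1) n n _ that] conj_col[OF G(1) c(2) n n _ that] G(2) Av Bv
        by (auto simp: z_def conj_act_def AB simp del: index_mult_mat assoc_mult_mat)
      define l where "l = n - 1"
      have nl: "n = 1 + l" using n by (simp add: l_def)
      define bb where "bb = (mat 1 1 (\<lambda>ij. fst z $$ ij), mat 1 1 (\<lambda>ij. snd z $$ ij))"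
      obtain y where y: "y \<in> Zn l" "bb \<in> Zn 1" "ieq n (Zn n) z (block_sum 1 l bb y)"
        using block_triangular_ieq[of z 1 l] z zcol unfolding nl bb_def by auto
      obtain p m t where pmt: "2 * p + m \<le> l" "ieq l (Zn l) y (phi l p m t)"
        using IH[of l y] y(1) nl by auto
      have i1: "ieq n (Zn n) (block_sum 1 l bb y) (block_sum 1 l bb (phi l p m t))"
        unfolding nl by (rule block_sum_ieq[OF y(2,1) phi_Zn[OF pmt(1)] pmt(2)])
      obtain m' t' where "2 * p + m' \<le> Suc l" "ieq n (Zn n) (block_sum 1 l bb (phi l p m t)) (phi n p m' t')"
        using phi_block_sum_one[OF y(2) pmt(1), of a b t] zcol[OF n] ab unfolding nl by (auto simp: bb_def)
      moreover from this(2) have "ieq n (Zn n) x (phi n p m' t')"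
        by (rule ieq_trans[OF ieq_trans[OF ieq_trans[OF xz y(3)] i1]])
      ultimately show ?thesis unfolding nl by auto
    next
      fix v w a b
      assume v: "v \<in> carrier_vec n" "v \<noteq> 0\<^sub>v n" and w: "w \<in> carrier_vec n" "w \<noteq> 0\<^sub>v n"
        and ab: "a \<noteq> 0" "b \<noteq> 0"
        and Av: "A *\<^sub>v v = a \<cdot>\<^sub>v v" "A *\<^sub>v w = (- a) \<cdot>\<^sub>v w" and Bv: "B *\<^sub>v v = b \<cdot>\<^sub>v w" "B *\<^sub>v w = b \<cdot>\<^sub>v v"
      \<comment> \<open>The vectors are eigenvectors of \<open>A\<close> for the distinct
        eigenvalues \<open>a\<close> and \<open>- a\<close>.\<close>
      have indep: "w \<noteq> e \<cdot>\<^sub>v v" for e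
      proof
        assume e: "w = e \<cdot>\<^sub>v v"
        have "A *\<^sub>v w = a \<cdot>\<^sub>v w" unfolding e mult_mat_vec[OF c(1) v(1)] Av(1)
          by (simp add: smult_smult_assoc mult.commute)
        with Av(2) have aw: "a \<cdot>\<^sub>v w = (- a) \<cdot>\<^sub>v w" by simp
        have "w = 0\<^sub>v n"
        proof (rule eq_vecI)
          fix i assume "i < dim_vec (0\<^sub>v n)"
          then have i: "i < n" by simp
          have "(a \<cdot>\<^sub>v w) $ i = ((- a) \<cdot>\<^sub>v w) $ i" using aw by simp
          then show "w $ i = 0\<^sub>v n $ i" using i w ab by auto
        qed (use w in auto)
        then show False using w by simp
      qed
      obtain g h where G: "GLpair n g h" "col h 0 = v" "col h 1 = w" "n \<ge> 2"
        using complete_basis2[OF v w(1) n indep] by blast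
      define z where "z = conj_act g h x"
      have z: "z \<in> Zn n" unfolding z_def by (rule conj_Zn[OF G(1) less.prems])
      have xz: "ieq n (Zn n) x z" unfolding z_def by (rule ieq_conj[OF G(1) less.prems])
      have n1: "1 < n" using G(4) by simp
      have zcol: "fst z $$ (i, 0) = (if i = 0 then a else 0)" "fst z $$ (i, 1) = (if i = 1 then - a else 0)"
        "snd z $$ (i, 0) = (if i = 1 then b else 0)" "snd z $$ (i, 1) = (if i = 0 then b else 0)"
        if "i < n" for i
        unfolding z_def conj_act_def AB fst_conv snd_conv
        by (rule conj_col[OF G(1) c(1) _ _ _ that] conj_col[OF G(1) c(2) _ _ _ that];
            simp only: G(2,3) Av Bv n n1)+
      define l where "l = n - 2"
      have nl: "n = 2 + l" using n1 by (simp add: l_def)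
      define bb where "bb = (mat 2 2 (\<lambda>ij. fst z $$ ij), mat 2 2 (\<lambda>ij. snd z $$ ij))"
      have zz: "fst z $$ (i, j) = 0 \<and> snd z $$ (i, j) = 0" if "2 \<le> i" "i < 2 + l" "j < 2" for i j
        using zcol[of i] that nl by (auto simp: less_2_cases_iff)
      obtain y where y: "y \<in> Zn l" "bb \<in> Zn 2" "ieq n (Zn n) z (block_sum 2 l bb y)"
        using block_triangular_ieq[of z 2 l, OF _ zz] z unfolding nl bb_def by blast
      obtain p m t where pmt: "2 * p + m \<le> l" "ieq l (Zn l) y (phi l p m t)"
        using IH[of l y] y(1) nl by auto
      have i1: "ieq n (Zn n) (block_sum 2 l bb y) (block_sum 2 l bb (phi l p m t))"
        unfolding nl by (rule block_sum_ieq[OF y(2,1) phi_Zn[OF pmt(1)] pmt(2)])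
      have "block_sum 2 l bb (phi l p m t)
          = phi n (Suc p) m (\<lambda>i. if i = 0 then a else if i = 1 then b else t (i - 2))"
        unfolding nl
        by (rule phi_block_sum_two[OF _ _ _ _ _ _ _ _ _ pmt(1)])
           (use zcol[OF n] zcol[OF n1] in \<open>auto simp: bb_def mem_ambient\<close>)
      then have "ieq n (Zn n) x (phi n (Suc p) m (\<lambda>i. if i = 0 then a else if i = 1 then b else t (i - 2)))"
        using ieq_trans[OF ieq_trans[OF xz y(3)] i1] by simp
      moreover have "2 * Suc p + m \<le> n" using pmt(1) nl by simp
      ultimately show ?thesis by blast
    qed
  qed
qed

section \<open>Invariants separating the coordinates of a slice\<close>

text \<open>By the Leibniz formula: polynomials in the spectral variable with coefficients in
  \<open>poly_fun n\<close> are closed under sums and products.\<close>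

lemma char_poly_coeff_poly_fun:
  assumes N: "\<And>x. x \<in> ambient n \<Longrightarrow> N x \<in> carrier_mat n n"
    and e: "\<And>i j. i < n \<Longrightarrow> j < n \<Longrightarrow> e i j \<in> poly_fun n"
    and Ne: "\<And>x i j. x \<in> ambient n \<Longrightarrow> i < n \<Longrightarrow> j < n \<Longrightarrow> N x $$ (i, j) = e i j x"
  shows "\<exists>p\<in>poly_fun n. \<forall>x\<in>ambient n. p x = coeff (char_poly (N x)) q"
proof -
  note S = subalg_poly_fun[of n]
  define PP where "PP = {F :: pt \<Rightarrow> complex poly. \<forall>i. (\<lambda>x. coeff (F x) i) \<in> poly_fun n}"
  have PPconst: "(\<lambda>_. c) \<in> PP" for c by (simp add: PP_def poly_fun.const)
  have PPadd: "(\<lambda>x. F x + G x) \<in> PP" if "F \<in> PP" "G \<in> PP" for F G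
    using that by (auto simp: PP_def intro: poly_fun.add)
  have PPmult: "(\<lambda>x. F x * G x) \<in> PP" if "F \<in> PP" "G \<in> PP" for F G
    using that by (auto simp: PP_def coeff_mult intro!: subalg_sum[OF S] poly_fun.mult)
  have PPsum: "(\<lambda>x. \<Sum>a\<in>A. F a x) \<in> PP" if "\<And>a. a \<in> A \<Longrightarrow> F a \<in> PP" for F and A :: "(nat \<Rightarrow> nat) set"
    using that by (induction A rule: infinite_finite_induct) (auto intro: PPadd PPconst)
  have PPprod: "(\<lambda>x. \<Prod>a\<in>A. F a x) \<in> PP" if "\<And>a. a \<in> A \<Longrightarrow> F a \<in> PP" for F and A :: "nat set"
    using that by (induction A rule: infinite_finite_induct) (auto intro: PPmult PPconst)
  define E where "E = (\<lambda>i j x. [:0, 1:] * (if i = j then 1 else 0) + [:- e i j x:])"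
  have E: "E i j \<in> PP" if "i < n" "j < n" for i j
  proof -
    have "(\<lambda>x. coeff [:- e i j x:] k) \<in> poly_fun n" for k
      using subalg_uminus[OF S e[OF that]] poly_fun.const by (cases k) (auto simp: coeff_pCons)
    then have "(\<lambda>x. [:- e i j x:]) \<in> PP" by (simp add: PP_def)
    from PPadd[OF PPconst this] show ?thesis unfolding E_def .
  qed
  define D where "D = (\<lambda>x. \<Sum>\<pi>\<in>{\<pi>. \<pi> permutes {0..<n}}. signof \<pi> * (\<Prod>i\<in>{0..<n}. E i (\<pi> i) x))"
  have "D \<in> PP" unfolding D_def
    by (intro PPsum PPmult PPconst PPprod E) (auto simp: permutes_in_image)
  moreover have "char_poly (N x) = D x" if x: "x \<in> ambient n" for x
  proof -
    have "char_poly (N x) = (\<Sum>\<pi>\<in>{\<pi>. \<pi> permutes {0..<n}}. signof \<pi> *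
        (\<Prod>i\<in>{0..<n}. char_poly_matrix (N x) $$ (i, \<pi> i)))"
      unfolding char_poly_def by (rule det_def') (use N[OF x] in simp)
    also have "\<dots> = D x" unfolding D_def
    proof (intro sum.cong prod.cong refl arg_cong2[where f = "(*)"])
      fix \<pi> i assume "\<pi> \<in> {\<pi>. \<pi> permutes {0..<n}}" and i: "i \<in> {0..<n}"
      then have "\<pi> i < n" by (auto simp: permutes_in_image)
      then show "char_poly_matrix (N x) $$ (i, \<pi> i) = E i (\<pi> i) x"
        using i N[OF x] Ne[OF x] by (simp add: char_poly_matrix_def E_def)
    qed
    finally show ?thesis .
  qed
  ultimately show ?thesis
    by (intro bexI[of _ "\<lambda>x. coeff (D x) q"]) (auto simp: PP_def)
qed

lemma char_poly_conj:
  assumes G: "GLpair n g h" and M: "M \<in> carrier_mat n n"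
  shows "char_poly (g * M * h) = char_poly (M :: complex mat)"
  by (rule char_poly_similar, rule similar_matI[of _ _ g h n]) (use G M in \<open>auto simp: GLpair_def\<close>)

definition inv_A :: "nat \<Rightarrow> pt set \<Rightarrow> nat \<Rightarrow> pt \<Rightarrow> complex" where
  "inv_A n X q = ext0 X (\<lambda>x. coeff (char_poly (fst x * fst x)) q)"

definition inv_B :: "nat \<Rightarrow> pt set \<Rightarrow> nat \<Rightarrow> pt \<Rightarrow> complex" where
  "inv_B n X q = ext0 X (\<lambda>x. coeff (char_poly (snd x * snd x)) q)"

lemma inv_AB_in:
  assumes X: "gvar n X"
  shows "inv_A n X q \<in> inv_ring n X" "inv_B n X q \<in> inv_ring n X"
proof -
  have main: "ext0 X (\<lambda>x. coeff (char_poly (\<pi> x * \<pi> x)) q) \<in> inv_ring n X"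
    if \<pi>: "\<And>i j. i < n \<Longrightarrow> j < n \<Longrightarrow> (\<lambda>x. \<pi> x $$ (i, j)) \<in> poly_fun n"
      and c: "\<And>x. x \<in> ambient n \<Longrightarrow> \<pi> x \<in> carrier_mat n n"
      and act: "\<And>g h x. \<pi> (conj_act g h x) = g * \<pi> x * h" for \<pi> :: "pt \<Rightarrow> complex mat"
  proof -
    obtain p where p: "p \<in> poly_fun n" "\<And>x. x \<in> ambient n \<Longrightarrow> p x = coeff (char_poly (\<pi> x * \<pi> x)) q"
    proof -
      have "\<exists>p\<in>poly_fun n. \<forall>x\<in>ambient n. p x = coeff (char_poly (\<pi> x * \<pi> x)) q"
      proof (rule char_poly_coeff_poly_fun[where e = "\<lambda>i j x. \<Sum>k<n. \<pi> x $$ (i, k) * \<pi> x $$ (k, j)"])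
        show "\<pi> x * \<pi> x \<in> carrier_mat n n" if "x \<in> ambient n" for x using c[OF that] by simp
        show "(\<lambda>x. \<Sum>k<n. \<pi> x $$ (i, k) * \<pi> x $$ (k, j)) \<in> poly_fun n" if "i < n" "j < n" for i j
          by (intro subalg_sum[OF subalg_poly_fun] poly_fun.mult \<pi>) (use that in auto)
        show "(\<pi> x * \<pi> x) $$ (i, j) = (\<Sum>k<n. \<pi> x $$ (i, k) * \<pi> x $$ (k, j))"
          if "x \<in> ambient n" "i < n" "j < n" for x i j
          using c[OF that(1)] that by (auto simp: scalar_prod_def lessThan_atLeast0)
      qed
      then show ?thesis using that by blast
    qed
    have eq: "ext0 X (\<lambda>x. coeff (char_poly (\<pi> x * \<pi> x)) q) = ext0 X p"
      using p(2) gvarD(1)[OF X] by (auto simp: ext0_def fun_eq_iff)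
    show ?thesis unfolding inv_ring_def
    proof (intro CollectI conjI allI impI ballI)
      show "ext0 X (\<lambda>x. coeff (char_poly (\<pi> x * \<pi> x)) q) \<in> coord_ring n X"
        unfolding eq coord_ring_def using p(1) by blast
      fix g h x assume G: "GLpair n g h" and x: "x \<in> X"
      have cx: "\<pi> x \<in> carrier_mat n n" using c gvarD(1)[OF X x] by blast
      have "char_poly (\<pi> (conj_act g h x) * \<pi> (conj_act g h x)) = char_poly (\<pi> x * \<pi> x)"
        unfolding act conj_mult[OF G cx cx] by (rule char_poly_conj[OF G]) (use cx in auto)
      then show "ext0 X (\<lambda>x. coeff (char_poly (\<pi> x * \<pi> x)) q) (conj_act g h x)
          = ext0 X (\<lambda>x. coeff (char_poly (\<pi> x * \<pi> x)) q) x"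
        using x gvarD(3)[OF X G x] by (simp add: ext0_def)
    qed
  qed
  show "inv_A n X q \<in> inv_ring n X" unfolding inv_A_def
    by (rule main) (auto simp: mem_ambient conj_act_def poly_fun.coordA)
  show "inv_B n X q \<in> inv_ring n X" unfolding inv_B_def
    by (rule main) (auto simp: mem_ambient conj_act_def poly_fun.coordB)
qed

text \<open>\<open>sq_A\<close> and \<open>sq_B\<close> list the diagonal entries of the squares of
  the two matrices of a slice point.\<close>

definition sq_A :: "nat \<Rightarrow> nat \<Rightarrow> (nat \<Rightarrow> complex) \<Rightarrow> nat \<Rightarrow> complex" where
  "sq_A p m t i = (if i < 2 * p then (if even i then t i ^ 2 else t (i - 1) ^ 2)
     else if i < 2 * p + m then t i ^ 2 else 0)"

definition sq_B :: "nat \<Rightarrow> nat \<Rightarrow> (nat \<Rightarrow> complex) \<Rightarrow> nat \<Rightarrow> complex" where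
  "sq_B p m t i = (if i < 2 * p then (if even i then t (Suc i) ^ 2 else t i ^ 2)
     else if i < 2 * p + m then 0 else t i ^ 2)"

lemma phi_squares:
  assumes n: "2 * p + m \<le> n"
  shows "fst (phi n p m t) * fst (phi n p m t) = mat n n (\<lambda>(i, j). if i = j then sq_A p m t i else 0)"
    and "snd (phi n p m t) * snd (phi n p m t) = mat n n (\<lambda>(i, j). if i = j then sq_B p m t i else 0)"
proof -
  let ?A = "fst (phi n p m t)" and ?B = "snd (phi n p m t)"
  show "?A * ?A = mat n n (\<lambda>(i, j). if i = j then sq_A p m t i else 0)"
  proof (rule eq_matI, goal_cases)
    case (1 i j)
    then have ij: "i < n" "j < n" by auto
    have "(?A * ?A) $$ (i, j) = (\<Sum>k\<in>{0..<n}. ?A $$ (i, k) * ?A $$ (k, j))"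
      using ij by (simp add: scalar_prod_def phi_def)
    also have "\<dots> = (\<Sum>k\<in>{0..<n}. if k = i then ?A $$ (i, i) * ?A $$ (i, j) else 0)"
      using ij by (intro sum.cong) (auto simp: phi_def)
    finally show ?case using ij by (simp add: phi_def sq_A_def power2_eq_square)
  qed (auto simp: phi_def)
  show "?B * ?B = mat n n (\<lambda>(i, j). if i = j then sq_B p m t i else 0)"
  proof (rule eq_matI, goal_cases)
    case (1 i j)
    then have ij: "i < n" "j < n" by auto
    \<comment> \<open>The only column in which row \<open>i\<close> of \<open>?B\<close> can be
      nonzero.\<close>
    define k0 where "k0 = (if i < 2 * p then (if even i then Suc i else i - 1) else i)"
    have k0: "k0 < n"
    proof -
      have "Suc i < 2 * p" if "i < 2 * p" "even i" using that by presburger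
      then show ?thesis using ij n by (auto simp: k0_def)
    qed
    have B0: "?B $$ (i, k) = 0" if "k < n" "k \<noteq> k0" for k
      using ij that by (auto simp: phi_def k0_def)
    have "(?B * ?B) $$ (i, j) = (\<Sum>k\<in>{0..<n}. ?B $$ (i, k) * ?B $$ (k, j))"
      using ij by (simp add: scalar_prod_def phi_def)
    also have "\<dots> = (\<Sum>k\<in>{0..<n}. if k = k0 then ?B $$ (i, k0) * ?B $$ (k0, j) else 0)"
      using ij B0 by (intro sum.cong) auto
    also have "\<dots> = ?B $$ (i, k0) * ?B $$ (k0, j)" using k0 by simp
    also have "\<dots> = (if i = j then sq_B p m t i else 0)"
    proof -
      consider "i < 2 * p" "even i" | i' where "i = Suc i'" "even i'" "i < 2 * p" | "i \<ge> 2 * p"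
        by (metis even_Suc not_less odd_Suc_minus_one old.nat.exhaust odd_pos)
      then show ?thesis
      proof cases
        case 1
        then have "Suc i < 2 * p" by presburger
        then show ?thesis using 1 ij n by (auto simp add: phi_def sq_B_def k0_def power2_eq_square)
      next
        case 2
        then show ?thesis using ij n by (auto simp add: phi_def sq_B_def k0_def power2_eq_square)
      next
        case 3
        then show ?thesis using ij n by (simp add: phi_def sq_B_def k0_def power2_eq_square)
      qed
    qed
    finally show ?case using ij by simp
  qed (auto simp: phi_def)
qed

lemma char_poly_diag:
  "char_poly (mat n n (\<lambda>(i, j). if i = j then d i else 0)) = (\<Prod>i<n. [:- d i, 1 :: complex:])"
proof -
  let ?D = "mat n n (\<lambda>(i, j). if i = j then d i else 0)"
  have "char_poly ?D = (\<Prod>a\<leftarrow>diag_mat ?D. [:- a, 1:])"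
    by (rule char_poly_upper_triangular[of _ n]) (auto simp: upper_triangular_def)
  also have "diag_mat ?D = map d [0..<n]" by (auto simp: diag_mat_def)
  finally show ?thesis by (simp add: prod.distinct_set_conv_list[symmetric] o_def lessThan_atLeast0)
qed

lemma inv_AB_phi:
  assumes n: "2 * p + m \<le> n" and X: "phi n p m t \<in> X"
  shows "inv_A n X q (phi n p m t) = coeff (\<Prod>i<n. [:- sq_A p m t i, 1:]) q"
    "inv_B n X q (phi n p m t) = coeff (\<Prod>i<n. [:- sq_B p m t i, 1:]) q"
  using X by (simp_all add: inv_A_def inv_B_def ext0_def phi_squares[OF n] char_poly_diag)

text \<open>Up to sign every slice coordinate is an eigenvalue of one of the two matrices: the even
  indices below \<open>2 * p\<close> and the next \<open>m\<close> indices belong to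
  \<open>A\<close>, the others to \<open>B\<close>.\<close>

lemma coordinate_square:
  assumes "i < n" "2 * p + m \<le> n"
  shows "(\<exists>l<n. \<forall>t. sq_A p m t l = t i ^ 2) \<or> (\<exists>l<n. \<forall>t. sq_B p m t l = t i ^ 2)"
proof -
  consider "i < 2 * p" "even i" | "i < 2 * p" "odd i" | "2 * p \<le> i" "i < 2 * p + m" | "2 * p + m \<le> i"
    by linarith
  then show ?thesis
  proof cases
    case 1 then show ?thesis using assms by (intro disjI1 exI[of _ i]) (simp add: sq_A_def)
  next
    case 2 then show ?thesis using assms by (intro disjI2 exI[of _ i]) (simp add: sq_B_def)
  next
    case 3 then show ?thesis using assms by (intro disjI1 exI[of _ i]) (simp add: sq_A_def)
  next
    case 4 then show ?thesis using assms by (intro disjI2 exI[of _ i]) (simp add: sq_B_def)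
  qed
qed

lemma monic_prod_coeffs:
  fixes d :: "nat \<Rightarrow> complex"
  assumes "l < n"
  shows "(d l) ^ n = (\<Sum>q<n. - coeff (\<Prod>i<n. [:- d i, 1:]) q * (d l) ^ q)"
proof -
  let ?P = "\<Prod>i<n. [:- d i, 1:]"
  have deg: "degree ?P = n"
    using degree_prod_eq_sum_degree[of "{..<n}" "\<lambda>i. [:- d i, 1:]"] by simp
  have "lead_coeff ?P = 1" by (simp add: lead_coeff_prod)
  then have mon: "coeff ?P n = 1" using deg by simp
  have "poly ?P (d l) = (\<Prod>i<n. d l - d i)" by (simp add: poly_prod algebra_simps)
  also have "\<dots> = 0" using assms by (auto intro: prod_zero)
  finally have "(\<Sum>q\<le>n. coeff ?P q * d l ^ q) = 0" unfolding poly_altdef deg .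
  then have "(\<Sum>q<n. coeff ?P q * d l ^ q) + d l ^ n = 0"
    using mon by (simp add: lessThan_Suc_atMost[symmetric])
  then show ?thesis by (simp add: sum_negf eq_neg_iff_add_eq_0 add.commute)
qed

lemma coordinate_integral:
  assumes X: "gvar n X" and n: "2 * p + m \<le> n" and phi: "\<And>t. phi n p m t \<in> X" and i: "i < n"
  obtains h where "\<And>q. q < 2 * n \<Longrightarrow> h q \<in> inv_ring n X \<or> h q = (\<lambda>_. 0)"
    "\<And>t. t i ^ (2 * n) = (\<Sum>q<2 * n. h q (phi n p m t) * t i ^ q)"
proof -
  have "\<exists>c d l. l < n \<and> (\<forall>q. c q \<in> inv_ring n X) \<and> (\<forall>t. d t l = t i ^ 2)
      \<and> (\<forall>t q. c q (phi n p m t) = - coeff (\<Prod>i<n. [:- d t i, 1:]) q)"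
  proof -
    have neg: "(\<lambda>x. - f x) \<in> inv_ring n X" if f: "f \<in> inv_ring n X" for f
    proof -
      obtain r where r: "r \<in> poly_fun n" "f = ext0 X r" using f by (rule inv_ringE)
      have "(\<lambda>x. - f x) = ext0 X (\<lambda>x. - r x)" by (auto simp: r ext0_def fun_eq_iff)
      then have "(\<lambda>x. - f x) \<in> coord_ring n X"
        unfolding coord_ring_def using subalg_uminus[OF subalg_poly_fun r(1)] by blast
      then show ?thesis using f by (auto simp: inv_ring_def)
    qed
    from coordinate_square[OF i n] show ?thesis
    proof (elim disjE exE conjE)
      fix l assume "l < n" "\<forall>t. sq_A p m t l = t i ^ 2"
      then show ?thesis using neg[OF inv_AB_in(1)[OF X]] inv_AB_phi(1)[OF n phi]
        by (intro exI[of _ "\<lambda>q x. - inv_A n X q x"] exI[of _ "sq_A p m"] exI[of _ l]) auto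
    next
      fix l assume "l < n" "\<forall>t. sq_B p m t l = t i ^ 2"
      then show ?thesis using neg[OF inv_AB_in(2)[OF X]] inv_AB_phi(2)[OF n phi]
        by (intro exI[of _ "\<lambda>q x. - inv_B n X q x"] exI[of _ "sq_B p m"] exI[of _ l]) auto
    qed
  qed
  then obtain c d l where c: "l < n" "\<And>q. c q \<in> inv_ring n X" "\<And>t. d t l = t i ^ 2"
    "\<And>t q. c q (phi n p m t) = - coeff (\<Prod>i<n. [:- d t i, 1:]) q" by metis
  \<comment> \<open>A monic equation of degree \<open>n\<close> for \<open>t i ^ 2\<close> is one of
    degree \<open>2 * n\<close> for \<open>t i\<close> with zero coefficients at the odd
    powers.\<close>
  define h where "h = (\<lambda>q. if even q then c (q div 2) else (\<lambda>_. 0))"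
  have "t i ^ (2 * n) = (\<Sum>q<2 * n. h q (phi n p m t) * t i ^ q)" for t
  proof -
    have "t i ^ (2 * n) = (d t l) ^ n" by (simp add: c(3) power_mult)
    also have "\<dots> = (\<Sum>q<n. c q (phi n p m t) * (d t l) ^ q)"
      unfolding c(4) by (rule monic_prod_coeffs[OF c(1)])
    also have "\<dots> = (\<Sum>q<n. h (2 * q) (phi n p m t) * t i ^ (2 * q))"
      by (simp add: h_def c(3) power_mult)
    also have "\<dots> = (\<Sum>q\<in>(\<lambda>q. 2 * q) ` {..<n}. h q (phi n p m t) * t i ^ q)"
      by (subst sum.reindex) (auto simp: inj_on_def)
    also have "\<dots> = (\<Sum>q<2 * n. h q (phi n p m t) * t i ^ q)"
    proof (rule sum.mono_neutral_left)
      show "\<forall>q\<in>{..<2 * n} - (\<lambda>q. 2 * q) ` {..<n}. h q (phi n p m t) * t i ^ q = 0"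
      proof
        fix q assume q: "q \<in> {..<2 * n} - (\<lambda>q. 2 * q) ` {..<n}"
        have "odd q"
        proof
          assume "even q"
          then have "q = 2 * (q div 2)" "q div 2 < n" using q by auto
          then have "q \<in> (\<lambda>q. 2 * q) ` {..<n}" by blast
          then show False using q by simp
        qed
        then show "h q (phi n p m t) * t i ^ q = 0" by (simp add: h_def)
      qed
    qed auto
    finally show ?thesis .
  qed
  moreover have "h q \<in> inv_ring n X \<or> h q = (\<lambda>_. 0)" for q using c(2) by (auto simp: h_def)
  ultimately show ?thesis using that by blast
qed

section \<open>The varieties attached to the types\<close>

definition generic :: "nat \<Rightarrow> (nat \<Rightarrow> complex) \<Rightarrow> bool" where
  "generic k a \<longleftrightarrow> (\<forall>i<k. a i \<noteq> 0) \<and> (\<forall>i<k. \<forall>j<k. i \<noteq> j \<longrightarrow> a i \<noteq> a j \<and> a i \<noteq> - a j)"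

text \<open>The set whose closure is \<open>Z_pmr\<close>; its members are the pairs with an
  explicit normal form.\<close>

definition U_pm :: "nat \<Rightarrow> nat \<Rightarrow> nat \<Rightarrow> pt set" where
  "U_pm n p m = {conj_act g h (diag_pmr n p m a, B) | g h a B.
     GLpair n g h \<and> (diag_pmr n p m a, B) \<in> Zn n \<and> generic (p + m) a}"

lemma Z_pmr_eq: "Z_pmr n p m r = zar_closure n (U_pm n p m)"
  unfolding Z_pmr_def U_pm_def generic_def by (rule arg_cong[of _ _ "zar_closure n"]) blast

lemma U_pm_Zn: "U_pm n p m \<subseteq> Zn n"
  unfolding U_pm_def using conj_Zn by blast

lemma U_pm_ambient: "U_pm n p m \<subseteq> ambient n"
  using U_pm_Zn[of n p m] gvarD(1)[OF gvar_Zn] by blast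

lemma gvar_Z_pmr: "gvar n (Z_pmr n p m r)"
  unfolding Z_pmr_eq
proof (rule gvar_closure)
  show "U_pm n p m \<subseteq> ambient n" by (rule U_pm_ambient)
  fix g h x assume gh: "GLpair n g h" and "x \<in> U_pm n p m"
  then obtain g' h' a B where x: "x = conj_act g' h' (diag_pmr n p m a, B)" "GLpair n g' h'"
    "(diag_pmr n p m a, B) \<in> Zn n" "generic (p + m) a" unfolding U_pm_def by blast
  have "(diag_pmr n p m a, B) \<in> ambient n" using x(3) by (simp add: mem_Zn)
  from conj_comp[OF gh x(2) this] x show "conj_act g h x \<in> U_pm n p m"
    unfolding U_pm_def by blast
qed

lemma U_pm_subset: "U_pm n p m \<subseteq> Z_pmr n p m r"
  unfolding Z_pmr_eq using U_pm_ambient by (rule subset_zar_closure)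

lemma Z_pmr_Zn: "Z_pmr n p m r \<subseteq> Zn n"
proof -
  have "zar_closure n (U_pm n p m) \<subseteq> zar_closure n (Zn n)"
    using U_pm_Zn[of n p m] by (auto simp: zar_closure_def)
  then show ?thesis using gvarD(2)[OF gvar_Zn] unfolding Z_pmr_eq by blast
qed

text \<open>Where the parameter \<open>a j\<close> sits among the slice coordinates: at the even
  positions of the blocks, then at the \<open>m\<close> single eigenvalues.\<close>

definition slice_index :: "nat \<Rightarrow> nat \<Rightarrow> nat" where
  "slice_index p j = (if j < p then 2 * j else j + p)"

lemma fst_phi_diag_pmr: "fst (phi n p m t) = diag_pmr n p m (\<lambda>j. t (slice_index p j))"
  unfolding phi_def diag_pmr_def slice_index_def
  by (rule eq_matI) (auto elim!: evenE oddE)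

lemma phi_U_pm:
  assumes n: "2 * p + m \<le> n" and g: "generic (p + m) (\<lambda>j. t (slice_index p j))"
  shows "phi n p m t \<in> U_pm n p m"
proof -
  have "phi n p m t = conj_act (1\<^sub>m n) (1\<^sub>m n) (diag_pmr n p m (\<lambda>j. t (slice_index p j)), snd (phi n p m t))"
    using phi_ambient[of n p m t] fst_phi_diag_pmr[of n p m t]
    by (auto simp: conj_act_def mem_ambient prod_eq_iff)
  moreover have "(diag_pmr n p m (\<lambda>j. t (slice_index p j)), snd (phi n p m t)) \<in> Zn n"
    using phi_Zn[OF n, of t] fst_phi_diag_pmr[of n p m t] by (metis prod.collapse)
  ultimately show ?thesis using g GLpair_one unfolding U_pm_def by blast
qed

lemma upoly_if: "f \<in> upoly \<Longrightarrow> g \<in> upoly \<Longrightarrow> (\<lambda>s. if P then f s else g s) \<in> upoly"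
  by (cases P) simp_all

lemma finite_affine_roots:
  fixes u v :: complex
  assumes "u + v \<noteq> 0"
  shows "finite {s. u + s * v = 0}"
proof (cases "v = 0")
  case False
  then have "{s. u + s * v = 0} \<subseteq> {- u / v}" by (auto simp: field_simps add_eq_0_iff)
  then show ?thesis using finite_subset by blast
qed (use assms in simp)

text \<open>Slice points at which \<open>A\<close> has zero, repeated or opposite parameters are
  reached as limits: on the line towards a generic point all but finitely many points are
  generic.\<close>

lemma phi_Z_pmr:
  assumes n: "2 * p + m \<le> n"
  shows "phi n p m t \<in> Z_pmr n p m r"
proof -
  \<comment> \<open>Gives the parameters of \<open>A\<close> the values 1 up to
    \<open>p + m\<close>, which are nonzero, distinct and never opposite.\<close>
  define t0 :: "nat \<Rightarrow> complex" where
    "t0 = (\<lambda>i. of_nat (if i < 2 * p then i div 2 + 1 else i - p + 1))"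
  define w where "w = (\<lambda>s i. t i + s * (t0 i - t i))"
  define a where "a = (\<lambda>s j. w s (slice_index p j))"
  have a1: "t0 (slice_index p j) = of_nat (j + 1)" for j
    by (simp add: t0_def slice_index_def)
  let ?b = "\<lambda>j. t (slice_index p j)" and ?v = "\<lambda>j. t0 (slice_index p j) - t (slice_index p j)"
  \<comment> \<open>The exceptional values of \<open>s\<close>. Each expression is affine in
    \<open>s\<close> and nonzero at \<open>s = 1\<close>, so it has finitely many roots.\<close>
  define F where "F = (\<Union>j<p + m. {s. ?b j + s * ?v j = 0})
    \<union> (\<Union>i<p + m. \<Union>j\<in>{..<p + m} - {i}. {s. (?b i - ?b j) + s * (?v i - ?v j) = 0} \<union> {s. (?b i + ?b j) + s * (?v i + ?v j) = 0})"
  have "finite F"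
    unfolding F_def
  proof (intro finite_UnI finite_UN_I finite_affine_roots)
    fix j
    show "?b j + ?v j \<noteq> 0" using a1[of j] of_nat_eq_0_iff[of "j + 1", where 'a = complex] by simp
    fix i assume "j \<in> {..<p + m} - {i}"
    then have ij: "i \<noteq> j" by auto
    show "?b i - ?b j + (?v i - ?v j) \<noteq> 0" using a1 ij by simp
    have "(of_nat (i + 1) + of_nat (j + 1) :: complex) = of_nat (i + j + 2)" by simp
    also have "\<dots> \<noteq> 0" using of_nat_eq_0_iff[of "i + j + 2", where 'a = complex] by simp
    finally show "?b i + ?b j + (?v i + ?v j) \<noteq> 0" using a1[of i] a1[of j] by simp
  qed auto
  have gen: "generic (p + m) (a s)" if s: "s \<notin> F" for s
    unfolding generic_def
  proof (intro conjI allI impI)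
    fix j assume "j < p + m"
    then show "a s j \<noteq> 0" using s by (auto simp: F_def a_def w_def)
  next
    fix i j assume i: "i < p + m" and j: "j < p + m" and ij: "i \<noteq> j"
    with s have "(?b i - ?b j) + s * (?v i - ?v j) \<noteq> 0" "(?b i + ?b j) + s * (?v i + ?v j) \<noteq> 0"
      unfolding F_def by blast+
    moreover have "a s i - a s j = (?b i - ?b j) + s * (?v i - ?v j)"
      "a s i + a s j = (?b i + ?b j) + s * (?v i + ?v j)"
      by (simp_all add: a_def w_def algebra_simps)
    ultimately have "a s i - a s j \<noteq> 0" "a s i + a s j \<noteq> 0" by simp_all
    then show "a s i \<noteq> a s j" "a s i \<noteq> - a s j" by auto
  qed
  have up: "(\<lambda>s. w s i) \<in> upoly" for i
    unfolding w_def
    by (intro subalgD(2)[OF subalg_upoly] subalgD(3)[OF subalg_upoly] subalgD(1)[OF subalg_upoly] upoly_ident)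
  note upoly_simps = up subalg_uminus[OF subalg_upoly up] subalgD(1)[OF subalg_upoly]
  have "phi n p m (w 0) \<in> Z_pmr n p m r"
  proof (rule curve_limit_mem[OF gvar_Z_pmr _ _ phi_ambient \<open>finite F\<close>])
    fix i j assume "i < n" "j < n"
    then show "(\<lambda>s. fst (phi n p m (w s)) $$ (i, j)) \<in> upoly" "(\<lambda>s. snd (phi n p m (w s)) $$ (i, j)) \<in> upoly"
      unfolding phi_def by (simp; intro upoly_if upoly_simps)+
  next
    fix s assume "s \<notin> F"
    then show "phi n p m (w s) \<in> Z_pmr n p m r"
      using phi_U_pm[OF n, of "w s"] gen[of s] U_pm_subset unfolding a_def by blast
  qed
  then show ?thesis by (simp add: w_def)
qed

lemma diag_pmr_entry:
  "i < n \<Longrightarrow> diag_pmr n p m a $$ (i, i) = (if i < 2 * p then (if even i then a (i div 2) else - a (i div 2))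
     else if i < 2 * p + m then a (i - p) else 0)"
  by (simp add: diag_pmr_def)

text \<open>A nonzero entry of \<open>B\<close> forces opposite diagonal entries of
  \<open>A\<close>; for generic \<open>a\<close> these occur only inside a block or as two
  zeros.\<close>

lemma anticommute_diag_pmr:
  assumes Z: "(diag_pmr n p m a, B) \<in> Zn n" and g: "generic (p + m) a" and ij: "i < n" "j < n"
    and nz: "B $$ (i, j) \<noteq> 0"
  shows "i < 2 * p \<and> even i \<and> j = Suc i \<or> i < 2 * p \<and> odd i \<and> i = Suc j \<or> 2 * p + m \<le> i \<and> 2 * p + m \<le> j"
proof -
  let ?A = "diag_pmr n p m a"
  define d where "d = (\<lambda>i. ?A $$ (i, i))"
  have B: "B \<in> carrier_mat n n" and 0: "?A * B + B * ?A = 0\<^sub>m n n" using Z by (auto simp: mem_Zn mem_ambient)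
  have A: "?A = mat n n (\<lambda>(i, j). if i = j then d i else 0)"
    by (auto simp: diag_pmr_def d_def intro!: eq_matI)
  have "(?A * B) $$ (i, j) = (\<Sum>k\<in>{0..<n}. ?A $$ (i, k) * B $$ (k, j))"
    using ij B by (simp add: scalar_prod_def A)
  also have "\<dots> = (\<Sum>k\<in>{0..<n}. if k = i then d i * B $$ (i, j) else 0)"
    using ij by (intro sum.cong) (auto simp: A)
  finally have AB: "(?A * B) $$ (i, j) = d i * B $$ (i, j)" using ij by simp
  have "(B * ?A) $$ (i, j) = (\<Sum>k\<in>{0..<n}. B $$ (i, k) * ?A $$ (k, j))"
    using ij B by (simp add: scalar_prod_def A)
  also have "\<dots> = (\<Sum>k\<in>{0..<n}. if k = j then B $$ (i, j) * d j else 0)"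
    using ij by (intro sum.cong) (auto simp: A)
  finally have BA: "(B * ?A) $$ (i, j) = B $$ (i, j) * d j" using ij by simp
  have "(?A * B + B * ?A) $$ (i, j) = (?A * B) $$ (i, j) + (B * ?A) $$ (i, j)"
    using B ij by (intro index_add_mat(1)) (auto simp: A)
  then have "(d i + d j) * B $$ (i, j) = 0" using 0 AB BA ij by (simp add: algebra_simps)
  then have sum0: "d i + d j = 0" using nz by simp
  \<comment> \<open>Every nonzero diagonal entry is a sign \<open>\<epsilon>\<close> times the
    parameter of index \<open>\<kappa>\<close>; opposite entries must share the index and differ in
    sign.\<close>
  define \<kappa> where "\<kappa> = (\<lambda>i. if i < 2 * p then i div 2 else i - p)"
  define \<epsilon> :: "nat \<Rightarrow> complex" where "\<epsilon> = (\<lambda>i. if i < 2 * p \<and> odd i then - 1 else 1)"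
  have d: "d l = (if l < 2 * p + m then \<epsilon> l * a (\<kappa> l) else 0)" if "l < n" for l
    using that by (auto simp: d_def diag_pmr_entry \<epsilon>_def \<kappa>_def)
  have \<kappa>: "\<kappa> l < p + m" if "l < 2 * p + m" for l using that by (auto simp: \<kappa>_def)
  have \<epsilon>: "\<epsilon> l = 1 \<or> \<epsilon> l = - 1" for l by (simp add: \<epsilon>_def)
  have a0: "a (\<kappa> l) \<noteq> 0" if "l < 2 * p + m" for l using g \<kappa>[OF that] by (simp add: generic_def)
  have d0: "d l \<noteq> 0" if "l < 2 * p + m" "l < n" for l
    using d[of l] \<epsilon>[of l] a0[of l] that by auto
  show ?thesis
  proof (cases "i < 2 * p + m \<and> j < 2 * p + m")
    case False
    then show ?thesis using d[OF ij(1)] d[OF ij(2)] d0[of i] d0[of j] sum0 ij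
      by (metis add.left_neutral add.right_neutral not_less)
  next
    case True
    then have e: "\<epsilon> i * a (\<kappa> i) + \<epsilon> j * a (\<kappa> j) = 0" using d ij sum0 by simp
    have \<kappa>eq: "\<kappa> i = \<kappa> j"
    proof (rule ccontr)
      assume "\<kappa> i \<noteq> \<kappa> j"
      then have "a (\<kappa> i) \<noteq> a (\<kappa> j)" "a (\<kappa> i) \<noteq> - a (\<kappa> j)"
        using g \<kappa>[of i] \<kappa>[of j] True unfolding generic_def by auto
      then show False using e \<epsilon>[of i] \<epsilon>[of j] by (auto simp: add_eq_0_iff)
    qed
    have ne: "\<epsilon> i \<noteq> \<epsilon> j"
    proof
      assume "\<epsilon> i = \<epsilon> j"
      then have "2 * (\<epsilon> i * a (\<kappa> i)) = 0" using e \<kappa>eq by simp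
      then show False using a0[of i] True \<epsilon>[of i] by auto
    qed
    then have lt: "i < 2 * p \<or> j < 2 * p" and par: "i < 2 * p \<Longrightarrow> j < 2 * p \<Longrightarrow> odd i \<longleftrightarrow> even j"
      by (auto simp: \<epsilon>_def split: if_splits)
    have "i < 2 * p \<longleftrightarrow> j < 2 * p" using \<kappa>eq by (auto simp: \<kappa>_def split: if_splits)
    then have both: "i < 2 * p" "j < 2 * p" using lt by auto
    then have "i div 2 = j div 2" using \<kappa>eq by (simp add: \<kappa>_def)
    then have "even i \<and> j = Suc i \<or> odd i \<and> i = Suc j" using par[OF both] by presburger
    then show ?thesis using both by blast
  qed
qed


text \<open>Diagonal conjugation fixes the diagonal \<open>A\<close> and scales the entries of
  \<open>B\<close>. Each block is balanced or degenerates to zero, and the strictly upper part of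
  the triangular tail tends to zero.\<close>

lemma triangular_ieq_phi:
  assumes X: "gvar n X" and n: "2 * p + m \<le> n" and A: "A = diag_pmr n p m a"
    and z: "(A, B) \<in> X" and B: "B \<in> carrier_mat n n"
    and supp: "\<And>i j. i < n \<Longrightarrow> j < n \<Longrightarrow> B $$ (i, j) \<noteq> 0 \<Longrightarrow>
      i < 2 * p \<and> even i \<and> j = Suc i \<or> i < 2 * p \<and> odd i \<and> i = Suc j \<or> 2 * p + m \<le> i \<and> i \<le> j"
  shows "\<exists>t. ieq n X (A, B) (phi n p m t)"
proof -
  define \<rho> where "\<rho> = (\<lambda>i. csqrt (B $$ (i, Suc i) * B $$ (Suc i, i)))"
  have \<rho>: "\<rho> i * \<rho> i = B $$ (i, Suc i) * B $$ (Suc i, i)" for i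
    using power2_csqrt[of "B $$ (i, Suc i) * B $$ (Suc i, i)"] by (simp add: \<rho>_def power2_eq_square)
  \<comment> \<open>If both off-diagonal entries are nonzero, each becomes the square root
    \<open>\<rho> i\<close> of their product; otherwise at most one is nonzero, and that one is
    scaled by \<open>s\<close>.\<close>
  define up where "up = (\<lambda>i s. if \<rho> i \<noteq> 0 then \<rho> i else if B $$ (Suc i, i) = 0 then s * B $$ (i, Suc i) else 0)"
  define lo where "lo = (\<lambda>i s. if \<rho> i \<noteq> 0 then \<rho> i else if B $$ (Suc i, i) = 0 then 0 else s * B $$ (Suc i, i))"
  \<comment> \<open>The weights that realise these scalings. In the tail they multiply the entry at
    \<open>i\<close>, \<open>j\<close> by \<open>s ^ (j - i)\<close>, which at \<open>s = 0\<close>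
    leaves just the diagonal.\<close>
  define d where "d = (\<lambda>s i. if i < 2 * p then
      (if even i then (if \<rho> i \<noteq> 0 then \<rho> i / B $$ (i, Suc i) else if B $$ (Suc i, i) = 0 then s else 1)
       else (if \<rho> (i - 1) \<noteq> 0 then 1 else if B $$ (i, i - 1) = 0 then 1 else s))
     else if i < 2 * p + m then 1 else s ^ (n - i))"
  define bs where "bs = (\<lambda>s i j. if i < 2 * p then (if even i \<and> j = Suc i then up i s else if odd i \<and> i = Suc j then lo j s else 0)
     else if 2 * p + m \<le> i \<and> i \<le> j then s ^ (j - i) * B $$ (i, j) else 0)"
  define y where "y = (\<lambda>s. (A, mat n n (\<lambda>(i, j). bs s i j)))"
  define t where "t = (\<lambda>i. if i < 2 * p then (if even i then a (i div 2) else \<rho> (i - 1))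
     else if i < 2 * p + m then a (i - p) else B $$ (i, i))"
  have Ac: "A \<in> carrier_mat n n" by (simp add: A diag_pmr_def)
  have sc: "(\<lambda>s. s * c) \<in> upoly" "(\<lambda>s. s ^ k * c) \<in> upoly" "(\<lambda>s. c) \<in> upoly" for c k
    by (intro subalgD(3)[OF subalg_upoly] subalgD(1)[OF subalg_upoly] subalg_power[OF subalg_upoly] upoly_ident)+
  have upo: "(\<lambda>s. up i s) \<in> upoly" "(\<lambda>s. lo i s) \<in> upoly" for i
    unfolding up_def lo_def by (intro upoly_if sc)+
  have yU: "(\<lambda>s. snd (y s) $$ (i, j)) \<in> upoly" if "i < n" "j < n" for i j
  proof -
    have "(\<lambda>s. bs s i j) \<in> upoly" unfolding bs_def by (intro upoly_if upo sc)
    then show ?thesis using that by (simp add: y_def)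
  qed
  have conj: "\<exists>g h. GLpair n g h \<and> y s = conj_act g h (A, B)" if s: "s \<noteq> 0" for s
  proof -
    have d0: "d s i \<noteq> 0" if "i < n" for i
      using s \<rho>[of i] by (auto simp: d_def)
    have bs: "bs s i j = d s i * B $$ (i, j) / d s j" if ij: "i < n" "j < n" for i j
    proof -
      consider (up) "i < 2 * p" "even i" "j = Suc i" | (lo) "i < 2 * p" "odd i" "i = Suc j"
        | (tri) "2 * p + m \<le> i" "i \<le> j"
        | (none) "\<not> (i < 2 * p \<and> even i \<and> j = Suc i)" "\<not> (i < 2 * p \<and> odd i \<and> i = Suc j)"
          "\<not> (2 * p + m \<le> i \<and> i \<le> j)" by blast
      then show ?thesis
      proof cases
        case up
        then have "j < 2 * p" "odd j" by presburger+
        then have dj: "d s j = (if \<rho> i \<noteq> 0 then 1 else if B $$ (Suc i, i) = 0 then 1 else s)"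
          using up by (simp add: d_def)
        have di: "d s i = (if \<rho> i \<noteq> 0 then \<rho> i / B $$ (i, Suc i) else if B $$ (Suc i, i) = 0 then s else 1)"
          using up by (simp add: d_def)
        show ?thesis using up \<rho>[of i] unfolding di dj by (auto simp: bs_def up_def)
      next
        case lo
        then have "j < 2 * p" "even j" by auto
        then have dj: "d s j = (if \<rho> j \<noteq> 0 then \<rho> j / B $$ (j, Suc j) else if B $$ (Suc j, j) = 0 then s else 1)"
          by (simp add: d_def)
        have di: "d s i = (if \<rho> j \<noteq> 0 then 1 else if B $$ (Suc j, j) = 0 then 1 else s)"
          using lo by (simp add: d_def)
        show ?thesis using lo \<rho>[of j] unfolding di dj by (auto simp: bs_def lo_def field_simps)
      next
        case tri
        have "s ^ (n - i) = s ^ (j - i) * s ^ (n - j)"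
          using tri ij by (simp add: power_add[symmetric])
        then show ?thesis using tri s by (simp add: d_def bs_def)
      next
        case none
        then have "B $$ (i, j) = 0" using supp[OF ij] by blast
        then show ?thesis using none by (auto simp: bs_def)
      qed
    qed
    have "A = mat n n (\<lambda>(i, j). d s i * A $$ (i, j) / d s j)"
      by (rule eq_matI) (use d0 in \<open>auto simp: A diag_pmr_def\<close>)
    moreover have "mat n n (\<lambda>(i, j). bs s i j) = mat n n (\<lambda>(i, j). d s i * B $$ (i, j) / d s j)"
      by (intro cong_mat) (auto simp: bs)
    ultimately have "y s = (mat n n (\<lambda>(i, j). d s i * fst (A, B) $$ (i, j) / d s j),
        mat n n (\<lambda>(i, j). d s i * snd (A, B) $$ (i, j) / d s j))"
      by (simp add: y_def)
    then show ?thesis using conj_diag[of n "d s" "(A, B)"] d0 Ac B by (simp add: mem_ambient)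
  qed
  have amb: "y s \<in> ambient n" for s using Ac by (simp add: y_def mem_ambient)
  have "ieq n X (A, B) (y 0)"
    by (rule ieq_limit(2)[OF X _ yU amb z conj]) (auto simp: y_def sc(3))
  moreover have "y 0 = phi n p m t"
  proof -
    have "bs 0 i j = snd (phi n p m t) $$ (i, j)" if "i < n" "j < n" for i j
    proof -
      have "Suc i < 2 * p" if "i < 2 * p" "even i" using that by presburger
      then show ?thesis
        using that by (auto simp: phi_def bs_def t_def up_def lo_def power_0_left)
    qed
    then have "mat n n (\<lambda>(i, j). bs 0 i j) = snd (phi n p m t)"
      by (intro eq_matI) (auto simp: phi_def)
    moreover have "A = fst (phi n p m t)"
      by (rule eq_matI) (auto simp: A diag_pmr_def phi_def t_def elim!: evenE oddE)
    ultimately show ?thesis by (simp add: y_def prod_eq_iff)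
  qed
  ultimately show ?thesis by auto
qed

text \<open>\<open>B\<close> splits along the kernel of \<open>A\<close>: outside it the nonzero
  entries lie in the blocks, and on it \<open>B\<close> can be made triangular without changing
  \<open>A\<close>, which is zero there.\<close>

lemma U_pm_ieq_phi:
  assumes n: "2 * p + m \<le> n" and x: "x \<in> U_pm n p m"
  shows "\<exists>t. ieq n (Z_pmr n p m r) x (phi n p m t)"
proof -
  let ?X = "Z_pmr n p m r" and ?k = "2 * p + m"
  define l where "l = n - ?k"
  have nl: "n = ?k + l" using n by (simp add: l_def)
  obtain g h a B where G: "GLpair n g h" and x: "x = conj_act g h (diag_pmr n p m a, B)"
    and Z: "(diag_pmr n p m a, B) \<in> Zn n" and gen: "generic (p + m) a"
    using assms(2) unfolding U_pm_def by blast
  let ?A = "diag_pmr n p m a"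
  have AB: "(?A, B) \<in> ambient n" using Z by (simp add: mem_Zn)
  then have B: "B \<in> carrier_mat n n" by (simp add: mem_ambient)
  have "(?A, B) = conj_act (1\<^sub>m n) (1\<^sub>m n) (?A, B)" using AB by (auto simp: conj_act_def mem_ambient)
  then have "(?A, B) \<in> U_pm n p m" unfolding U_pm_def using GLpair_one Z gen by blast
  then have ABX: "(?A, B) \<in> ?X" using U_pm_subset by blast
  have x1: "ieq n ?X x (?A, B)" using ieq_conj[OF G ABX] unfolding x ieq_def by metis
  define B1 where "B1 = mat ?k ?k (\<lambda>ij. B $$ ij)"
  define B2 where "B2 = mat l l (\<lambda>(i, j). B $$ (i + ?k, j + ?k))"
  define A1 where "A1 = mat ?k ?k (\<lambda>ij. ?A $$ ij)"
  note anti = anticommute_diag_pmr[OF Z gen]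
  have Bsum: "B = bdiag ?k l B1 B2"
  proof (rule eq_matI)
    fix i j assume "i < dim_row (bdiag ?k l B1 B2)" "j < dim_col (bdiag ?k l B1 B2)"
    then have ij: "i < n" "j < n" by (auto simp: B1_def B2_def nl)
    have "Suc i < 2 * p" if "i < 2 * p" "even i" for i using that by presburger
    then have off: "B $$ (i, j) = 0" if "(i < ?k) \<noteq> (j < ?k)"
      using anti[OF ij] that by fastforce
    show "B $$ (i, j) = bdiag ?k l B1 B2 $$ (i, j)"
      using ij off by (cases "i < ?k"; cases "j < ?k") (auto simp: B1_def B2_def nl)
  qed (use B in \<open>auto simp: B1_def B2_def nl\<close>)
  have Asum: "?A = bdiag ?k l A1 (0\<^sub>m l l)"
    by (rule eq_matI) (auto simp: A1_def nl diag_pmr_def)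
  obtain T P Q where PQ: "GLpair l P Q" and T: "T \<in> carrier_mat l l" "upper_triangular T"
    and B2T: "B2 = P * T * Q"
    by (rule schur_form[of B2 l]) (simp add: B2_def)
  have TB: "T = Q * B2 * P"
    using conj_inverse[OF PQ, of "(T, T)"] T by (simp add: B2T conj_act_def mem_ambient)
  have b: "(A1, B1) \<in> ambient ?k" and y: "(0\<^sub>m l l, B2) \<in> ambient l"
    by (auto simp: mem_ambient A1_def B1_def B2_def)
  have ABs: "(?A, B) = block_sum ?k l (A1, B1) (0\<^sub>m l l, B2)"
    using Asum Bsum by (simp add: block_sum_def)
  note G' = block_sum_conj[OF b y GLpair_sym[OF PQ]]
  have "conj_act Q P (0\<^sub>m l l, B2) = (0\<^sub>m l l, T)"
    using PQ unfolding conj_act_def TB by (auto simp: GLpair_def)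
  then have conj: "conj_act (bdiag ?k l (1\<^sub>m ?k) Q) (bdiag ?k l (1\<^sub>m ?k) P) (?A, B) = (?A, bdiag ?k l B1 T)"
    using G'(2) unfolding ABs by (simp add: block_sum_def Asum[symmetric])
  have G'': "GLpair n (bdiag ?k l (1\<^sub>m ?k) Q) (bdiag ?k l (1\<^sub>m ?k) P)" using G'(1) nl by simp
  have z: "(?A, bdiag ?k l B1 T) \<in> ?X" using gvarD(3)[OF gvar_Z_pmr G'' ABX] unfolding conj .
  have x2: "ieq n ?X (?A, B) (?A, bdiag ?k l B1 T)" using ieq_conj[OF G'' ABX] unfolding conj .
  have "\<exists>t. ieq n ?X (?A, bdiag ?k l B1 T) (phi n p m t)"
  proof (rule triangular_ieq_phi[OF gvar_Z_pmr n refl z])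
    show "bdiag ?k l B1 T \<in> carrier_mat n n" using T by (simp add: B1_def nl)
    fix i j assume ij: "i < n" "j < n" and nz: "bdiag ?k l B1 T $$ (i, j) \<noteq> 0"
    show "i < 2 * p \<and> even i \<and> j = Suc i \<or> i < 2 * p \<and> odd i \<and> i = Suc j \<or> ?k \<le> i \<and> i \<le> j"
    proof (cases "i < ?k \<and> j < ?k")
      case True
      then have "B $$ (i, j) \<noteq> 0" using nz T ij by (simp add: B1_def nl)
      then show ?thesis using anti[OF ij] True by auto
    next
      case False
      then have k: "?k \<le> i" "?k \<le> j" and "T $$ (i - ?k, j - ?k) \<noteq> 0"
        using nz T ij by (auto simp: B1_def nl split: if_splits)
      moreover have "T $$ (i - ?k, j - ?k) = 0" if "j < i"
        using T k ij that by (auto simp: upper_triangular_def nl)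
      ultimately show ?thesis by fastforce
    qed
  qed
  then show ?thesis using ieq_trans[OF x1 x2] ieq_trans by blast
qed

text \<open>The degeneration is available on \<open>U_pm\<close>; an invariant is the restriction of
  a polynomial, so its vanishing there passes to the closure.\<close>

lemma Z_pmr_vanish:
  assumes n: "2 * p + m \<le> n" and f: "f \<in> inv_ring n (Z_pmr n p m r)"
    and 0: "\<And>t. f (phi n p m t) = 0"
  shows "f = (\<lambda>_. 0)"
proof -
  obtain q where q: "q \<in> poly_fun n" "f = ext0 (Z_pmr n p m r) q" using f by (rule inv_ringE)
  have "q x = 0" if x: "x \<in> U_pm n p m" for x
  proof -
    obtain t where "ieq n (Z_pmr n p m r) x (phi n p m t)" using U_pm_ieq_phi[OF n x] by blast
    then have "f x = f (phi n p m t)" using f unfolding ieq_def by blast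
    then have "f x = 0" using 0 by simp
    then show ?thesis using q U_pm_subset[of n p m r] x by (auto simp: ext0_def)
  qed
  then have "q x = 0" if "x \<in> Z_pmr n p m r" for x
    using zar_closure_vanish[of x n "U_pm n p m" q] that q(1) unfolding Z_pmr_eq by blast
  then show ?thesis by (auto simp: q(2) ext0_def fun_eq_iff)
qed

lemma Zn_vanish:
  assumes f: "f \<in> inv_ring n (Zn n)" and 0: "\<And>p m t. 2 * p + m \<le> n \<Longrightarrow> f (phi n p m t) = 0"
  shows "f = (\<lambda>_. 0)"
proof
  fix x
  show "f x = 0"
  proof (cases "x \<in> Zn n")
    case True
    then obtain p m t where "2 * p + m \<le> n" "ieq n (Zn n) x (phi n p m t)" using Zn_ieq_phi by blast
    then show ?thesis using f 0 unfolding ieq_def by metis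
  next
    case False
    then show ?thesis using f by (auto elim!: inv_ringE simp: ext0_def)
  qed
qed

section \<open>Maximal spectra of the invariant rings\<close>

lemma ideal_in_iff: "ideal_in S I \<longleftrightarrow> fun_ideal S I"
  by (simp add: ideal_in_def fun_ideal_def)

text \<open>The point of the quotient below \<open>x\<close>, when \<open>S\<close> is the invariant
  ring of a closed stable set containing \<open>x\<close>.\<close>

definition pt_ideal :: "(pt \<Rightarrow> complex) set \<Rightarrow> pt \<Rightarrow> (pt \<Rightarrow> complex) set" where
  "pt_ideal S x = {f \<in> S. f x = 0}"

lemma inv_ringI:
  assumes "p \<in> poly_fun n" "f = ext0 X p"
    "\<And>g h x. GLpair n g h \<Longrightarrow> x \<in> X \<Longrightarrow> f (conj_act g h x) = f x"
  shows "f \<in> inv_ring n X"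
  using assms by (auto simp: inv_ring_def coord_ring_def)

text \<open>Constants too are extended by zero: the unit is \<open>ext0 X\<close> of 1, and
  \<open>inv_ring\<close> itself is not a \<open>subalg\<close>. Its pullback to a slice is one,
  since the slice stays inside \<open>X\<close>.\<close>

lemma inv_ring_const:
  assumes "gvar n X"
  shows "ext0 X (\<lambda>_. c) \<in> inv_ring n X"
  by (rule inv_ringI[OF poly_fun.const refl]) (use gvarD(3)[OF assms] in \<open>auto simp: ext0_def\<close>)

lemma inv_ring_conj: "f \<in> inv_ring n X \<Longrightarrow> GLpair n g h \<Longrightarrow> x \<in> X \<Longrightarrow> f (conj_act g h x) = f x"
  by (simp add: inv_ring_def)

lemma inv_ring_add:
  assumes "f \<in> inv_ring n X" "g \<in> inv_ring n X"
  shows "(\<lambda>x. f x + g x) \<in> inv_ring n X"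
proof -
  obtain p q where pq: "p \<in> poly_fun n" "f = ext0 X p" "q \<in> poly_fun n" "g = ext0 X q"
    using inv_ringE[OF assms(1)] inv_ringE[OF assms(2)] by metis
  have "(\<lambda>x. f x + g x) = ext0 X (\<lambda>x. p x + q x)"
    unfolding pq(2,4) by (auto simp: ext0_def fun_eq_iff)
  then show ?thesis
    by (intro inv_ringI[OF poly_fun.add[OF pq(1,3)]])
       (simp_all add: inv_ring_conj[OF assms(1)] inv_ring_conj[OF assms(2)])
qed

lemma inv_ring_mult:
  assumes "f \<in> inv_ring n X" "g \<in> inv_ring n X"
  shows "(\<lambda>x. f x * g x) \<in> inv_ring n X"
proof -
  obtain p q where pq: "p \<in> poly_fun n" "f = ext0 X p" "q \<in> poly_fun n" "g = ext0 X q"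
    using inv_ringE[OF assms(1)] inv_ringE[OF assms(2)] by metis
  have "(\<lambda>x. f x * g x) = ext0 X (\<lambda>x. p x * q x)"
    unfolding pq(2,4) by (auto simp: ext0_def fun_eq_iff)
  then show ?thesis
    by (intro inv_ringI[OF poly_fun.mult[OF pq(1,3)]])
       (simp_all add: inv_ring_conj[OF assms(1)] inv_ring_conj[OF assms(2)])
qed

lemma inv_ring_off: "f \<in> inv_ring n X \<Longrightarrow> x \<notin> X \<Longrightarrow> f x = 0"
  by (auto elim!: inv_ringE simp: ext0_def)

lemma inv_ring_scale:
  assumes X: "gvar n X" and f: "f \<in> inv_ring n X"
  shows "(\<lambda>x. c * f x) \<in> inv_ring n X"
proof -
  have "(\<lambda>x. c * f x) = (\<lambda>x. ext0 X (\<lambda>_. c) x * f x)"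
    using inv_ring_off[OF f] by (auto simp: ext0_def fun_eq_iff)
  then show ?thesis using inv_ring_mult[OF inv_ring_const[OF X] f] by simp
qed

lemma inv_ring_zero:
  assumes X: "gvar n X"
  shows "(\<lambda>_. 0) \<in> inv_ring n X"
  using inv_ring_scale[OF X inv_ring_const[OF X], of 0] by simp

lemma fun_ideal_pt_ideal: "gvar n X \<Longrightarrow> fun_ideal (inv_ring n X) (pt_ideal (inv_ring n X) x)"
  unfolding fun_ideal_def pt_ideal_def
  by (auto intro: inv_ring_zero inv_ring_add inv_ring_mult)

lemma proper_ideal_iff:
  assumes X: "gvar n X" and I: "fun_ideal (inv_ring n X) I"
  shows "I \<noteq> inv_ring n X \<longleftrightarrow> ext0 X (\<lambda>_. 1) \<notin> I"
proof
  show "ext0 X (\<lambda>_. 1) \<notin> I" if "I \<noteq> inv_ring n X"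
  proof
    assume 1: "ext0 X (\<lambda>_. 1) \<in> I"
    have "f \<in> I" if f: "f \<in> inv_ring n X" for f
    proof -
      have "(\<lambda>x. f x * ext0 X (\<lambda>_. 1) x) = f"
        using inv_ring_off[OF f] by (auto simp: ext0_def fun_eq_iff)
      then show ?thesis using fun_idealD(4)[OF I 1 f] by simp
    qed
    then show False using that fun_idealD(1)[OF I] by blast
  qed
  show "I \<noteq> inv_ring n X" if "ext0 X (\<lambda>_. 1) \<notin> I" using that inv_ring_const[OF X] by blast
qed

lemma pt_ideal_maximal:
  assumes X: "gvar n X" and x: "x \<in> X"
  shows "pt_ideal (inv_ring n X) x \<in> Specmax (inv_ring n X)"
proof -
  let ?S = "inv_ring n X"
  note M = fun_ideal_pt_ideal[OF X, of x]
  have "J = pt_ideal ?S x" if J: "fun_ideal ?S J" "pt_ideal ?S x \<subseteq> J" "J \<noteq> ?S" for J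
  proof (rule ccontr)
    assume "J \<noteq> pt_ideal ?S x"
    then obtain f where f: "f \<in> J" "f \<notin> pt_ideal ?S x" using J(2) by blast
    then have fS: "f \<in> ?S" and fx: "f x \<noteq> 0" using fun_idealD(1)[OF J(1)] by (auto simp: pt_ideal_def)
    \<comment> \<open>The function \<open>1 - f / f x\<close> vanishes at \<open>x\<close>, so it
      lies in \<open>J\<close>; adding a multiple of \<open>f\<close> produces the unit.\<close>
    let ?g = "\<lambda>y. ext0 X (\<lambda>_. 1) y + (- inverse (f x)) * f y"
    have "?g \<in> ?S" by (intro inv_ring_add inv_ring_const[OF X] inv_ring_scale[OF X fS])
    then have "?g \<in> J" using J(2) x fx by (auto simp: pt_ideal_def ext0_def)
    moreover have "(\<lambda>y. ext0 X (\<lambda>_. inverse (f x)) y * f y) \<in> J"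
      by (rule fun_idealD(4)[OF J(1) f(1) inv_ring_const[OF X]])
    ultimately have "(\<lambda>y. ?g y + ext0 X (\<lambda>_. inverse (f x)) y * f y) \<in> J" by (rule fun_idealD(3)[OF J(1)])
    moreover have "(\<lambda>y. ?g y + ext0 X (\<lambda>_. inverse (f x)) y * f y) = ext0 X (\<lambda>_. 1)"
      using inv_ring_off[OF fS] by (auto simp: ext0_def fun_eq_iff)
    ultimately show False using J proper_ideal_iff[OF X J(1)] by simp
  qed
  moreover have "pt_ideal ?S x \<noteq> ?S"
    unfolding proper_ideal_iff[OF X M] using x by (auto simp: pt_ideal_def ext0_def)
  ultimately show ?thesis
    using M by (auto simp: Specmax_def maximal_ideal_def ideal_in_iff)
qed

text \<open>Projection to the coordinate subspace of dimension \<open>j\<close>. For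
  \<open>j = n\<close> nothing is lost, as \<open>phi\<close> reads only the coordinates below
  \<open>n\<close>.\<close>

definition trunc :: "nat \<Rightarrow> (nat \<Rightarrow> complex) \<Rightarrow> nat \<Rightarrow> complex" where
  "trunc j t i = (if i < j then t i else 0)"

lemma pullback_mpoly:
  assumes n: "2 * p + m \<le> n" and f: "f \<in> inv_ring n X" and X: "\<And>t. phi n p m t \<in> X"
  shows "(\<lambda>t. f (phi n p m (trunc j t))) \<in> mpoly_fun j"
proof -
  obtain q where q: "q \<in> poly_fun n" "f = ext0 X q" using f by (rule inv_ringE)
  note S = subalg_mpoly_fun[of j]
  have tr: "(\<lambda>t. trunc j t i) \<in> mpoly_fun j" for i
    by (cases "i < j") (auto simp: trunc_def intro: mpoly_fun.intros)
  have mif: "f \<in> mpoly_fun j \<Longrightarrow> g \<in> mpoly_fun j \<Longrightarrow> (\<lambda>s. if P then f s else g s) \<in> mpoly_fun j" for f g P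
    by (cases P) simp_all
  have "(\<lambda>t. q (phi n p m (trunc j t))) \<in> mpoly_fun j"
  proof (rule poly_fun_pullback[OF S q(1)])
    fix i k assume "i < n" "k < n"
    then show "(\<lambda>t. fst (phi n p m (trunc j t)) $$ (i, k)) \<in> mpoly_fun j"
      "(\<lambda>t. snd (phi n p m (trunc j t)) $$ (i, k)) \<in> mpoly_fun j"
      unfolding phi_def by (simp; intro mif tr subalg_uminus[OF S tr] mpoly_fun.mconst)+
  qed
  then show ?thesis using q(2) X by (simp add: ext0_def)
qed

lemma pullback_subalg:
  assumes X: "gvar n X" and phi: "\<And>t. phi n p m t \<in> X"
  shows "subalg ((\<lambda>f t. f (phi n p m (trunc j t))) ` inv_ring n X)"
  unfolding subalg_def
proof (intro conjI allI ballI)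
  let ?\<psi> = "\<lambda>t. phi n p m (trunc j t)"
  let ?S0 = "(\<lambda>f t. f (?\<psi> t)) ` inv_ring n X"
  have S0I: "(\<lambda>t. f (?\<psi> t)) \<in> ?S0" if "f \<in> inv_ring n X" for f using that by blast
  show "(\<lambda>_. c) \<in> ?S0" for c
    using S0I[OF inv_ring_const[OF X, of c]] phi by (simp add: ext0_def)
  fix f g assume "f \<in> ?S0" "g \<in> ?S0"
  then obtain f' g' where fg: "f' \<in> inv_ring n X" "g' \<in> inv_ring n X"
    "f = (\<lambda>t. f' (?\<psi> t))" "g = (\<lambda>t. g' (?\<psi> t))" by blast
  show "(\<lambda>x. f x + g x) \<in> ?S0" "(\<lambda>x. f x * g x) \<in> ?S0"
    using S0I[OF inv_ring_add[OF fg(1,2)]] S0I[OF inv_ring_mult[OF fg(1,2)]] unfolding fg(3,4) by simp_all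
qed

text \<open>By \<open>E\<close>, \<open>M\<close> contains the kernel of the pullback, so its image
  is a proper ideal; lying over provides a zero of that image, and maximality of \<open>M\<close>
  turns inclusion into equality.\<close>

lemma maximal_on_slice:
  assumes X: "gvar n X" and n: "2 * p + m \<le> n" and phi: "\<And>t. phi n p m t \<in> X"
    and M: "M \<in> Specmax (inv_ring n X)" and j: "j \<le> n"
    and E: "\<And>f. f \<in> inv_ring n X \<Longrightarrow> (\<And>t. f (phi n p m (trunc j t)) = 0) \<Longrightarrow> f \<in> M"
  obtains t where "M = pt_ideal (inv_ring n X) (phi n p m (trunc j t))"
proof -
  let ?S = "inv_ring n X" and ?\<psi> = "\<lambda>t. phi n p m (trunc j t)"
  have Mi: "fun_ideal ?S M" and MS: "M \<noteq> ?S"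
    and max: "\<And>J. fun_ideal ?S J \<Longrightarrow> M \<subseteq> J \<Longrightarrow> J \<noteq> ?S \<Longrightarrow> J = M"
    using M by (auto simp: Specmax_def maximal_ideal_def ideal_in_iff)
  have M1: "ext0 X (\<lambda>_. 1) \<notin> M" using proper_ideal_iff[OF X Mi] MS by blast
  define S0 where "S0 = (\<lambda>f t. f (?\<psi> t)) ` ?S"
  define M0 where "M0 = (\<lambda>f t. f (?\<psi> t)) ` M"
  have S0I: "(\<lambda>t. f (?\<psi> t)) \<in> S0" if "f \<in> ?S" for f using that by (auto simp: S0_def)
  have sub: "subalg S0" unfolding S0_def by (rule pullback_subalg[OF X phi])
  have M0I: "(\<lambda>t. f (?\<psi> t)) \<in> M0" if "f \<in> M" for f using that by (auto simp: M0_def)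
  have S0P: "S0 \<subseteq> mpoly_fun j" using pullback_mpoly[OF n _ phi] by (auto simp: S0_def)
  have ideal: "fun_ideal S0 M0"
    unfolding fun_ideal_def
  proof (intro conjI ballI)
    show "M0 \<subseteq> S0" using fun_idealD(1)[OF Mi] by (auto simp: S0_def M0_def)
    show "(\<lambda>_. 0) \<in> M0" using fun_idealD(2)[OF Mi] by (force simp: M0_def)
    fix f assume "f \<in> M0"
    then obtain f' where f': "f' \<in> M" "f = (\<lambda>t. f' (?\<psi> t))" by (auto simp: M0_def)
    show "(\<lambda>x. f x + g x) \<in> M0" if "g \<in> M0" for g
    proof -
      obtain g' where g': "g' \<in> M" "g = (\<lambda>t. g' (?\<psi> t))" using \<open>g \<in> M0\<close> by (auto simp: M0_def)
      show ?thesis using M0I[OF fun_idealD(3)[OF Mi f'(1) g'(1)]] unfolding f'(2) g'(2) by simp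
    qed
    show "(\<lambda>x. s x * f x) \<in> M0" if "s \<in> S0" for s
    proof -
      obtain s' where s': "s' \<in> ?S" "s = (\<lambda>t. s' (?\<psi> t))" using \<open>s \<in> S0\<close> by (auto simp: S0_def)
      show ?thesis using M0I[OF fun_idealD(4)[OF Mi f'(1) s'(1)]] unfolding f'(2) s'(2) by simp
    qed
  qed
  have not1: "(\<lambda>_. 1) \<notin> M0"
  proof
    assume "(\<lambda>_. 1) \<in> M0"
    then obtain f where f: "f \<in> M" "(\<lambda>_. 1) = (\<lambda>t. f (?\<psi> t))" by (auto simp: M0_def)
    have f1: "f (?\<psi> t) = 1" for t using fun_cong[OF f(2), of t] by simp
    have fS: "f \<in> ?S" using f fun_idealD(1)[OF Mi] by blast
    \<comment> \<open>If \<open>f\<close> in \<open>M\<close> pulls back to 1, then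
      \<open>1 - f\<close> pulls back to 0 and lies in \<open>M\<close> as well.\<close>
    have "(\<lambda>x. ext0 X (\<lambda>_. 1) x + (- 1) * f x) \<in> M"
    proof (rule E)
      show "(\<lambda>x. ext0 X (\<lambda>_. 1) x + (- 1) * f x) \<in> ?S"
        by (intro inv_ring_add inv_ring_const[OF X] inv_ring_scale[OF X fS])
    qed (simp add: f1 phi ext0_def)
    from fun_idealD(3)[OF Mi this f(1)] show False using M1 by simp
  qed
  have "\<exists>c. \<forall>f\<in>M0. f c = 0"
  \<comment> \<open>Lying over asks for a positive degree, and \<open>2 * n\<close> is zero here;
    with no coordinates, degree 1 will do.\<close>
  proof (cases "n = 0")
    case True
    then have j0: "j = 0" using j by simp
    show ?thesis
    proof (rule lying_over[OF sub S0P _ _ ideal not1, of 1])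
      fix i assume "i < j"
      then show "\<exists>h. (\<forall>q<1. h q \<in> S0) \<and> (\<forall>t. t i ^ 1 = (\<Sum>q<1. h q t * t i ^ q))" using j0 by simp
    qed simp
  next
    case False
    show ?thesis
    proof (rule lying_over[OF sub S0P _ _ ideal not1, of "2 * n"])
      fix i assume i: "i < j"
      then have "i < n" using j by simp
      then obtain h where h: "\<And>q. q < 2 * n \<Longrightarrow> h q \<in> ?S \<or> h q = (\<lambda>_. 0)"
        "\<And>t. t i ^ (2 * n) = (\<Sum>q<2 * n. h q (phi n p m t) * t i ^ q)"
        using coordinate_integral[OF X n phi] by metis
      have "t i ^ (2 * n) = (\<Sum>q<2 * n. h q (?\<psi> t) * t i ^ q)" for t
        using h(2)[of "trunc j t"] i by (simp add: trunc_def)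
      moreover have "(\<lambda>t. h q (?\<psi> t)) \<in> S0" if "q < 2 * n" for q
        using h(1)[OF that] S0I subalgD(1)[OF sub, of 0] by auto
      ultimately show "\<exists>h. (\<forall>q<2 * n. h q \<in> S0) \<and> (\<forall>t. t i ^ (2 * n) = (\<Sum>q<2 * n. h q t * t i ^ q))"
        by (intro exI[of _ "\<lambda>q t. h q (?\<psi> t)"]) auto
    qed (use False in simp)
  qed
  then obtain c where c: "\<And>f. f \<in> M \<Longrightarrow> f (?\<psi> c) = 0" by (auto simp: M0_def)
  have "M \<subseteq> pt_ideal ?S (?\<psi> c)" using c fun_idealD(1)[OF Mi] by (auto simp: pt_ideal_def)
  moreover have "pt_ideal ?S (?\<psi> c) \<noteq> ?S"
    using pt_ideal_maximal[OF X phi] by (auto simp: Specmax_def maximal_ideal_def)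
  ultimately have "pt_ideal ?S (?\<psi> c) = M" by (intro max fun_ideal_pt_ideal[OF X])
  then show ?thesis using that by blast
qed

text \<open>The ideal quotient of \<open>M\<close> by \<open>g\<close> contains \<open>M\<close> and
  is proper when \<open>g\<close> is not in \<open>M\<close>, so it equals \<open>M\<close>.\<close>

lemma Specmax_prime:
  assumes X: "gvar n X" and M: "M \<in> Specmax (inv_ring n X)"
    and f: "f \<in> inv_ring n X" and g: "g \<in> inv_ring n X" and fg: "(\<lambda>x. f x * g x) \<in> M"
  shows "f \<in> M \<or> g \<in> M"
proof (rule ccontr)
  assume "\<not> ?thesis"
  then have fM: "f \<notin> M" and gM: "g \<notin> M" by auto
  let ?S = "inv_ring n X"
  have Mi: "fun_ideal ?S M"
    and max: "\<And>J. fun_ideal ?S J \<Longrightarrow> M \<subseteq> J \<Longrightarrow> J \<noteq> ?S \<Longrightarrow> J = M"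
    using M by (auto simp: Specmax_def maximal_ideal_def ideal_in_iff)
  define J where "J = {h \<in> ?S. (\<lambda>x. h x * g x) \<in> M}"
  have "fun_ideal ?S J"
    unfolding fun_ideal_def
  proof (intro conjI ballI)
    show "J \<subseteq> ?S" by (auto simp: J_def)
    show "(\<lambda>_. 0) \<in> J" using inv_ring_zero[OF X] fun_idealD(2)[OF Mi] by (simp add: J_def)
    fix a assume a: "a \<in> J"
    show "(\<lambda>x. a x + b x) \<in> J" if b: "b \<in> J" for b
      using a b fun_idealD(3)[OF Mi, of "\<lambda>x. a x * g x" "\<lambda>x. b x * g x"]
      by (auto simp: J_def distrib_right intro: inv_ring_add)
    show "(\<lambda>x. s x * a x) \<in> J" if s: "s \<in> ?S" for s
      using a s fun_idealD(4)[OF Mi, of "\<lambda>x. a x * g x" s]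
      by (auto simp: J_def mult.assoc intro: inv_ring_mult)
  qed
  moreover have "M \<subseteq> J"
    using fun_idealD(1)[OF Mi] fun_idealD(4)[OF Mi _ g] by (auto simp: J_def mult.commute)
  moreover have "J \<noteq> ?S"
  proof -
    have "(\<lambda>x. ext0 X (\<lambda>_. 1) x * g x) = g"
      using inv_ring_off[OF g] by (auto simp: ext0_def fun_eq_iff)
    then have "ext0 X (\<lambda>_. 1) \<notin> J" using gM by (simp add: J_def)
    then show ?thesis using inv_ring_const[OF X, of 1] by blast
  qed
  ultimately have "J = M" by (rule max)
  then show False using f fg fM by (auto simp: J_def)
qed

text \<open>If \<open>M\<close> came from no slice, each slice would carry an invariant vanishing on
  it but outside \<open>M\<close>. The product of these vanishes on all slices, hence is zero,
  against primality.\<close>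

lemma Specmax_cover:
  assumes X: "gvar n X" and W: "finite W" "\<And>p m. (p, m) \<in> W \<Longrightarrow> 2 * p + m \<le> n"
    and phi: "\<And>p m t. (p, m) \<in> W \<Longrightarrow> phi n p m t \<in> X"
    and 0: "\<And>f. f \<in> inv_ring n X \<Longrightarrow> (\<And>p m t. (p, m) \<in> W \<Longrightarrow> f (phi n p m t) = 0) \<Longrightarrow> f = (\<lambda>_. 0)"
    and M: "M \<in> Specmax (inv_ring n X)"
  shows "\<exists>p m t. (p, m) \<in> W \<and> M = pt_ideal (inv_ring n X) (phi n p m (trunc n t))"
proof (rule ccontr)
  assume neg: "\<not> ?thesis"
  let ?S = "inv_ring n X"
  have Mi: "fun_ideal ?S M" and MS: "M \<noteq> ?S"
    using M by (auto simp: Specmax_def maximal_ideal_def ideal_in_iff)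
  have "\<exists>f. f \<in> ?S \<and> f \<notin> M \<and> (\<forall>t. f (phi n (fst w) (snd w) (trunc n t)) = 0)" if w: "w \<in> W" for w
  proof (rule ccontr)
    assume none: "\<not> ?thesis"
    obtain p m where pm: "w = (p, m)" by (cases w)
    show False
    proof (rule maximal_on_slice[OF X W(2)[of p m] phi[of p m] M le_refl])
      fix t assume "M = pt_ideal ?S (phi n p m (trunc n t))"
      then show False using neg w pm by blast
    qed (use none w pm in auto)
  qed
  then obtain F where F: "\<And>w. w \<in> W \<Longrightarrow> F w \<in> ?S" "\<And>w. w \<in> W \<Longrightarrow> F w \<notin> M"
    "\<And>w t. w \<in> W \<Longrightarrow> F w (phi n (fst w) (snd w) (trunc n t)) = 0" by metis
  have "\<exists>f. f \<in> ?S \<and> f \<notin> M \<and> (\<forall>w\<in>W. \<forall>t. f (phi n (fst w) (snd w) (trunc n t)) = 0)"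
    using W(1) F
  proof (induction W)
    case empty
    have "ext0 X (\<lambda>_. 1) \<notin> M" using proper_ideal_iff[OF X Mi] MS by blast
    then show ?case using inv_ring_const[OF X, of 1] by blast
  next
    case (insert w W)
    then obtain f where f: "f \<in> ?S" "f \<notin> M" "\<forall>w\<in>W. \<forall>t. f (phi n (fst w) (snd w) (trunc n t)) = 0" by auto
    have "(\<lambda>x. F w x * f x) \<in> ?S" using insert.prems f by (intro inv_ring_mult) auto
    moreover have "(\<lambda>x. F w x * f x) \<notin> M"
      using Specmax_prime[OF X M insert.prems(1)[of w] f(1)] insert.prems(2)[of w] f(2) by auto
    ultimately show ?case using f insert.prems(3) by (intro exI[of _ "\<lambda>x. F w x * f x"]) auto
  qed
  then obtain f where f: "f \<in> ?S" "f \<notin> M" "\<And>w t. w \<in> W \<Longrightarrow> f (phi n (fst w) (snd w) (trunc n t)) = 0" by blast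
  have "f = (\<lambda>_. 0)"
  proof (rule 0[OF f(1)])
    fix p m t assume w: "(p, m) \<in> W"
    have "phi n p m t = phi n p m (trunc n t)"
      unfolding phi_def prod.inject by (intro conjI cong_mat) (auto simp: trunc_def)
    then show "f (phi n p m t) = 0" using f(3)[OF w, of t] by simp
  qed
  then show False using f(2) fun_idealD(2)[OF Mi] by simp
qed


text \<open>The product is a power of the variable, with exponent \<open>n - card K\<close>, times a
  polynomial with nonzero constant term; so its lowest nonzero coefficient counts the nonzero
  roots.\<close>

lemma prod_linear_coeff:
  fixes d :: "nat \<Rightarrow> complex"
  assumes K: "K = {l. l < n \<and> d l \<noteq> 0}"
  shows "q = card K \<Longrightarrow> coeff (\<Prod>l<n. [:- d l, 1:]) (n - q) \<noteq> 0"
    and "card K < q \<Longrightarrow> q \<le> n \<Longrightarrow> coeff (\<Prod>l<n. [:- d l, 1:]) (n - q) = 0"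
proof -
  have fin: "K \<subseteq> {..<n}" "finite K" unfolding K by auto
  have le: "card K \<le> n" using card_mono[OF _ fin(1)] by simp
  have "(\<Prod>l<n. [:- d l, 1:]) = (\<Prod>l\<in>{..<n} - K. [:- d l, 1:]) * (\<Prod>l\<in>K. [:- d l, 1:])"
    by (rule prod.subset_diff[OF fin(1)]) simp
  also have "(\<Prod>l\<in>{..<n} - K. [:- d l, 1:]) = (\<Prod>l\<in>{..<n} - K. [:0, 1:])"
    by (rule prod.cong) (auto simp: K)
  also have "\<dots> = monom 1 (n - card K)"
    using fin by (simp add: card_Diff_subset monom_altdef)
  finally have P: "(\<Prod>l<n. [:- d l, 1:]) = monom 1 (n - card K) * (\<Prod>l\<in>K. [:- d l, 1:])" .
  show "coeff (\<Prod>l<n. [:- d l, 1:]) (n - q) \<noteq> 0" if "q = card K"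
  proof -
    have "coeff (\<Prod>l<n. [:- d l, 1:]) (n - q) = poly (\<Prod>l\<in>K. [:- d l, 1:]) 0"
      using that by (simp add: P coeff_monom_mult poly_0_coeff_0)
    also have "\<dots> \<noteq> 0" using fin(2) by (auto simp: poly_prod K)
    finally show ?thesis .
  qed
  show "coeff (\<Prod>l<n. [:- d l, 1:]) (n - q) = 0" if "card K < q" "q \<le> n"
    using that by (simp add: P coeff_monom_mult)
qed

section \<open>Strata of a slice: closedness, irreducibility and dimension\<close>

locale invariant_slice =
  fixes n p m :: nat and X :: "pt set"
  assumes gvar: "gvar n X" and le: "2 * p + m \<le> n" and phi_in: "phi n p m t \<in> X"
begin

abbreviation S :: "(pt \<Rightarrow> complex) set" where
  "S \<equiv> inv_ring n X"

text \<open>The image in the quotient of the coordinate subspace of dimension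
  \<open>j\<close>.\<close>

definition stratum :: "nat \<Rightarrow> (pt \<Rightarrow> complex) set set" where
  "stratum j = range (\<lambda>t. pt_ideal S (phi n p m (trunc j t)))"

lemma stratum_Specmax: "stratum j \<subseteq> Specmax S"
  unfolding stratum_def using pt_ideal_maximal[OF gvar phi_in] by blast

text \<open>Its equations are the invariants vanishing on the coordinate subspace;
  \<open>maximal_on_slice\<close> shows that they admit no further maximal ideals.\<close>

lemma stratum_zclosed:
  assumes j: "j \<le> n"
  shows "zclosed S (stratum j)"
proof -
  let ?E = "{f \<in> S. \<forall>t. f (phi n p m (trunc j t)) = 0}"
  have "stratum j = {M \<in> Specmax S. ?E \<subseteq> M}"
  proof
    show "stratum j \<subseteq> {M \<in> Specmax S. ?E \<subseteq> M}"
      using stratum_Specmax[of j] by (auto simp: stratum_def pt_ideal_def)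
    show "{M \<in> Specmax S. ?E \<subseteq> M} \<subseteq> stratum j"
    proof
      fix M assume M: "M \<in> {M \<in> Specmax S. ?E \<subseteq> M}"
      show "M \<in> stratum j"
        by (rule maximal_on_slice[OF gvar le phi_in _ j, of M]) (use M in \<open>auto simp: stratum_def\<close>)
    qed
  qed
  then show ?thesis unfolding zclosed_def by (intro exI[of _ ?E]) auto
qed

text \<open>Pullback lands in an integral domain, so two invariants that are each nonzero somewhere
  on the subspace have a product that is nonzero somewhere.\<close>

lemma stratum_zirred:
  assumes j: "j \<le> n"
  shows "zirred S (stratum j)"
  unfolding zirred_def
proof (intro conjI allI impI)
  show "zclosed S (stratum j)" by (rule stratum_zclosed[OF j])
  show "stratum j \<noteq> {}" by (simp add: stratum_def)
  fix C1 C2 assume *: "zclosed S C1 \<and> zclosed S C2 \<and> stratum j \<subseteq> C1 \<union> C2"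
  show "stratum j \<subseteq> C1 \<or> stratum j \<subseteq> C2"
  proof (rule ccontr)
    assume neg: "\<not> ?thesis"
    have sep: "\<exists>f\<in>S. (\<exists>t. f (phi n p m (trunc j t)) \<noteq> 0) \<and> (\<forall>M\<in>C. f \<in> M)"
      if C: "zclosed S C" "\<not> stratum j \<subseteq> C" for C
    proof -
      obtain E where E: "E \<subseteq> S" "C = {M \<in> Specmax S. E \<subseteq> M}" using C(1) by (auto simp: zclosed_def)
      obtain t where "pt_ideal S (phi n p m (trunc j t)) \<notin> C" using C(2) by (auto simp: stratum_def)
      then obtain f where "f \<in> E" "f \<notin> pt_ideal S (phi n p m (trunc j t))"
        using E(2) pt_ideal_maximal[OF gvar phi_in] by blast
      then show ?thesis using E by (intro bexI[of _ f]) (auto simp: pt_ideal_def)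
    qed
    obtain f where f: "f \<in> S" "\<exists>t. f (phi n p m (trunc j t)) \<noteq> 0" "\<forall>M\<in>C1. f \<in> M"
      using sep[of C1] * neg by blast
    obtain g where g: "g \<in> S" "\<exists>t. g (phi n p m (trunc j t)) \<noteq> 0" "\<forall>M\<in>C2. g \<in> M"
      using sep[of C2] * neg by blast
    have "f (phi n p m (trunc j t)) * g (phi n p m (trunc j t)) = 0" for t
    proof -
      have "pt_ideal S (phi n p m (trunc j t)) \<in> C1 \<union> C2" using * by (auto simp: stratum_def)
      then have "f \<in> pt_ideal S (phi n p m (trunc j t)) \<or> g \<in> pt_ideal S (phi n p m (trunc j t))"
        using f(3) g(3) by blast
      then show ?thesis by (auto simp: pt_ideal_def)
    qed
    from mpoly_fun_domain[OF pullback_mpoly[OF le f(1) phi_in] pullback_mpoly[OF le g(1) phi_in] this]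
    show False using f(2) g(2) by blast
  qed
qed

lemma stratum_mono: "i \<le> j \<Longrightarrow> stratum i \<subseteq> stratum j"
proof -
  assume "i \<le> j"
  then have "trunc i t = trunc j (trunc i t)" for t by (auto simp: trunc_def fun_eq_iff)
  then show ?thesis unfolding stratum_def by (metis (no_types, lifting) image_subsetI rangeI)
qed

text \<open>The number of nonzero eigenvalues of \<open>A\<^sup>2\<close> or of \<open>B\<^sup>2\<close> jumps when one more coordinate
  becomes nonzero; a coefficient of the characteristic polynomial detects this.\<close>

lemma stratum_strict:
  assumes j: "j < n"
  shows "stratum j \<subset> stratum (Suc j)"
proof -
  have main: "\<exists>f\<in>S. f (phi n p m (trunc (Suc j) (\<lambda>_. 1))) \<noteq> 0 \<and> (\<forall>t. f (phi n p m (trunc j t)) = 0)"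
    if I: "\<And>q. I q \<in> S" "\<And>t q. I q (phi n p m t) = coeff (\<Prod>i<n. [:- d t i, 1:]) q"
      and l: "l < n" "\<And>t. d t l = t j ^ 2"
      and d: "\<And>i t l. d (trunc i t) l \<noteq> 0 \<Longrightarrow> d (trunc i (\<lambda>_. 1)) l \<noteq> 0"
        "\<And>i l. d (trunc i (\<lambda>_. 1)) l \<noteq> 0 \<Longrightarrow> d (trunc (Suc i) (\<lambda>_. 1)) l \<noteq> 0"
    for I :: "nat \<Rightarrow> pt \<Rightarrow> complex" and d :: "(nat \<Rightarrow> complex) \<Rightarrow> nat \<Rightarrow> complex" and l
  proof -
    define K where "K = (\<lambda>t. {l. l < n \<and> d t l \<noteq> 0})"
    \<comment> \<open>Among the points of a coordinate subspace the all-ones point has the largest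
      set of nonzero values of \<open>d\<close>, so every point of the smaller subspace has fewer
      than \<open>q\<close> of them.\<close>
    define q where "q = card (K (trunc (Suc j) (\<lambda>_. 1)))"
    have fin: "finite (K t)" "K t \<subseteq> {..<n}" for t by (auto simp: K_def)
    have q: "q \<le> n" unfolding q_def using card_mono[OF _ fin(2)] by simp
    have "card (K (trunc j t)) < q" for t
      unfolding q_def
    proof (rule psubset_card_mono[OF fin(1)])
      have "K (trunc j t) \<subseteq> K (trunc (Suc j) (\<lambda>_. 1))" using d by (auto simp: K_def)
      moreover have "l \<in> K (trunc (Suc j) (\<lambda>_. 1))" "l \<notin> K (trunc j t)"
        using l by (auto simp: K_def trunc_def)
      ultimately show "K (trunc j t) \<subset> K (trunc (Suc j) (\<lambda>_. 1))" by blast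
    qed
    then have "I (n - q) (phi n p m (trunc j t)) = 0" for t
      unfolding I(2) by (intro prod_linear_coeff(2)[OF _ _ q]) (auto simp: K_def)
    moreover have "I (n - q) (phi n p m (trunc (Suc j) (\<lambda>_. 1))) \<noteq> 0"
      unfolding I(2) by (rule prod_linear_coeff(1)[OF _ q_def]) (simp add: K_def)
    ultimately show ?thesis using I(1) by blast
  qed
  have "\<exists>f\<in>S. f (phi n p m (trunc (Suc j) (\<lambda>_. 1))) \<noteq> 0 \<and> (\<forall>t. f (phi n p m (trunc j t)) = 0)"
    using coordinate_square[OF j le]
  proof (elim disjE exE conjE)
    fix l assume "l < n" "\<forall>t. sq_A p m t l = t j ^ 2"
    then show ?thesis
      by (intro main[where I = "inv_A n X" and d = "sq_A p m"] inv_AB_in[OF gvar] inv_AB_phi[OF le phi_in])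
         (auto simp: sq_A_def trunc_def split: if_splits)
  next
    fix l assume "l < n" "\<forall>t. sq_B p m t l = t j ^ 2"
    then show ?thesis
      by (intro main[where I = "inv_B n X" and d = "sq_B p m"] inv_AB_in[OF gvar] inv_AB_phi[OF le phi_in])
         (auto simp: sq_B_def trunc_def split: if_splits)
  qed
  then obtain f where f: "f \<in> S" "f (phi n p m (trunc (Suc j) (\<lambda>_. 1))) \<noteq> 0"
    "\<And>t. f (phi n p m (trunc j t)) = 0" by blast
  let ?M = "pt_ideal S (phi n p m (trunc (Suc j) (\<lambda>_. 1)))"
  have "?M \<in> stratum (Suc j)" by (simp add: stratum_def)
  moreover have "?M \<notin> stratum j"
  proof
    assume "?M \<in> stratum j"
    then obtain t where "?M = pt_ideal S (phi n p m (trunc j t))" by (auto simp: stratum_def)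
    then show False using f by (auto simp: pt_ideal_def)
  qed
  ultimately show ?thesis using stratum_mono[of j "Suc j"] by auto
qed

text \<open>A chain with \<open>n + 1\<close> steps would give \<open>n + 1\<close> separating
  invariants, whose pullbacks are independent because of the chain and dependent because they have
  \<open>n\<close> variables.\<close>

lemma chain_length_le:
  assumes irr: "\<And>i. i \<le> k \<Longrightarrow> zirred S (c i) \<and> c i \<subseteq> stratum n"
    and strict: "\<And>i. i < k \<Longrightarrow> c i \<subset> c (Suc i)"
  shows "k \<le> n"
proof (rule ccontr)
  assume "\<not> k \<le> n"
  then have k: "n < k" by simp
  let ?\<psi> = "\<lambda>t. phi n p m (trunc n t)"
  define S0 where "S0 = (\<lambda>f t. f (?\<psi> t)) ` S"
  have S0: "subalg S0" unfolding S0_def by (rule pullback_subalg[OF gvar phi_in])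
  \<comment> \<open>The chain seen in parameter space. Primeness of \<open>T j\<close> is claimed
    for functions in \<open>S0\<close> only, since irreducibility in the quotient speaks of
    invariants.\<close>
  define T where "T = (\<lambda>i. {t. pt_ideal S (?\<psi> t) \<in> c i})"
  have cT: "\<exists>t\<in>T i. M = pt_ideal S (?\<psi> t)" if "M \<in> c i" "i \<le> k" for M i
    using irr[OF that(2)] that(1) by (auto simp: T_def stratum_def)
  have "\<exists>f\<in>S. (\<forall>t\<in>T i. f (?\<psi> t) = 0) \<and> (\<exists>t\<in>T (Suc i). f (?\<psi> t) \<noteq> 0)" if i: "i < k" for i
  proof -
    obtain E where E: "E \<subseteq> S" "c i = {M \<in> Specmax S. E \<subseteq> M}"
      using irr[of i] i by (auto simp: zirred_def zclosed_def)
    obtain M where M: "M \<in> c (Suc i)" "M \<notin> c i" using strict[OF i] by blast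
    then obtain t where t: "t \<in> T (Suc i)" "M = pt_ideal S (?\<psi> t)" using cT[of M "Suc i"] i by auto
    then obtain f where f: "f \<in> E" "f \<notin> M" using M(2) E(2) pt_ideal_maximal[OF gvar phi_in] by blast
    have "f (?\<psi> t') = 0" if "t' \<in> T i" for t'
      using that E f(1) by (auto simp: T_def pt_ideal_def)
    then show ?thesis using f E(1) t by (intro bexI[of _ f]) (auto simp: pt_ideal_def)
  qed
  then obtain f where f: "\<And>i. i < k \<Longrightarrow> f i \<in> S" "\<And>i t. i < k \<Longrightarrow> t \<in> T i \<Longrightarrow> f i (?\<psi> t) = 0"
    "\<And>i. i < k \<Longrightarrow> \<exists>t\<in>T (Suc i). f i (?\<psi> t) \<noteq> 0" by metis
  define F where "F = (\<lambda>i t. f i (?\<psi> t))"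
  let ?fs = "map F (rev [0..<n + 1])"
  have "set ?fs \<subseteq> mpoly_fun n"
    using pullback_mpoly[OF le f(1) phi_in] k by (auto simp: F_def)
  then obtain N e where e: "\<exists>l\<in>explists N (n + 1). e l \<noteq> 0" "\<And>t. eval_rel N e ?fs t = 0"
    using algebraic_dependence[of ?fs n] by (metis length_map length_rev length_upt diff_zero)
  have "\<exists>t\<in>T (n + 1). eval_rel N e ?fs t \<noteq> 0"
  proof (rule chain_algebraically_independent[OF S0 _ _ _ _ _ _ e(1)])
    show "T 0 \<noteq> {}" using irr[of 0] cT[of _ 0] by (auto simp: zirred_def)
    show "T j \<subseteq> T (Suc j)" if "j < n + 1" for j using strict[of j] that k by (auto simp: T_def)
    show "F j \<in> S0" "t \<in> T j \<Longrightarrow> F j t = 0" "\<exists>t\<in>T (Suc j). F j t \<noteq> 0" if "j < n + 1" for j t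
      using f[of j] that k by (auto simp: F_def S0_def)
    fix j g h assume j: "j \<le> n + 1" and "g \<in> S0" "h \<in> S0" and 0: "\<And>t. t \<in> T j \<Longrightarrow> g t * h t = 0"
    then obtain g' h' where g': "g' \<in> S" "g = (\<lambda>t. g' (?\<psi> t))" and h': "h' \<in> S" "h = (\<lambda>t. h' (?\<psi> t))"
      by (auto simp: S0_def)
    let ?C = "\<lambda>g. {M \<in> Specmax S. {g} \<subseteq> M}"
    have "zclosed S (?C g')" "zclosed S (?C h')" using g'(1) h'(1) unfolding zclosed_def by blast+
    moreover have "c j \<subseteq> ?C g' \<union> ?C h'"
    proof
      fix M assume M: "M \<in> c j"
      then obtain t where t: "t \<in> T j" "M = pt_ideal S (?\<psi> t)" using cT[of M j] j k by auto
      then have "g' (?\<psi> t) = 0 \<or> h' (?\<psi> t) = 0" using 0[OF t(1)] g' h' by simp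
      then show "M \<in> ?C g' \<union> ?C h'"
        using t(2) g'(1) h'(1) pt_ideal_maximal[OF gvar phi_in] by (auto simp: pt_ideal_def)
    qed
    ultimately have "c j \<subseteq> ?C g' \<or> c j \<subseteq> ?C h'" using irr[of j] j k unfolding zirred_def by auto
    then show "(\<forall>t\<in>T j. g t = 0) \<or> (\<forall>t\<in>T j. h t = 0)"
      by (auto simp: T_def g'(2) h'(2) pt_ideal_def)
  qed
  then show False using e(2) by blast
qed

lemma zdim_stratum: "zdim S (stratum n) = enat n"
  unfolding zdim_def
proof (rule antisym)
  show "Sup {enat k |k. \<exists>c. (\<forall>i\<le>k. zirred S (c i) \<and> c i \<subseteq> stratum n) \<and> (\<forall>i<k. c i \<subset> c (Suc i))} \<le> enat n"
  proof (rule Sup_least, clarify)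
    fix k c assume "\<forall>i\<le>k. zirred S (c i) \<and> c i \<subseteq> stratum n" "\<forall>i<k. c i \<subset> c (Suc i)"
    then have "k \<le> n" by (intro chain_length_le[of k c]) auto
    then show "enat k \<le> enat n" by simp
  qed
  show "enat n \<le> Sup {enat k |k. \<exists>c. (\<forall>i\<le>k. zirred S (c i) \<and> c i \<subseteq> stratum n) \<and> (\<forall>i<k. c i \<subset> c (Suc i))}"
    by (rule Sup_upper) (use stratum_zirred stratum_mono stratum_strict in blast)
qed

end

section \<open>Irreducible components\<close>

text \<open>Products of an equation of each set cut out the union, because maximal ideals are
  prime.\<close>

lemma zclosed_union:
  assumes X: "gvar n X" and C: "zclosed (inv_ring n X) C1" "zclosed (inv_ring n X) C2"
  shows "zclosed (inv_ring n X) (C1 \<union> C2)"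
proof -
  let ?S = "inv_ring n X"
  obtain E1 E2 where E: "E1 \<subseteq> ?S" "C1 = {M \<in> Specmax ?S. E1 \<subseteq> M}"
    "E2 \<subseteq> ?S" "C2 = {M \<in> Specmax ?S. E2 \<subseteq> M}" using C by (auto simp: zclosed_def)
  let ?E = "{(\<lambda>x. f x * g x) | f g. f \<in> E1 \<and> g \<in> E2}"
  have "C1 \<union> C2 = {M \<in> Specmax ?S. ?E \<subseteq> M}"
  proof (intro equalityI subsetI)
    fix M assume M: "M \<in> C1 \<union> C2"
    then have MS: "M \<in> Specmax ?S" using E by blast
    then have Mi: "fun_ideal ?S M" by (simp add: Specmax_def maximal_ideal_def ideal_in_iff)
    have "(\<lambda>x. f x * g x) \<in> M" if fg: "f \<in> E1" "g \<in> E2" for f g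
    proof -
      have "f \<in> M \<or> g \<in> M" using M E fg by blast
      then show ?thesis
        using fun_idealD(4)[OF Mi, of f g] fun_idealD(4)[OF Mi, of g f] fg E by (auto simp: mult.commute)
    qed
    then show "M \<in> {M \<in> Specmax ?S. ?E \<subseteq> M}" using MS by blast
  next
    fix M assume M: "M \<in> {M \<in> Specmax ?S. ?E \<subseteq> M}"
    show "M \<in> C1 \<union> C2"
    proof (rule ccontr)
      assume "M \<notin> C1 \<union> C2"
      then obtain f g where fg: "f \<in> E1" "f \<notin> M" "g \<in> E2" "g \<notin> M" using M E by blast
      then have fgM: "(\<lambda>x. f x * g x) \<in> M" using M by blast
      show False using Specmax_prime[OF X _ _ _ fgM] M fg E by blast
    qed
  qed
  moreover have "?E \<subseteq> ?S" using E inv_ring_mult by blast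
  ultimately show ?thesis unfolding zclosed_def by blast
qed

lemma zclosed_empty:
  assumes X: "gvar n X"
  shows "zclosed (inv_ring n X) {}"
proof -
  have "{} = {M \<in> Specmax (inv_ring n X). {ext0 X (\<lambda>_. 1)} \<subseteq> M}"
    using proper_ideal_iff[OF X] by (auto simp: Specmax_def maximal_ideal_def ideal_in_iff)
  then show ?thesis unfolding zclosed_def using inv_ring_const[OF X] by blast
qed

lemma zirred_finite_union:
  assumes X: "gvar n X" and C: "zirred (inv_ring n X) C" and W: "finite W"
    and D: "\<And>w. w \<in> W \<Longrightarrow> zclosed (inv_ring n X) (D w)" and sub: "C \<subseteq> (\<Union>w\<in>W. D w)"
  shows "\<exists>w\<in>W. C \<subseteq> D w"
proof -
  have closed: "zclosed (inv_ring n X) (\<Union>w\<in>V. D w)" if "finite V" "V \<subseteq> W" for V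
    using that by (induction V) (auto intro: zclosed_empty[OF X] zclosed_union[OF X] D)
  have "\<exists>w\<in>V. C \<subseteq> D w" if "finite V" "V \<subseteq> W" "C \<subseteq> (\<Union>w\<in>V. D w)" for V
    using that
  proof (induction V)
    case empty
    then show ?case using C by (auto simp: zirred_def)
  next
    case (insert w V)
    have "C \<subseteq> D w \<or> C \<subseteq> (\<Union>w\<in>V. D w)"
      using C closed[of V] D[of w] insert.prems insert.hyps unfolding zirred_def by auto
    then show ?case using insert by auto
  qed
  then show ?thesis using W sub by blast
qed

lemma slice_Zn:
  assumes "2 * p + m \<le> n"
  shows "invariant_slice n p m (Zn n)"
  by unfold_locales (use gvar_Zn phi_Zn assms in auto)

lemma slice_Z_pmr:
  assumes "2 * p + m \<le> n"
  shows "invariant_slice n p m (Z_pmr n p m r)"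
  by unfold_locales (use gvar_Z_pmr phi_Z_pmr assms in auto)

section \<open>Components of the quotient of the whole variety\<close>

definition types :: "nat \<Rightarrow> (nat \<times> nat) set" where
  "types n = {(p, m). 2 * p + m \<le> n}"

lemma finite_types: "finite (types n)"
  by (rule finite_subset[of _ "{..n} \<times> {..n}"]) (auto simp: types_def)

text \<open>The image of the full slice of type \<open>w\<close>;
  \<open>component_zcomponent\<close> justifies the name.\<close>

definition component :: "nat \<Rightarrow> nat \<times> nat \<Rightarrow> (pt \<Rightarrow> complex) set set" where
  "component n w = invariant_slice.stratum n (fst w) (snd w) (Zn n) n"

lemma Specmax_Zn: "Specmax (inv_ring n (Zn n)) = (\<Union>w\<in>types n. component n w)"
proof
  show "Specmax (inv_ring n (Zn n)) \<subseteq> (\<Union>w\<in>types n. component n w)"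
  proof
    fix M assume M: "M \<in> Specmax (inv_ring n (Zn n))"
    have "\<exists>p m t. (p, m) \<in> types n \<and> M = pt_ideal (inv_ring n (Zn n)) (phi n p m (trunc n t))"
      by (rule Specmax_cover[OF gvar_Zn finite_types _ _ _ M])
         (auto simp: types_def intro: phi_Zn Zn_vanish)
    then obtain p m t where w: "(p, m) \<in> types n"
      "M = pt_ideal (inv_ring n (Zn n)) (phi n p m (trunc n t))" by blast
    then interpret invariant_slice n p m "Zn n" by (intro slice_Zn) (simp add: types_def)
    have "M \<in> component n (p, m)" using w by (simp add: component_def stratum_def)
    then show "M \<in> (\<Union>w\<in>types n. component n w)" using w by blast
  qed
  show "(\<Union>w\<in>types n. component n w) \<subseteq> Specmax (inv_ring n (Zn n))"
    by (rule UN_least)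
       (simp add: types_def component_def case_prod_beta invariant_slice.stratum_Specmax[OF slice_Zn])
qed

lemma component_zirred: "w \<in> types n \<Longrightarrow> zirred (inv_ring n (Zn n)) (component n w)"
  using invariant_slice.stratum_zirred[OF slice_Zn] by (auto simp: types_def component_def)

lemma zdim_component: "w \<in> types n \<Longrightarrow> zdim (inv_ring n (Zn n)) (component n w) = enat n"
  using invariant_slice.zdim_stratum[OF slice_Zn] by (auto simp: types_def component_def)

lemma zirred_subset_component:
  assumes "zirred (inv_ring n (Zn n)) C"
  shows "\<exists>w\<in>types n. C \<subseteq> component n w"
proof (rule zirred_finite_union[OF gvar_Zn assms finite_types])
  show "zclosed (inv_ring n (Zn n)) (component n w)" if "w \<in> types n" for w
    using component_zirred[OF that] by (simp add: zirred_def)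
  show "C \<subseteq> (\<Union>w\<in>types n. component n w)"
    using assms unfolding Specmax_Zn[symmetric] by (auto simp: zirred_def zclosed_def)
qed

text \<open>A strict inclusion would put one more member on top of the \<open>n + 1\<close> strata
  of type \<open>v\<close>, a chain too long for the slice of type \<open>w\<close>.\<close>

lemma component_inclusion_eq:
  assumes v: "v \<in> types n" and w: "w \<in> types n" and sub: "component n v \<subseteq> component n w"
  shows "component n v = component n w"
proof (rule ccontr)
  assume ne: "component n v \<noteq> component n w"
  interpret v: invariant_slice n "fst v" "snd v" "Zn n" using v by (intro slice_Zn) (auto simp: types_def)
  interpret w: invariant_slice n "fst w" "snd w" "Zn n" using w by (intro slice_Zn) (auto simp: types_def)
  define c where "c = (\<lambda>i. if i \<le> n then v.stratum i else component n w)"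
  have "Suc n \<le> n"
  proof (rule w.chain_length_le)
    show "zirred w.S (c i) \<and> c i \<subseteq> w.stratum n" if "i \<le> Suc n" for i
      using v.stratum_zirred[of i] v.stratum_mono[of i n] component_zirred[OF w] sub
      by (auto simp: c_def component_def)
    show "c i \<subset> c (Suc i)" if "i < Suc n" for i
    proof (cases "i = n")
      case True
      then show ?thesis using sub ne by (auto simp: c_def component_def)
    next
      case False
      then show ?thesis using v.stratum_strict[of i] that by (simp add: c_def)
    qed
  qed
  then show False by simp
qed

lemma component_zcomponent:
  assumes w: "w \<in> types n"
  shows "zcomponent (inv_ring n (Zn n)) (component n w)"
  unfolding zcomponent_def
proof (intro conjI allI impI)
  show "zirred (inv_ring n (Zn n)) (component n w)" by (rule component_zirred[OF w])
  fix D assume D: "zirred (inv_ring n (Zn n)) D \<and> component n w \<subseteq> D"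
  then obtain v where v: "v \<in> types n" "D \<subseteq> component n v" using zirred_subset_component by blast
  then have "component n w = component n v" using component_inclusion_eq[OF w v(1)] D by blast
  then show "D = component n w" using D v by blast
qed

text \<open>On \<open>Z_pmr\<close> an invariant vanishing on the slice of its own type is zero, so
  this slice alone covers the spectrum.\<close>

lemma git_quot_Z_pmr:
  assumes "2 * p + m \<le> n"
  shows "git_quot n (Z_pmr n p m r) = invariant_slice.stratum n p m (Z_pmr n p m r) n"
proof -
  interpret invariant_slice n p m "Z_pmr n p m r" by (rule slice_Z_pmr[OF assms])
  have "M \<in> stratum n" if M: "M \<in> Specmax S" for M
  proof -
    have "\<exists>p' m' t. (p', m') \<in> {(p, m)} \<and> M = pt_ideal S (phi n p' m' (trunc n t))"
    proof (rule Specmax_cover[OF gvar _ _ _ _ M])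
      fix f assume "f \<in> S" and "\<And>p' m' t. (p', m') \<in> {(p, m)} \<Longrightarrow> f (phi n p' m' t) = 0"
      then show "f = (\<lambda>_. 0)" by (intro Z_pmr_vanish[OF le]) auto
    qed (use le phi_in in auto)
    then show ?thesis by (auto simp: stratum_def)
  qed
  then show ?thesis using stratum_Specmax[of n] by (auto simp: git_quot_def)
qed

lemma inv_ring_restrict:
  assumes f: "f \<in> inv_ring n (Zn n)"
  shows "ext0 (Z_pmr n p m r) f \<in> inv_ring n (Z_pmr n p m r)"
proof -
  obtain q where q: "q \<in> poly_fun n" "f = ext0 (Zn n) q" using f by (rule inv_ringE)
  have "ext0 (Z_pmr n p m r) f = ext0 (Z_pmr n p m r) q"
    by (auto simp: q(2) ext0_def fun_eq_iff dest: subsetD[OF Z_pmr_Zn])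
  then show ?thesis
  proof (rule inv_ringI[OF q(1)])
    fix g h x assume G: "GLpair n g h" and x: "x \<in> Z_pmr n p m r"
    have "x \<in> Zn n" using subsetD[OF Z_pmr_Zn x] .
    then show "ext0 (Z_pmr n p m r) f (conj_act g h x) = ext0 (Z_pmr n p m r) f x"
      using gvarD(3)[OF gvar_Z_pmr G x] inv_ring_conj[OF f G] x by (simp add: ext0_def)
  qed
qed

text \<open>Restriction does not change the value of an invariant at \<open>x\<close>.\<close>

lemma quot_embed_pt_ideal:
  assumes x: "x \<in> Z_pmr n p m r"
  shows "quot_embed n (Zn n) (Z_pmr n p m r) (pt_ideal (inv_ring n (Z_pmr n p m r)) x)
    = pt_ideal (inv_ring n (Zn n)) x"
  using inv_ring_restrict x by (auto simp: quot_embed_def pt_ideal_def ext0_def)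

text \<open>Both sides are parametrised by the same slice points, which lie in \<open>Z_pmr\<close>
  as well as in \<open>Zn\<close>.\<close>

lemma quot_embed_image:
  assumes "2 * p + m \<le> n"
  shows "quot_embed n (Zn n) (Z_pmr n p m r) ` git_quot n (Z_pmr n p m r) = component n (p, m)"
proof -
  interpret Z: invariant_slice n p m "Z_pmr n p m r" by (rule slice_Z_pmr[OF assms])
  interpret R: invariant_slice n p m "Zn n" by (rule slice_Zn[OF assms])
  show ?thesis
    unfolding git_quot_Z_pmr[OF assms] Z.stratum_def component_def fst_conv snd_conv R.stratum_def
      image_image quot_embed_pt_ideal[OF Z.phi_in] ..
qed

theorem theorem5p4:
  fixes n :: nat
  assumes "n \<ge> 1"
  shows "(\<forall>C. zcomponent (inv_ring n (Zn n)) C \<longrightarrow> zdim (inv_ring n (Zn n)) C = enat n)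
    \<and> (\<forall>p m r. 2 * p + m + r = n \<longrightarrow>
         zcomponent (inv_ring n (Zn n)) (quot_embed n (Zn n) (Z_pmr n p m r) ` git_quot n (Z_pmr n p m r))
       \<and> zdim (inv_ring n (Z_pmr n p m r)) (git_quot n (Z_pmr n p m r)) = enat n)"
proof (intro conjI allI impI)
  fix C assume C: "zcomponent (inv_ring n (Zn n)) C"
  \<comment> \<open>Pure dimension concerns an arbitrary component: being irreducible it lies in one
    of the sets \<open>component n w\<close>, and by maximality it equals that set.\<close>
  then obtain w where w: "w \<in> types n" "C \<subseteq> component n w"
    using zirred_subset_component[of n C] unfolding zcomponent_def by blast
  then have "C = component n w" using C component_zirred[OF w(1)] by (auto simp: zcomponent_def)
  then show "zdim (inv_ring n (Zn n)) C = enat n" using zdim_component[OF w(1)] by simp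
next
  fix p m r assume "2 * p + m + r = n"
  then have le: "2 * p + m \<le> n" by simp
  show "zcomponent (inv_ring n (Zn n)) (quot_embed n (Zn n) (Z_pmr n p m r) ` git_quot n (Z_pmr n p m r))"
    unfolding quot_embed_image[OF le] by (rule component_zcomponent) (use le in \<open>simp add: types_def\<close>)
  show "zdim (inv_ring n (Z_pmr n p m r)) (git_quot n (Z_pmr n p m r)) = enat n"
    unfolding git_quot_Z_pmr[OF le] by (rule invariant_slice.zdim_stratum[OF slice_Z_pmr[OF le]])
qed

end
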